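(* If $G=(V,E)$ is a topological graph where $V$ is a compact Hausdorff space and if $\omega$ is a Radon measure on $V$, then $\mathrm{lass}_{r+2}(G)\leq\Delta_{r+3}(G)\leq\gamma_r(G)$ for every $r\geq1$.
   Context: A topological graph is a graph $G=(V,E)$ whose vertex set $V$ is a topological space; $E$ is regarded as a symmetric subset of $V\times V$. A set of vertices is independent if it contains no edge. Spaces of subsets. For an integer $k\ge 0$, $\mathrm{Sub}(V,k)$ is the collection of all subsets of $V$ of cardinality at most $k$ (including $\emptyset$). For $k\ge1$, $\mathrm{Sub}(V,k)\setminus\{\emptyset\}$ has the quotient topology of the map $V^k\to \mathrm{Sub}(V,k)\setminus\{\emptyset\}$, $(v_1,\dots,v_k)\mapsto\{v_1,\dots,v_k\}$, and $\mathrm{Sub}(V,k)$ is the topological disjoint union of this space with $\{\emptyset\}$. The measure on $\mathrm{Sub}(V,k)\setminus\{\emptyset\}$ is the pushforward under the same map of the product measure on $V^k$ obtained from $\omega$, and $\{\emptyset\}$ is given measure $1$. $C(X)$ is the space of real-valued continuous functions on $X$. Kernels. For a measure space $X$, $L^2_{\rm sym}(X)$ is the space of real kernels $K\in L^2(X\times X)$ (product measure) with $K(x,y)=K(y,x)$ almost everywhere, and $\langle\cdot,\cdot\rangle$ denotes the $L^2$ inner product. A kernel $K\in L^2_{\rm sym}(X)$ is positive semidefinite if $\langle Kf,f\rangle\ge0$ for all $f\in L^2(X)$, where $(Kf)(x)=\int_X K(x,y)f(y)\,dy$ (integration with respect to the measure on $X$). This is applied with $X=V$ (measure $\omega$) and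 with $X=\mathrm{Sub}(V,k)$ (the measure above). Lasserre hierarchy. For $k\ge2$ and $\nu\in C(\mathrm{Sub}(V,2k))$ let $(M\nu)(S,T)=\nu(S\cup T)$ for $S,T\in\mathrm{Sub}(V,k)$. Then $\mathrm{lass}_k(G)$ is the supremum of $\int_V\nu(\{x\})\,d\omega(x)$ over all $\nu\in C(\mathrm{Sub}(V,2k))$ such that $\nu(\emptyset)=1$, $\nu(S)=0$ whenever $S\in \mathrm{Sub}(V,2k)$ is not independent, and $M\nu$ is positive semidefinite. $k$-point bound. For $k\ge2$, $\nu\in C(\mathrm{Sub}(V,k))$ and $Q\subseteq V$ with $|Q|\le k-2$, let $(M_Q\nu)(S,T)=\nu(Q\cup S\cup T)$ for $S,T\in\mathrm{Sub}(V,1)$. Then $\Delta_k(G)$ is the supremum of $\int_V\nu(\{x\})\,d\omega(x)$ over all $\nu\in C(\mathrm{Sub}(V,k))$ such that $\nu(\emptyset)=1$, $\nu(S)=0$ whenever $S\in\mathrm{Sub}(V,k)$ is not independent, and $M_Q\nu$ is positive semidefinite for every independent set $Q\in\mathrm{Sub}(V,k-2)$. Completely positive hierarchy. For $F\colon V^{r+2}\to\mathbb{R}$ let $(\mathcal{R}_{\mathcal{S}_{r+2}}F)(x_1,\dots,x_{r+2})=\frac1{(r+2)!}\sum_{\pi\in\mathcal{S}_{r+2}}F(x_{\pi(1)},\dots,x_{\pi(r+2)})$, where $\mathcal{S}_{r+2}$ is the symmetric group. For an integer $r\ge1$ let $\mathcal{C}_r(V)=\{A\in L^2_{\rm sym}(V):\mathcal{R}_{\mathcal{S}_{r+2}}(A\otimes\mathbf{1}^{\otimes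 r})\ge0\text{ almost everywhere}\}$, where $(A\otimes\mathbf 1^{\otimes r})(x_1,\dots,x_{r+2})=A(x_1,x_2)$, and let $\mathcal{C}_r^*(V)=\{A\in L^2_{\rm sym}(V):\langle A,Z\rangle\ge0\text{ for all }Z\in\mathcal{C}_r(V)\}$. Then $\gamma_r(G)$ is the supremum of $\langle A,J\rangle=\int_V\int_V A(x,y)\,d\omega(y)\,d\omega(x)$ (with $J$ the constant-one kernel) over all continuous positive-semidefinite kernels $A\in\mathcal{C}_r^*(V)$ such that $\int_V A(x,x)\,d\omega(x)=1$ and $A(x,y)=0$ whenever $xy\in E$.
   Formalization: γ_r(G) is taken to be 0 when no kernel is feasible (e.g. ω = 0, or a dense set of edges near the diagonal); with the supremum of the empty set equal to −∞ the claim would fail there, since the other two bounds are at least 0. *)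

theory Defs
  imports "HOL-Analysis.Analysis"
begin

section \<open>Topological graphs and Radon measures\<close>

text \<open>
  A graph is given by its vertex space \<open>V\<close> and its edge set \<open>E\<close>, a symmetric relation.
  Irreflexivity of \<open>E\<close> is not required; a loop at \<open>x\<close> just means that \<open>{x}\<close> is not independent.
\<close>

definition topological_graph :: "'a topology \<Rightarrow> ('a \<times> 'a) set \<Rightarrow> bool" where
  "topological_graph V E \<longleftrightarrow> E \<subseteq> topspace V \<times> topspace V \<and> sym E"

definition independent_set :: "('a \<times> 'a) set \<Rightarrow> 'a set \<Rightarrow> bool" where
  "independent_set E S \<longleftrightarrow> (\<forall>x\<in>S. \<forall>y\<in>S. (x, y) \<notin> E)"

text \<open>For compact Hausdorff \<open>V\<close>, finiteness on compact sets is finiteness of the measure.\<close>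

definition Radon_measure_on :: "'a topology \<Rightarrow> 'a measure \<Rightarrow> bool" where
  "Radon_measure_on V \<omega> \<longleftrightarrow>
     space \<omega> = topspace V \<and>
     sets \<omega> = sigma_sets (topspace V) {U. openin V U} \<and>
     (\<forall>C. compactin V C \<longrightarrow> emeasure \<omega> C < \<infinity>) \<and>
     (\<forall>B\<in>sets \<omega>. emeasure \<omega> B = (SUP C\<in>{C. compactin V C \<and> C \<subseteq> B}. emeasure \<omega> C))"


section \<open>The spaces \<open>Sub(V,k)\<close>\<close>

definition Sub :: "'a set \<Rightarrow> nat \<Rightarrow> 'a set set" where
  "Sub V k = {S. S \<subseteq> V \<and> finite S \<and> card S \<le> k}"

text \<open>Points of \<open>V\<^sup>k\<close> are the extensional functions on \<open>{..<k}\<close>.\<close>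

definition tuple_set :: "nat \<Rightarrow> (nat \<Rightarrow> 'a) \<Rightarrow> 'a set" where
  "tuple_set k v = v ` {..<k}"

lemma tuple_set_image:
  assumes "k \<ge> 1"
  shows "tuple_set k ` (PiE {..<k} (\<lambda>_. V)) = Sub V k - {{}}"
proof (intro equalityI subsetI)
  fix S assume "S \<in> tuple_set k ` (PiE {..<k} (\<lambda>_. V))"
  then obtain v where v: "v \<in> PiE {..<k} (\<lambda>_. V)" "S = v ` {..<k}"
    by (auto simp: tuple_set_def)
  have "card S \<le> k" using card_image_le[of "{..<k}" v] v by simp
  moreover have "S \<noteq> {}" using assms v by (auto simp: lessThan_empty_iff)
  ultimately show "S \<in> Sub V k - {{}}" using v by (auto simp: Sub_def PiE_iff)
next
  fix S assume "S \<in> Sub V k - {{}}"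
  then have S: "S \<subseteq> V" "finite S" "card S \<le> k" "S \<noteq> {}" by (auto simp: Sub_def)
  obtain h where h: "bij_betw h {0..<card S} S" using S(2) ex_bij_betw_nat_finite by blast
  have hS: "h ` {..<card S} = S" using h by (simp add: bij_betw_def lessThan_atLeast0)
  define v where "v = (\<lambda>i. if i < k then h (if i < card S then i else 0) else undefined)"
  have c: "0 < card S" using S by (simp add: card_gt_0_iff)
  have mem: "h (if i < card S then i else 0) \<in> S" for i
    using hS c by auto
  have "v ` {..<k} = S"
  proof
    show "v ` {..<k} \<subseteq> S" using mem by (auto simp: v_def)
    show "S \<subseteq> v ` {..<k}"
    proof
      fix x assume "x \<in> S"
      then obtain i where i: "i < card S" "x = h i" using hS by auto
      then have "v i = x" "i < k" using S(3) by (auto simp: v_def)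
      then show "x \<in> v ` {..<k}" by auto
    qed
  qed
  moreover have "v \<in> PiE {..<k} (\<lambda>_. V)"
    using subsetD[OF S(1) mem] by (simp add: v_def PiE_iff extensional_def)
  ultimately show "S \<in> tuple_set k ` (PiE {..<k} (\<lambda>_. V))"
    unfolding tuple_set_def by blast
qed

definition quotient_topology :: "'a topology \<Rightarrow> ('a \<Rightarrow> 'b) \<Rightarrow> 'b topology" where
  "quotient_topology X f =
     topology (\<lambda>U. U \<subseteq> f ` topspace X \<and> openin X {x \<in> topspace X. f x \<in> U})"

lemma openin_quotient_topology:
  "openin (quotient_topology X f) U \<longleftrightarrow>
     U \<subseteq> f ` topspace X \<and> openin X {x \<in> topspace X. f x \<in> U}"
proof -
  have "istopology (\<lambda>U. U \<subseteq> f ` topspace X \<and> openin X {x \<in> topspace X. f x \<in> U})"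
    unfolding istopology_def
  proof (intro conjI allI impI)
    fix S T assume "S \<subseteq> f ` topspace X \<and> openin X {x \<in> topspace X. f x \<in> S}"
      "T \<subseteq> f ` topspace X \<and> openin X {x \<in> topspace X. f x \<in> T}"
    moreover have "{x \<in> topspace X. f x \<in> S \<inter> T} =
        {x \<in> topspace X. f x \<in> S} \<inter> {x \<in> topspace X. f x \<in> T}" by auto
    ultimately show "S \<inter> T \<subseteq> f ` topspace X" "openin X {x \<in> topspace X. f x \<in> S \<inter> T}"
      by (auto intro: openin_Int)
  next
    fix \<K> assume K: "\<forall>U\<in>\<K>. U \<subseteq> f ` topspace X \<and> openin X {x \<in> topspace X. f x \<in> U}"
    then show "\<Union>\<K> \<subseteq> f ` topspace X" by blast
    have "{x \<in> topspace X. f x \<in> \<Union>\<K>} = (\<Union>U\<in>\<K>. {x \<in> topspace X. f x \<in> U})" by auto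
    then show "openin X {x \<in> topspace X. f x \<in> \<Union>\<K>}" using K by auto
  qed
  then show ?thesis by (simp add: quotient_topology_def)
qed

lemma topspace_quotient_topology [simp]: "topspace (quotient_topology X f) = f ` topspace X"
proof
  show "topspace (quotient_topology X f) \<subseteq> f ` topspace X"
    using openin_topspace[of "quotient_topology X f"] unfolding openin_quotient_topology by blast
  have "openin (quotient_topology X f) (f ` topspace X)"
  proof -
    have "{x \<in> topspace X. f x \<in> f ` topspace X} = topspace X" by auto
    then show ?thesis by (simp add: openin_quotient_topology)
  qed
  then show "f ` topspace X \<subseteq> topspace (quotient_topology X f)" by (rule openin_subset)
qed

lemma quotient_map_quotient_topology: "quotient_map X (quotient_topology X f) f"
  by (auto simp: quotient_map_def openin_quotient_topology)

text \<open>The disjoint union of the quotient of \<open>V\<^sup>k\<close> with the one-point space \<open>{{}}\<close>.\<close>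

definition Sub_topology :: "'a topology \<Rightarrow> nat \<Rightarrow> 'a set topology" where
  "Sub_topology V k = topology (\<lambda>U. U \<subseteq> Sub (topspace V) k \<and>
     openin (quotient_topology (product_topology (\<lambda>_. V) {..<k}) (tuple_set k)) (U - {{}}))"

lemma openin_Sub_topology:
  "openin (Sub_topology V k) U \<longleftrightarrow> U \<subseteq> Sub (topspace V) k \<and>
     openin (quotient_topology (product_topology (\<lambda>_. V) {..<k}) (tuple_set k)) (U - {{}})"
proof -
  let ?Q = "quotient_topology (product_topology (\<lambda>_. V) {..<k}) (tuple_set k)"
  have "istopology (\<lambda>U. U \<subseteq> Sub (topspace V) k \<and> openin ?Q (U - {{}}))"
    unfolding istopology_def
  proof (intro conjI allI impI)
    fix S T assume "S \<subseteq> Sub (topspace V) k \<and> openin ?Q (S - {{}})"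
      "T \<subseteq> Sub (topspace V) k \<and> openin ?Q (T - {{}})"
    moreover have "S \<inter> T - {{}} = (S - {{}}) \<inter> (T - {{}})" by auto
    ultimately show "S \<inter> T \<subseteq> Sub (topspace V) k" "openin ?Q (S \<inter> T - {{}})"
      by (auto intro: openin_Int)
  next
    fix \<K> assume K: "\<forall>U\<in>\<K>. U \<subseteq> Sub (topspace V) k \<and> openin ?Q (U - {{}})"
    then show "\<Union>\<K> \<subseteq> Sub (topspace V) k" by blast
    have eq: "\<Union>\<K> - {{}} = \<Union>((\<lambda>U. U - {{}}) ` \<K>)" by blast
    show "openin ?Q (\<Union>\<K> - {{}})"
      unfolding eq by (rule openin_Union) (use K in blast)
  qed
  then show ?thesis by (simp add: Sub_topology_def)
qed

lemma topspace_Sub_topology: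
  assumes "k \<ge> 1"
  shows "topspace (Sub_topology V k) = Sub (topspace V) k"
proof
  show "topspace (Sub_topology V k) \<subseteq> Sub (topspace V) k"
    using openin_topspace[of "Sub_topology V k"] unfolding openin_Sub_topology by blast
  have "openin (Sub_topology V k) (Sub (topspace V) k)"
  proof -
    let ?Q = "quotient_topology (product_topology (\<lambda>_. V) {..<k}) (tuple_set k)"
    have "topspace ?Q = Sub (topspace V) k - {{}}"
      using tuple_set_image[OF assms] by (simp add: topspace_product_topology)
    then show ?thesis
      using openin_topspace[of ?Q] by (simp add: openin_Sub_topology)
  qed
  then show "Sub (topspace V) k \<subseteq> topspace (Sub_topology V k)" by (rule openin_subset)
qed

text \<open>
  Pushforward measure on the image of \<open>f\<close>, with the pushforward \<open>\<sigma>\<close>-algebra, which consists of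
  all sets with measurable preimage. Products of measures are taken on the product \<open>\<sigma>\<close>-algebra.
  Without second countability it can be smaller than the Borel \<open>\<sigma>\<close>-algebra of the product space,
  but by Stone--Weierstrass continuous functions are measurable for it, and being dense in \<open>L\<^sup>2\<close> of
  the Radon product measure, they show that both choices give the same \<open>L\<^sup>2\<close> spaces.
\<close>

definition pushforward :: "'a measure \<Rightarrow> ('a \<Rightarrow> 'b) \<Rightarrow> 'b measure" where
  "pushforward M f =
     distr M (sigma (f ` space M) {A. A \<subseteq> f ` space M \<and> f -` A \<inter> space M \<in> sets M}) f"

lemma space_pushforward [simp]: "space (pushforward M f) = f ` space M"
  by (simp add: pushforward_def space_measure_of_conv)

lemma sets_pushforward:
  "sets (pushforward M f) = {A. A \<subseteq> f ` space M \<and> f -` A \<inter> space M \<in> sets M}"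
proof -
  let ?A = "{A. A \<subseteq> f ` space M \<and> f -` A \<inter> space M \<in> sets M}"
  have "sigma_algebra (f ` space M) ?A"
    unfolding sigma_algebra_iff2
  proof (intro conjI ballI allI impI)
    show "?A \<subseteq> Pow (f ` space M)" "{} \<in> ?A" by auto
  next
    fix s assume s: "s \<in> ?A"
    have "f -` (f ` space M - s) \<inter> space M = space M - (f -` s \<inter> space M)" by auto
    then show "f ` space M - s \<in> ?A" using s by auto
  next
    fix A :: "nat \<Rightarrow> _" assume A: "range A \<subseteq> ?A"
    have "f -` (\<Union>i. A i) \<inter> space M = (\<Union>i. f -` A i \<inter> space M)" by auto
    moreover have "(\<Union>i. f -` A i \<inter> space M) \<in> sets M"
      by (rule sets.countable_UN) (use A in auto)
    ultimately show "(\<Union>i. A i) \<in> ?A" using A by auto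
  qed
  then show ?thesis
    unfolding pushforward_def sets_distr by (rule sigma_algebra.sets_measure_of_eq)
qed

lemma emeasure_pushforward:
  assumes "A \<in> sets (pushforward M f)"
  shows "emeasure (pushforward M f) A = emeasure M (f -` A \<inter> space M)"
proof -
  let ?N = "sigma (f ` space M) {A. A \<subseteq> f ` space M \<and> f -` A \<inter> space M \<in> sets M}"
  have "f \<in> measurable M ?N" by (rule measurable_measure_of) auto
  moreover have "A \<in> sets ?N" using assms by (simp add: pushforward_def)
  ultimately show ?thesis by (simp add: pushforward_def emeasure_distr)
qed

text \<open>The pushforward of the product measure on \<open>V\<^sup>k\<close>, together with an atom of mass 1 at \<open>{}\<close>.\<close>

definition Sub_measure :: "'a measure \<Rightarrow> nat \<Rightarrow> 'a set measure" where
  "Sub_measure \<omega> k =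
     (let P = pushforward (PiM {..<k} (\<lambda>_. \<omega>)) (tuple_set k)
      in measure_of (Sub (space \<omega>) k) {A. A \<subseteq> Sub (space \<omega>) k \<and> A - {{}} \<in> sets P}
           (\<lambda>A. emeasure P (A - {{}}) + indicator A {}))"

lemma Sub_measure_simps:
  fixes \<omega> :: "'a measure"
  assumes "k \<ge> 1"
  defines "P \<equiv> pushforward (PiM {..<k} (\<lambda>_. \<omega>)) (tuple_set k)"
  shows space_Sub_measure: "space (Sub_measure \<omega> k) = Sub (space \<omega>) k"
    and sets_Sub_measure:
      "sets (Sub_measure \<omega> k) = {A. A \<subseteq> Sub (space \<omega>) k \<and> A - {{}} \<in> sets P}"
    and emeasure_Sub_measure: "A \<in> sets (Sub_measure \<omega> k) \<Longrightarrow>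
      emeasure (Sub_measure \<omega> k) A = emeasure P (A - {{}}) + indicator A {}"
proof -
  let ?A = "{A. A \<subseteq> Sub (space \<omega>) k \<and> A - {{}} \<in> sets P}"
  let ?\<mu> = "\<lambda>A. emeasure P (A - {{}}) + indicator A {} :: ennreal"
  have spP: "space P = Sub (space \<omega>) k - {{}}"
    using tuple_set_image[OF assms(1), of "space \<omega>"] by (simp add: P_def space_PiM)
  have sa: "sigma_algebra (Sub (space \<omega>) k) ?A"
    unfolding sigma_algebra_iff2
  proof (intro conjI ballI allI impI)
    show "?A \<subseteq> Pow (Sub (space \<omega>) k)" "{} \<in> ?A" by auto
  next
    fix s assume s: "s \<in> ?A"
    have "Sub (space \<omega>) k - s - {{}} = space P - (s - {{}})" by (auto simp: spP)
    then show "Sub (space \<omega>) k - s \<in> ?A" using s by auto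
  next
    fix A :: "nat \<Rightarrow> _" assume A: "range A \<subseteq> ?A"
    have "(\<Union>i. A i) - {{}} = (\<Union>i. A i - {{}})" by auto
    moreover have "(\<Union>i. A i - {{}}) \<in> sets P"
      by (rule sets.countable_UN) (use A in auto)
    ultimately show "(\<Union>i. A i) \<in> ?A" using A by auto
  qed
  have eq: "Sub_measure \<omega> k = measure_of (Sub (space \<omega>) k) ?A ?\<mu>"
    by (simp add: Sub_measure_def P_def Let_def)
  show "space (Sub_measure \<omega> k) = Sub (space \<omega>) k"
    unfolding eq by (rule sigma_algebra.space_measure_of_eq[OF sa])
  show sets: "sets (Sub_measure \<omega> k) = ?A"
    unfolding eq by (rule sigma_algebra.sets_measure_of_eq[OF sa])
  have ca: "countably_additive ?A ?\<mu>"
    unfolding countably_additive_def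
  proof (intro allI impI)
    fix A :: "nat \<Rightarrow> 'a set set"
    assume A: "range A \<subseteq> ?A" "disjoint_family A"
    have "(\<Sum>i. emeasure P (A i - {{}})) = emeasure P (\<Union>i. A i - {{}})"
    proof (rule suminf_emeasure)
      show "range (\<lambda>i. A i - {{}}) \<subseteq> sets P" using A(1) by auto
      show "disjoint_family (\<lambda>i. A i - {{}})"
        using A(2) unfolding disjoint_family_on_def by blast
    qed
    moreover have "(\<Union>i. A i - {{}}) = (\<Union>i. A i) - {{}}" by auto
    moreover have "(\<Sum>i. indicator (A i) {} :: ennreal) = indicator (\<Union>i. A i) {}"
      using A(2) by (rule suminf_indicator)
    ultimately show "(\<Sum>i. ?\<mu> (A i)) = ?\<mu> (\<Union>i. A i)"
      by (simp only: suminf_add[OF summableI summableI, symmetric])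
  qed
  show "emeasure (Sub_measure \<omega> k) A = ?\<mu> A" if "A \<in> sets (Sub_measure \<omega> k)"
    unfolding eq by (rule emeasure_measure_of_sigma[OF sa _ ca])
      (use that sets in \<open>auto simp: positive_def\<close>)
qed


section \<open>Kernels\<close>

text \<open>
  Functions and kernels are honest functions rather than almost-everywhere classes.
\<close>

definition L2 :: "'a measure \<Rightarrow> ('a \<Rightarrow> real) set" where
  "L2 M = {f. f \<in> borel_measurable M \<and> integrable M (\<lambda>x. (f x)\<^sup>2)}"

definition L2_sym :: "'a measure \<Rightarrow> ('a \<Rightarrow> 'a \<Rightarrow> real) set" where
  "L2_sym M = {K. (\<lambda>(x, y). K x y) \<in> L2 (M \<Otimes>\<^sub>M M) \<and>
                  (AE (x, y) in M \<Otimes>\<^sub>M M. K x y = K y x)}"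

definition kernel_inner :: "'a measure \<Rightarrow> ('a \<Rightarrow> 'a \<Rightarrow> real) \<Rightarrow> ('a \<Rightarrow> 'a \<Rightarrow> real) \<Rightarrow> real" where
  "kernel_inner M A B = (\<integral>(x, y). A x y * B x y \<partial>(M \<Otimes>\<^sub>M M))"

definition kernel_op :: "'a measure \<Rightarrow> ('a \<Rightarrow> 'a \<Rightarrow> real) \<Rightarrow> ('a \<Rightarrow> real) \<Rightarrow> 'a \<Rightarrow> real" where
  "kernel_op M K f x = (\<integral>y. K x y * f y \<partial>M)"

definition psd_kernel :: "'a measure \<Rightarrow> ('a \<Rightarrow> 'a \<Rightarrow> real) \<Rightarrow> bool" where
  "psd_kernel M K \<longleftrightarrow> K \<in> L2_sym M \<and> (\<forall>f\<in>L2 M. (\<integral>x. kernel_op M K f x * f x \<partial>M) \<ge> 0)"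


section \<open>The Lasserre hierarchy\<close>

definition lass_feasible ::
    "'a topology \<Rightarrow> ('a \<times> 'a) set \<Rightarrow> 'a measure \<Rightarrow> nat \<Rightarrow> ('a set \<Rightarrow> real) \<Rightarrow> bool" where
  "lass_feasible V E \<omega> k \<nu> \<longleftrightarrow>
     continuous_map (Sub_topology V (2 * k)) euclideanreal \<nu> \<and>
     \<nu> {} = 1 \<and>
     (\<forall>S\<in>Sub (topspace V) (2 * k). \<not> independent_set E S \<longrightarrow> \<nu> S = 0) \<and>
     psd_kernel (Sub_measure \<omega> k) (\<lambda>S T. \<nu> (S \<union> T))"

definition lass :: "'a topology \<Rightarrow> ('a \<times> 'a) set \<Rightarrow> 'a measure \<Rightarrow> nat \<Rightarrow> ereal" where
  "lass V E \<omega> k = Sup {ereal (\<integral>x. \<nu> {x} \<partial>\<omega>) |\<nu>. lass_feasible V E \<omega> k \<nu>}"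


section \<open>The k-point bound\<close>

definition Delta_feasible ::
    "'a topology \<Rightarrow> ('a \<times> 'a) set \<Rightarrow> 'a measure \<Rightarrow> nat \<Rightarrow> ('a set \<Rightarrow> real) \<Rightarrow> bool" where
  "Delta_feasible V E \<omega> k \<nu> \<longleftrightarrow>
     continuous_map (Sub_topology V k) euclideanreal \<nu> \<and>
     \<nu> {} = 1 \<and>
     (\<forall>S\<in>Sub (topspace V) k. \<not> independent_set E S \<longrightarrow> \<nu> S = 0) \<and>
     (\<forall>Q\<in>Sub (topspace V) (k - 2). independent_set E Q \<longrightarrow>
        psd_kernel (Sub_measure \<omega> 1) (\<lambda>S T. \<nu> (Q \<union> S \<union> T)))"

definition Delta :: "'a topology \<Rightarrow> ('a \<times> 'a) set \<Rightarrow> 'a measure \<Rightarrow> nat \<Rightarrow> ereal" where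
  "Delta V E \<omega> k = Sup {ereal (\<integral>x. \<nu> {x} \<partial>\<omega>) |\<nu>. Delta_feasible V E \<omega> k \<nu>}"


section \<open>The completely positive hierarchy\<close>

definition symmetrize :: "nat \<Rightarrow> ((nat \<Rightarrow> 'a) \<Rightarrow> real) \<Rightarrow> (nat \<Rightarrow> 'a) \<Rightarrow> real" where
  "symmetrize n F x = (1 / fact n) * (\<Sum>\<pi> | \<pi> permutes {..<n}. F (\<lambda>i. x (\<pi> i)))"

text \<open>With coordinates numbered from 0, \<open>A \<otimes> \<one> \<otimes> \<dots> \<otimes> \<one>\<close> is \<open>\<lambda>x. A (x 0) (x 1)\<close>.\<close>

definition C_cone :: "'a measure \<Rightarrow> nat \<Rightarrow> ('a \<Rightarrow> 'a \<Rightarrow> real) set" where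
  "C_cone \<omega> r = {A \<in> L2_sym \<omega>.
     AE x in PiM {..<r + 2} (\<lambda>_. \<omega>). symmetrize (r + 2) (\<lambda>x. A (x 0) (x 1)) x \<ge> 0}"

definition C_dual :: "'a measure \<Rightarrow> nat \<Rightarrow> ('a \<Rightarrow> 'a \<Rightarrow> real) set" where
  "C_dual \<omega> r = {A \<in> L2_sym \<omega>. \<forall>Z\<in>C_cone \<omega> r. kernel_inner \<omega> A Z \<ge> 0}"

definition gamma_feasible ::
    "'a topology \<Rightarrow> ('a \<times> 'a) set \<Rightarrow> 'a measure \<Rightarrow> nat \<Rightarrow> ('a \<Rightarrow> 'a \<Rightarrow> real) \<Rightarrow> bool" where
  "gamma_feasible V E \<omega> r A \<longleftrightarrow>
     continuous_map (prod_topology V V) euclideanreal (\<lambda>(x, y). A x y) \<and>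
     psd_kernel \<omega> A \<and>
     A \<in> C_dual \<omega> r \<and>
     (\<integral>x. A x x \<partial>\<omega>) = 1 \<and>
     (\<forall>(x, y)\<in>E. A x y = 0)"

text \<open>
  Every feasible value is nonnegative, and the supremum is taken in \<open>[0,\<infinity>]\<close>: it is 0 when there is
  no feasible kernel. This happens for example when \<open>\<omega> = 0\<close>, or when \<open>(x, x)\<close> is in the closure
  of \<open>E\<close> for every vertex \<open>x\<close>; there the other two bounds are 0, so the value \<open>-\<infinity>\<close> would be inadequate. The feasible
  sets of the other two problems always contain the indicator function of \<open>{{}}\<close>.
\<close>

definition gamma :: "'a topology \<Rightarrow> ('a \<times> 'a) set \<Rightarrow> 'a measure \<Rightarrow> nat \<Rightarrow> ereal" where
  "gamma V E \<omega> r =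
     (if \<exists>A. gamma_feasible V E \<omega> r A
      then Sup {ereal (kernel_inner \<omega> A (\<lambda>_ _. 1)) |A. gamma_feasible V E \<omega> r A}
      else 0)"

end

(*
  Delta <= gamma: for nu feasible for Delta_{r+3}, the kernel obtained from nu({x, y} \<union> Z) by
  averaging over Z = {z_1, ..., z_r} and normalizing the trace is feasible for gamma_r: it pairs with
  Z \<in> C_r through the symmetrization, against the nonnegative function nu({w_1, ..., w_{r+2}}).
  Its value is m_{r+2} / m_{r+1}, where m_j is the integral of nu({x_1, ..., x_j}); positivity of the
  matrices M_Q makes m log-convex, so that this is at least m_1 / m_0 = m_1.

  lass <= Delta: positivity of M nu says something about nu(Q \<union> S \<union> T) only when Q lies in the
  support of omega, whereas Delta also constrains Q off the support, so restricting nu is not enough.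
  Instead every vertex x is snapped to a point of the support that is nearly nearest to it in a
  pseudometric read off from nu, by a rule depending on a threshold t in (1, 2), and the value is set
  to 0 when some pair of vertices moved too far compared with the size of nu on sets containing it.
  For fixed t this is positive and vanishes on dependent sets; for almost every t it is continuous
  at a given set, so the average over t is continuous and feasible, and it agrees with nu on the support.
*)
theory Submission
  imports Defs
begin

section \<open>Positive semidefinite kernels and positive semidefinite matrices\<close>

text \<open>Feasibility speaks of positivity in \<open>L2\<close>, the arguments speak of finite
  matrices. Matrices are extracted by spreading point masses over small sets of positive measure,
  and kernels are recovered by uniform approximation with step kernels; both passages involve only
  sets inside the support of \<omega>. In general V is neither metrizable nor second countable.
  Estimates therefore use the pseudometric \<open>d\<close>, for which the compact space V is
  totally bounded: this yields finite step approximations, a countable dense part of the support,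
  and sequences as a test for continuity. A nearest-point map onto the support is not continuous in
  general. The first member of a dense sequence lying within t times the distance is a more stable
  choice: at a given vertex it is unstable only for countably many t. Here t > 1 makes such a member
  exist and t < 2 bounds the displacement by twice the distance. Pairs inside the support always
  pass the cut-off, so it splits into a factor for S and a factor for T. It costs two vertices: the
  estimates cover sets of at most 2(r+2) - 2 vertices, and r + 3 fits because r >= 1.\<close>

lemma integrable_product_kernel:
  fixes g h :: "'a \<Rightarrow> real"
  assumes M: "finite_measure M" and g: "integrable M g" and h: "integrable M h"
  shows "integrable (M \<Otimes>\<^sub>M M) (\<lambda>(x, y). g x * h y)"
    and "(\<integral>(x, y). g x * h y \<partial>(M \<Otimes>\<^sub>M M)) = (\<integral>x. g x \<partial>M) * (\<integral>y. h y \<partial>M)"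
proof -
  interpret finite_measure M by fact
  interpret pair_sigma_finite M M ..
  note [measurable] = borel_measurable_integrable[OF g] borel_measurable_integrable[OF h]
  show *: "integrable (M \<Otimes>\<^sub>M M) (\<lambda>(x, y). g x * h y)"
    by (rule Fubini_integrable) (use g h in \<open>auto simp: abs_mult\<close>)
  show "(\<integral>(x, y). g x * h y \<partial>(M \<Otimes>\<^sub>M M)) = (\<integral>x. g x \<partial>M) * (\<integral>y. h y \<partial>M)"
    using integral_fst'[OF *] by simp
qed

lemma integral_kernel_op:
  assumes M: "finite_measure M"
    and int: "integrable (M \<Otimes>\<^sub>M M) (\<lambda>(x, y). K x y * f y * f x)"
  shows "(\<integral>x. kernel_op M K f x * f x \<partial>M) = (\<integral>(x, y). K x y * f y * f x \<partial>(M \<Otimes>\<^sub>M M))"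
proof -
  interpret finite_measure M by fact
  interpret pair_sigma_finite M M ..
  show ?thesis
    using integral_fst'[OF int] by (simp add: kernel_op_def)
qed

text \<open>Point masses at \<open>s i\<close> are replaced by the test function that spreads the
  weight \<open>c i\<close> evenly over \<open>N i\<close>. The contribution of the block
  \<open>N i \<times> N j\<close> then differs from \<open>c i * c j * K (s i) (s j)\<close> by at
  most \<open>\<epsilon> * (\<bar>c i\<bar> * \<bar>c j\<bar>)\<close>, and \<epsilon> is
  arbitrary.\<close>

lemma psd_kernel_imp_pointwise:
  fixes s :: "'i \<Rightarrow> 'a" and c :: "'i \<Rightarrow> real"
  assumes M: "finite_measure M" and K: "psd_kernel M K" and I: "finite I"
    and nbhd: "\<And>\<epsilon>. \<epsilon> > 0 \<Longrightarrow> \<exists>N. \<forall>i\<in>I. N i \<in> sets M \<and> measure M (N i) > 0 \<and>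
      (\<forall>j\<in>I. \<forall>x\<in>N i. \<forall>y\<in>N j. \<bar>K x y - K (s i) (s j)\<bar> \<le> \<epsilon>)"
  shows "0 \<le> (\<Sum>i\<in>I. \<Sum>j\<in>I. c i * c j * K (s i) (s j))"
proof -
  interpret finite_measure M by fact
  interpret P: pair_sigma_finite M M ..
  interpret PF: finite_measure "M \<Otimes>\<^sub>M M" by (rule finite_measure_pair_measure[OF M M])
  let ?MM = "M \<Otimes>\<^sub>M M"
  have K': "(\<lambda>(x, y). K x y) \<in> borel_measurable ?MM" "integrable ?MM (\<lambda>z. ((\<lambda>(x, y). K x y) z)\<^sup>2)"
    using K by (auto simp: psd_kernel_def L2_sym_def L2_def)
  have Kint: "integrable ?MM (\<lambda>(x, y). K x y)"
    using PF.square_integrable_imp_integrable[OF K'] .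
  let ?S = "\<Sum>i\<in>I. \<Sum>j\<in>I. c i * c j * K (s i) (s j)"
  let ?C = "\<Sum>i\<in>I. \<Sum>j\<in>I. \<bar>c i\<bar> * \<bar>c j\<bar>"
  have key: "- \<epsilon> * ?C \<le> ?S" if \<epsilon>: "\<epsilon> > 0" for \<epsilon>
  proof -
    obtain N where N: "\<And>i. i \<in> I \<Longrightarrow> N i \<in> sets M" "\<And>i. i \<in> I \<Longrightarrow> measure M (N i) > 0"
      "\<And>i j x y. i \<in> I \<Longrightarrow> j \<in> I \<Longrightarrow> x \<in> N i \<Longrightarrow> y \<in> N j \<Longrightarrow> \<bar>K x y - K (s i) (s j)\<bar> \<le> \<epsilon>"
      using nbhd[OF \<epsilon>] by blast
    define a where "a i = c i / measure M (N i)" for i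
    define f where "f x = (\<Sum>i\<in>I. a i * indicator (N i) x)" for x
    define G where "G i j = (\<lambda>z. indicator (N i \<times> N j) z *\<^sub>R (\<lambda>(x, y). K x y) z)" for i j
    have Nint: "integrable M (indicator (N i) :: _ \<Rightarrow> real)" if "i \<in> I" for i
      using N(1)[OF that] by (simp add: integrable_indicator_iff emeasure_eq_measure)
    have fm [measurable]: "f \<in> borel_measurable M"
      unfolding f_def using N(1) by (auto intro!: borel_measurable_sum)
    have fbd: "\<bar>f x\<bar> \<le> (\<Sum>i\<in>I. \<bar>a i\<bar>)" for x
      unfolding f_def by (rule order_trans[OF sum_abs]) (auto intro!: sum_mono simp: indicator_def)
    have fL2: "f \<in> L2 M"
      unfolding L2_def
    proof (intro CollectI conjI fm, rule integrable_const_bound)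
      show "AE x in M. norm ((f x)\<^sup>2) \<le> (\<Sum>i\<in>I. \<bar>a i\<bar>)\<^sup>2"
        using power_mono[OF fbd abs_ge_zero, of _ 2] by (intro AE_I2) (simp add: power2_abs)
    qed auto
    have Gint: "integrable ?MM (G i j)" if "i \<in> I" "j \<in> I" for i j
      unfolding G_def by (rule integrable_mult_indicator[OF _ Kint]) (use N(1) that in auto)
    have Feq: "(\<lambda>(x, y). K x y * f y * f x) = (\<lambda>z. \<Sum>i\<in>I. \<Sum>j\<in>I. a i * a j * G i j z)"
    proof (rule ext, clarify)
      fix x y
      have "K x y * f y * f x = K x y * (\<Sum>i\<in>I. \<Sum>j\<in>I. (a i * indicator (N i) x) * (a j * indicator (N j) y))"
        by (simp only: f_def sum_product[symmetric]) (simp only: ac_simps)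
      also have "\<dots> = (\<Sum>i\<in>I. \<Sum>j\<in>I. a i * a j * G i j (x, y))"
        by (simp add: sum_distrib_left G_def indicator_times algebra_simps)
      finally show "K x y * f y * f x = (\<Sum>i\<in>I. \<Sum>j\<in>I. a i * a j * G i j (x, y))" .
    qed
    have Fint: "integrable ?MM (\<lambda>(x, y). K x y * f y * f x)"
      unfolding Feq using Gint by auto
    have "0 \<le> (\<integral>x. kernel_op M K f x * f x \<partial>M)"
      using K fL2 by (auto simp: psd_kernel_def)
    also have "\<dots> = (\<Sum>i\<in>I. \<Sum>j\<in>I. a i * a j * (\<integral>z. G i j z \<partial>?MM))"
      unfolding integral_kernel_op[OF M Fint] unfolding Feq
      by (subst Bochner_Integration.integral_sum)
         (auto intro!: Bochner_Integration.integrable_sum Gint simp: Bochner_Integration.integral_sum[OF integrable_mult_right[OF Gint]])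
    also have "\<dots> \<le> (\<Sum>i\<in>I. \<Sum>j\<in>I. c i * c j * K (s i) (s j) + \<epsilon> * (\<bar>c i\<bar> * \<bar>c j\<bar>))"
    proof (intro sum_mono)
      fix i j assume ij: "i \<in> I" "j \<in> I"
      let ?m = "measure M (N i) * measure M (N j)"
      have m: "measure ?MM (N i \<times> N j) = ?m"
        using N(1) ij by (simp add: measure_def emeasure_pair_measure_Times enn2real_mult)
      have mpos: "?m > 0" using N(2) ij by simp
      have Rint: "integrable ?MM (indicator (N i \<times> N j) :: _ \<Rightarrow> real)"
        using N(1) ij by (simp add: integrable_indicator_iff PF.emeasure_eq_measure)
      have "\<bar>(\<integral>z. G i j z \<partial>?MM) - K (s i) (s j) * ?m\<bar>
          = \<bar>\<integral>z. G i j z - K (s i) (s j) * indicator (N i \<times> N j) z \<partial>?MM\<bar>"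
        using Gint[OF ij] Rint N(1) ij by (simp add: m)
      also have "\<dots> \<le> (\<integral>z. \<bar>G i j z - K (s i) (s j) * indicator (N i \<times> N j) z\<bar> \<partial>?MM)"
        by (rule integral_abs_bound)
      also have "\<dots> \<le> (\<integral>z. \<epsilon> * indicator (N i \<times> N j) z \<partial>?MM)"
      proof (rule integral_mono)
        show "integrable ?MM (\<lambda>z. \<bar>G i j z - K (s i) (s j) * indicator (N i \<times> N j) z\<bar>)"
          "integrable ?MM (\<lambda>z. \<epsilon> * indicator (N i \<times> N j) z)"
          using Gint[OF ij] Rint by auto
      qed (use N(3)[OF ij] \<epsilon> in \<open>auto simp: G_def indicator_def\<close>)
      also have "\<dots> = \<epsilon> * ?m" using N(1) ij by (simp add: m)
      finally have b: "\<bar>(\<integral>z. G i j z \<partial>?MM) - K (s i) (s j) * ?m\<bar> \<le> \<epsilon> * ?m" .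
      have "a i * a j * ((\<integral>z. G i j z \<partial>?MM) - K (s i) (s j) * ?m) \<le> \<bar>a i * a j\<bar> * (\<epsilon> * ?m)"
        using mult_left_mono[OF b, of "\<bar>a i * a j\<bar>"]
        by (simp add: abs_mult[symmetric])
      also have "\<dots> = \<epsilon> * (\<bar>c i\<bar> * \<bar>c j\<bar>)"
        using N(2)[OF ij(1)] N(2)[OF ij(2)] by (simp add: a_def abs_mult field_simps)
      finally show "a i * a j * (\<integral>z. G i j z \<partial>?MM) \<le> c i * c j * K (s i) (s j) + \<epsilon> * (\<bar>c i\<bar> * \<bar>c j\<bar>)"
        using N(2)[OF ij(1)] N(2)[OF ij(2)] by (simp add: a_def field_simps)
    qed
    also have "\<dots> = ?S + \<epsilon> * ?C"
      by (simp add: sum.distrib sum_distrib_left)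
    finally show ?thesis by simp
  qed
  show ?thesis
  proof (rule field_le_epsilon)
    fix e :: real assume e: "e > 0"
    have C: "?C \<ge> 0" by (intro sum_nonneg) auto
    have "- (e / (?C + 1)) * ?C \<le> ?S" by (rule key) (use e C in auto)
    moreover have "(e / (?C + 1)) * ?C \<le> e"
      using C e by (simp add: field_simps)
    ultimately show "0 \<le> ?S + e" by linarith
  qed
qed

text \<open>The quadratic form of the step kernel \<open>K (p x) (p y)\<close> at \<open>f\<close>
  is that of a finite matrix of values of \<open>K\<close>, taken at the integrals of
  \<open>f\<close> over the level sets of \<open>p\<close>. The step kernels approximate
  \<open>K\<close> uniformly, which controls the form against the integrable function
  \<open>\<bar>f x\<bar> * \<bar>f y\<bar>\<close>. The same approximation shows that
  \<open>K\<close> is measurable and bounded, hence in \<open>L2\<close>.\<close>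

lemma pointwise_imp_psd_kernel:
  fixes K :: "'a \<Rightarrow> 'a \<Rightarrow> real"
  assumes M: "finite_measure M"
    and sym: "\<And>x y. x \<in> space M \<Longrightarrow> y \<in> space M \<Longrightarrow> K x y = K y x"
    and \<Omega>: "AE x in M. x \<in> \<Omega>"
    and approx: "\<And>\<epsilon>. \<epsilon> > 0 \<Longrightarrow> \<exists>p A. finite A \<and> p \<in> measurable M (count_space A) \<and>
      (\<forall>x\<in>space M \<inter> \<Omega>. p x \<in> \<Omega>) \<and>
      (\<forall>x\<in>space M. \<forall>y\<in>space M. \<bar>K x y - K (p x) (p y)\<bar> \<le> \<epsilon>)"
    and psd: "\<And>A c. finite A \<Longrightarrow> A \<subseteq> \<Omega> \<Longrightarrow> 0 \<le> (\<Sum>a\<in>A. \<Sum>b\<in>A. c a * c b * K a b)"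
  shows "psd_kernel M K"
proof -
  interpret finite_measure M by fact
  interpret P: pair_sigma_finite M M ..
  interpret PF: finite_measure "M \<Otimes>\<^sub>M M" by (rule finite_measure_pair_measure[OF M M])
  let ?MM = "M \<Otimes>\<^sub>M M"
  have stepm: "(\<lambda>(x, y). K (p x) (p y)) \<in> borel_measurable ?MM"
    if A: "finite A" and p [measurable]: "p \<in> measurable M (count_space A)" for p A
  proof -
    have "(\<lambda>z. K (p (fst z)) (p (snd z))) \<in> borel_measurable ?MM"
    proof (rule measurable_compose_countable'[where I=A and f="\<lambda>a z. K a (p (snd z))" and g="\<lambda>z. p (fst z)"])
      show "(\<lambda>z. p (fst z)) \<in> measurable ?MM (count_space A)" by measurable
      show "countable A" using A by (rule countable_finite)
      fix a assume "a \<in> A"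
      show "(\<lambda>z. K a (p (snd z))) \<in> borel_measurable ?MM"
        by (rule measurable_compose_countable'[where I=A and f="\<lambda>b z. K a b" and g="\<lambda>z. p (snd z)"])
          (use A in \<open>auto intro: countable_finite\<close>)
    qed
    then show ?thesis by (simp add: case_prod_beta')
  qed
  \<comment> \<open>Membership in \<open>L2\<close> requires measurability for the product
    \<open>\<sigma>\<close>-algebra; it is inherited from step kernels in the limit.\<close>
  have Km [measurable]: "(\<lambda>(x, y). K x y) \<in> borel_measurable ?MM"
  proof -
    have "\<forall>n. \<exists>p A. finite A \<and> p \<in> measurable M (count_space A) \<and>
      (\<forall>x\<in>space M. \<forall>y\<in>space M. \<bar>K x y - K (p x) (p y)\<bar> \<le> 1 / real (Suc n))"
    proof
      fix n show "\<exists>p A. finite A \<and> p \<in> measurable M (count_space A) \<and>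
        (\<forall>x\<in>space M. \<forall>y\<in>space M. \<bar>K x y - K (p x) (p y)\<bar> \<le> 1 / real (Suc n))"
        using approx[of "1 / real (Suc n)"] by (auto simp del: of_nat_Suc)
    qed
    then obtain p A where p: "\<And>n. finite (A n)" "\<And>n. p n \<in> measurable M (count_space (A n))"
      "\<And>n x y. x \<in> space M \<Longrightarrow> y \<in> space M \<Longrightarrow> \<bar>K x y - K (p n x) (p n y)\<bar> \<le> 1 / real (Suc n)"
      by metis
    show ?thesis
    proof (rule borel_measurable_LIMSEQ_real)
      show "(\<lambda>(x, y). K (p n x) (p n y)) \<in> borel_measurable ?MM" for n
        by (rule stepm[OF p(1,2)])
      fix z assume "z \<in> space ?MM"
      then obtain x y where z: "z = (x, y)" "x \<in> space M" "y \<in> space M"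
        by (auto simp: space_pair_measure)
      have "(\<lambda>n. K (p n x) (p n y) - K x y) \<longlonglongrightarrow> 0"
      proof (rule Lim_null_comparison)
        show "\<forall>\<^sub>F n in sequentially. norm (K (p n x) (p n y) - K x y) \<le> 1 / real (Suc n)"
          using p(3)[OF z(2,3)] by (auto simp: abs_minus_commute)
        show "(\<lambda>n. 1 / real (Suc n)) \<longlonglongrightarrow> 0" by (rule LIMSEQ_Suc[OF lim_1_over_n])
      qed
      then show "(\<lambda>n. (\<lambda>(x, y). K (p n x) (p n y)) z) \<longlonglongrightarrow> (\<lambda>(x, y). K x y) z"
        by (simp add: z LIM_zero_iff)
    qed
  qed
  obtain B where B: "\<And>x y. x \<in> space M \<Longrightarrow> y \<in> space M \<Longrightarrow> \<bar>K x y\<bar> \<le> B"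
  proof -
    obtain p A where p: "finite A" "p \<in> measurable M (count_space A)"
      "\<And>x y. x \<in> space M \<Longrightarrow> y \<in> space M \<Longrightarrow> \<bar>K x y - K (p x) (p y)\<bar> \<le> 1"
      using approx[of 1] by auto
    have pA: "p x \<in> A" if "x \<in> space M" for x using measurable_space[OF p(2) that] by simp
    have "\<bar>K x y\<bar> \<le> (\<Sum>a\<in>A. \<Sum>b\<in>A. \<bar>K a b\<bar>) + 1" if "x \<in> space M" "y \<in> space M" for x y
    proof -
      have "\<bar>K (p x) (p y)\<bar> \<le> (\<Sum>b\<in>A. \<bar>K (p x) b\<bar>)"
        by (rule member_le_sum) (use p pA that in auto)
      also have "\<dots> \<le> (\<Sum>a\<in>A. \<Sum>b\<in>A. \<bar>K a b\<bar>)"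
        by (rule member_le_sum) (use p pA that in \<open>auto intro: sum_nonneg\<close>)
      finally show ?thesis using p(3)[OF that] by linarith
    qed
    then show ?thesis using that by blast
  qed
  have "K \<in> L2_sym M"
    unfolding L2_sym_def L2_def
  proof (intro CollectI conjI Km)
    show "integrable ?MM (\<lambda>z. ((\<lambda>(x, y). K x y) z)\<^sup>2)"
    proof (rule PF.integrable_const_bound)
      show "AE z in ?MM. norm (((\<lambda>(x, y). K x y) z)\<^sup>2) \<le> B\<^sup>2"
        using power_mono[OF B abs_ge_zero, of _ _ 2]
        by (intro AE_I2) (auto simp: power2_abs space_pair_measure)
    qed measurable
    show "AE (x, y) in ?MM. K x y = K y x"
      by (rule AE_I2) (auto simp: space_pair_measure intro: sym)
  qed
  moreover have "(\<integral>x. kernel_op M K f x * f x \<partial>M) \<ge> 0" if f: "f \<in> L2 M" for f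
  proof -
    have fm [measurable]: "f \<in> borel_measurable M" using f by (simp add: L2_def)
    have fi: "integrable M f"
      using f by (auto simp: L2_def intro: square_integrable_imp_integrable)
    have ffi: "integrable ?MM (\<lambda>(x, y). \<bar>f x\<bar> * \<bar>f y\<bar>)"
      by (rule integrable_product_kernel[OF M]) (use fi in auto)
    let ?F = "\<lambda>(x, y). K x y * f y * f x"
    have Fi: "integrable ?MM ?F"
    proof (rule Bochner_Integration.integrable_bound)
      show "integrable ?MM (\<lambda>z. B * (\<lambda>(x, y). \<bar>f x\<bar> * \<bar>f y\<bar>) z)"
        by (rule integrable_mult_right) (use ffi in auto)
      show "AE z in ?MM. norm (?F z) \<le> norm (B * (\<lambda>(x, y). \<bar>f x\<bar> * \<bar>f y\<bar>) z)"
      proof (rule AE_I2, clarsimp simp: space_pair_measure abs_mult)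
        fix x y assume "x \<in> space M" "y \<in> space M"
        then have "\<bar>K x y\<bar> \<le> \<bar>B\<bar>" using B[of x y] by linarith
        then show "\<bar>K x y\<bar> * \<bar>f y\<bar> * \<bar>f x\<bar> \<le> \<bar>B\<bar> * (\<bar>f x\<bar> * \<bar>f y\<bar>)"
          using mult_right_mono[of "\<bar>K x y\<bar>" "\<bar>B\<bar>" "\<bar>f x\<bar> * \<bar>f y\<bar>"] by (simp add: ac_simps)
      qed
    qed measurable
    let ?D = "\<integral>(x, y). \<bar>f x\<bar> * \<bar>f y\<bar> \<partial>?MM"
    have key: "- \<epsilon> * ?D \<le> (\<integral>z. ?F z \<partial>?MM)" if \<epsilon>: "\<epsilon> > 0" for \<epsilon>
    proof -
      obtain p A where A: "finite A" and p [measurable]: "p \<in> measurable M (count_space A)"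
        and p\<Omega>: "\<And>x. x \<in> space M \<Longrightarrow> x \<in> \<Omega> \<Longrightarrow> p x \<in> \<Omega>"
        and pK: "\<And>x y. x \<in> space M \<Longrightarrow> y \<in> space M \<Longrightarrow> \<bar>K x y - K (p x) (p y)\<bar> \<le> \<epsilon>"
        using approx[OF \<epsilon>] by blast
      have pA: "p x \<in> A" if "x \<in> space M" for x using measurable_space[OF p that] by simp
      have pre: "{x \<in> space M. p x = a} \<in> sets M" if "a \<in> A" for a
        using measurable_sets[OF p, of "{a}"] that by (simp add: vimage_def Collect_conj_eq Int_commute)
      define u where "u a = (\<lambda>x. indicator {x \<in> space M. p x = a} x *\<^sub>R f x)" for a
      have ui: "integrable M (u a)" if "a \<in> A" for a
        unfolding u_def by (rule integrable_mult_indicator[OF pre[OF that] fi])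
      let ?G = "\<lambda>(x, y). K (p x) (p y) * f y * f x"
      have Geq: "?G z = (\<Sum>a\<in>A. \<Sum>b\<in>A. K a b * (\<lambda>(x, y). u a x * u b y) z)" if zMM: "z \<in> space ?MM" for z
      proof -
        obtain x y where z: "z = (x, y)" "x \<in> space M" "y \<in> space M"
          using zMM by (auto simp: space_pair_measure)
        have "(\<Sum>a\<in>A. \<Sum>b\<in>A. K a b * (u a x * u b y))
            = (\<Sum>a\<in>A. if a = p x then (\<Sum>b\<in>A. if b = p y then K a b * (f x * f y) else 0) else 0)"
          by (intro sum.cong refl) (auto simp: u_def z indicator_def intro!: sum.neutral sum.cong)
        also have "\<dots> = K (p x) (p y) * (f x * f y)"
          using A pA z by (simp add: sum.delta)
        finally show ?thesis by (simp add: z)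
      qed
      have Gi': "integrable ?MM (\<lambda>z. \<Sum>a\<in>A. \<Sum>b\<in>A. K a b * (\<lambda>(x, y). u a x * u b y) z)"
        by (intro Bochner_Integration.integrable_sum integrable_mult_right integrable_product_kernel(1)[OF M] ui)
      have Gi: "integrable ?MM ?G"
        using Gi' Geq by (subst Bochner_Integration.integrable_cong[OF refl Geq]) auto
      have "(\<integral>z. ?G z \<partial>?MM) = (\<Sum>a\<in>A. \<Sum>b\<in>A. K a b * ((\<integral>x. u a x \<partial>M) * (\<integral>x. u b x \<partial>M)))"
      proof -
        let ?U = "\<lambda>a b z. K a b * (\<lambda>(x, y). u a x * u b y) z"
        have Ui: "integrable ?MM (?U a b)" if "a \<in> A" "b \<in> A" for a b
          by (intro integrable_mult_right integrable_product_kernel(1)[OF M] ui that)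
        have "(\<integral>z. ?G z \<partial>?MM) = (\<integral>z. (\<Sum>a\<in>A. \<Sum>b\<in>A. ?U a b z) \<partial>?MM)"
          by (rule Bochner_Integration.integral_cong[OF refl Geq])
        also have "\<dots> = (\<Sum>a\<in>A. \<integral>z. (\<Sum>b\<in>A. ?U a b z) \<partial>?MM)"
          by (rule Bochner_Integration.integral_sum, rule Bochner_Integration.integrable_sum, rule Ui)
        also have "\<dots> = (\<Sum>a\<in>A. \<Sum>b\<in>A. \<integral>z. ?U a b z \<partial>?MM)"
          by (intro sum.cong refl Bochner_Integration.integral_sum Ui)
        also have "\<dots> = (\<Sum>a\<in>A. \<Sum>b\<in>A. K a b * ((\<integral>x. u a x \<partial>M) * (\<integral>x. u b x \<partial>M)))"
          by (intro sum.cong refl) (simp add: integrable_product_kernel(2)[OF M ui ui])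
        finally show ?thesis .
      qed
      also have "\<dots> = (\<Sum>a\<in>A \<inter> \<Omega>. \<Sum>b\<in>A \<inter> \<Omega>. (\<integral>x. u a x \<partial>M) * (\<integral>x. u b x \<partial>M) * K a b)"
      proof -
        \<comment> \<open>As \<open>p\<close> maps \<Omega> into itself, a value outside \<Omega> is
          attained only on a null set. Its coefficient vanishes, and only indices in \<Omega>
          remain, where the matrices are known to be positive.\<close>
        have z: "(\<integral>x. u a x \<partial>M) = 0" if "a \<notin> \<Omega>" for a
        proof -
          have "AE x in M. u a x = 0"
            using \<Omega> AE_space by eventually_elim (use p\<Omega> that in \<open>auto simp: u_def indicator_def\<close>)
          then show ?thesis by (simp add: integral_eq_zero_AE)
        qed
        show ?thesis
          by (rule HOL.sym, intro sum.mono_neutral_cong_left ballI A)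
             (auto simp: z A intro!: sum.mono_neutral_cong_left)
      qed
      also have "\<dots> \<ge> 0" by (rule psd) (use A in auto)
      finally have G0: "(\<integral>z. ?G z \<partial>?MM) \<ge> 0" .
      have "\<bar>(\<integral>z. ?F z \<partial>?MM) - (\<integral>z. ?G z \<partial>?MM)\<bar> = \<bar>\<integral>z. ?F z - ?G z \<partial>?MM\<bar>"
        by (simp only: Bochner_Integration.integral_diff[OF Fi Gi])
      also have "\<dots> \<le> (\<integral>z. \<bar>?F z - ?G z\<bar> \<partial>?MM)" by (rule integral_abs_bound)
      also have "\<dots> \<le> (\<integral>z. \<epsilon> * (\<lambda>(x, y). \<bar>f x\<bar> * \<bar>f y\<bar>) z \<partial>?MM)"
      proof (rule integral_mono)
        show "integrable ?MM (\<lambda>z. \<bar>?F z - ?G z\<bar>)"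
          by (rule integrable_abs[OF Bochner_Integration.integrable_diff[OF Fi Gi]])
        show "integrable ?MM (\<lambda>z. \<epsilon> * (\<lambda>(x, y). \<bar>f x\<bar> * \<bar>f y\<bar>) z)"
          by (rule integrable_mult_right) (use ffi in auto)
        fix z assume "z \<in> space ?MM"
        then obtain x y where z: "z = (x, y)" "x \<in> space M" "y \<in> space M"
          by (auto simp: space_pair_measure)
        have "\<bar>K x y * f y * f x - K (p x) (p y) * f y * f x\<bar> = \<bar>K x y - K (p x) (p y)\<bar> * (\<bar>f x\<bar> * \<bar>f y\<bar>)"
          by (simp add: abs_mult[symmetric] algebra_simps)
        also have "\<dots> \<le> \<epsilon> * (\<bar>f x\<bar> * \<bar>f y\<bar>)"
          by (intro mult_right_mono pK z) auto
        finally show "\<bar>?F z - ?G z\<bar> \<le> \<epsilon> * (\<lambda>(x, y). \<bar>f x\<bar> * \<bar>f y\<bar>) z" by (simp add: z)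
      qed
      also have "\<dots> = \<epsilon> * ?D" by simp
      finally show ?thesis using G0 by linarith
    qed
    have "0 \<le> (\<integral>z. ?F z \<partial>?MM)"
    proof (rule field_le_epsilon)
      fix e :: real assume e: "e > 0"
      have C: "?D \<ge> 0" by (rule integral_nonneg_AE) auto
      have "- (e / (?D + 1)) * ?D \<le> (\<integral>z. ?F z \<partial>?MM)" by (rule key) (use e C in auto)
      moreover have "(e / (?D + 1)) * ?D \<le> e"
        using C e by (simp add: field_simps)
      ultimately show "0 \<le> (\<integral>z. ?F z \<partial>?MM) + e" by linarith
    qed
    then show ?thesis by (simp add: integral_kernel_op[OF M Fi])
  qed
  ultimately show ?thesis by (auto simp: psd_kernel_def)
qed

section \<open>Radon measures on compact Hausdorff spaces\<close>

lemma continuous_map_realI: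
  fixes f :: "'a \<Rightarrow> real"
  assumes "\<And>x \<epsilon>. x \<in> topspace X \<Longrightarrow> \<epsilon> > 0 \<Longrightarrow>
    \<exists>U. openin X U \<and> x \<in> U \<and> (\<forall>y\<in>U. \<bar>f y - f x\<bar> \<le> \<epsilon>)"
  shows "continuous_map X euclideanreal f"
proof -
  have "continuous_map X Met_TC.mtopology f"
    unfolding Met_TC.continuous_map_to_metric
  proof (intro ballI allI impI)
    fix x and \<epsilon> :: real assume "x \<in> topspace X" "\<epsilon> > 0"
    then obtain U where "openin X U" "x \<in> U" "\<forall>y\<in>U. \<bar>f y - f x\<bar> \<le> \<epsilon> / 2"
      using assms[of x "\<epsilon> / 2"] by auto
    then show "\<exists>U. openin X U \<and> x \<in> U \<and> (\<forall>y\<in>U. f y \<in> Met_TC.mball (f x) \<epsilon>)"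
      using \<open>\<epsilon> > 0\<close> by (intro exI[of _ U]) (fastforce simp: dist_real_def abs_minus_commute)
  qed
  then show ?thesis by simp
qed

locale radon_space =
  fixes V :: "'a topology" and \<omega> :: "'a measure"
  assumes compact: "compact_space V" and Hausdorff: "Hausdorff_space V"
    and radon: "Radon_measure_on V \<omega>"
begin

lemma space_eq [simp]: "space \<omega> = topspace V"
  using radon by (simp add: Radon_measure_on_def)

lemma sets_open: "openin V U \<Longrightarrow> U \<in> sets \<omega>"
  using radon by (auto simp: Radon_measure_on_def)

lemma sets_closed: "closedin V U \<Longrightarrow> U \<in> sets \<omega>"
  using sets_open[of "topspace V - U"] sets.compl_sets[of "topspace V - U" \<omega>]
  by (auto simp: closedin_def double_diff)

lemma sets_topspace [simp]: "topspace V \<in> sets \<omega>"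
  by (rule sets_open) simp

lemma finite_measure: "finite_measure \<omega>"
proof
  have "compactin V (topspace V)" using compact by (simp add: compact_space_def)
  then show "emeasure \<omega> (space \<omega>) \<noteq> \<infinity>"
    using radon unfolding Radon_measure_on_def by (metis less_irrefl)
qed

sublocale finite_measure \<omega> by (rule finite_measure)

sublocale product_sigma_finite "\<lambda>_. \<omega>" ..

lemma finite_measure_PiM: "finite I \<Longrightarrow> finite_measure (PiM I (\<lambda>_. \<omega>))"
proof
  assume I: "finite I"
  have "emeasure (PiM I (\<lambda>_. \<omega>)) (PiE I (\<lambda>_. space \<omega>)) = (\<Prod>i\<in>I. emeasure \<omega> (space \<omega>))"
    by (rule emeasure_PiM[OF I]) auto
  then show "emeasure (PiM I (\<lambda>_. \<omega>)) (space (PiM I (\<lambda>_. \<omega>))) \<noteq> \<infinity>"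
    using finite_emeasure_space by (simp only: space_PiM) (simp add: power_eq_top_ennreal del: space_eq)
qed

definition supp :: "'a set" where
  "supp = topspace V - \<Union>{U. openin V U \<and> emeasure \<omega> U = 0}"

lemma supp_subset: "supp \<subseteq> topspace V"
  by (auto simp: supp_def)

lemma closedin_supp: "closedin V supp"
  unfolding supp_def by (intro closedin_diff closedin_topspace openin_Union) auto

lemma sets_supp: "supp \<in> sets \<omega>"
  by (rule sets_closed[OF closedin_supp])

lemma measure_open_pos:
  assumes "openin V U" "x \<in> U" "x \<in> supp"
  shows "measure \<omega> U > 0"
proof -
  have "emeasure \<omega> U \<noteq> 0" using assms by (auto simp: supp_def)
  then show ?thesis by (simp add: emeasure_eq_measure zero_less_measure_iff)
qed

text \<open>The complement may be an uncountable union of null open sets. Inner regularity reduces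
  the claim to its compact subsets, and each of these is covered by finitely many of the null
  sets.\<close>

lemma null_compl_supp: "emeasure \<omega> (topspace V - supp) = 0"
proof -
  let ?N = "topspace V - supp"
  have N: "?N \<in> sets \<omega>" using sets_supp by (metis sets.compl_sets space_eq)
  have "emeasure \<omega> C = 0" if C: "compactin V C" "C \<subseteq> ?N" for C
  proof -
    let ?\<U> = "{U. openin V U \<and> emeasure \<omega> U = 0}"
    have "C \<subseteq> \<Union>?\<U>" using C by (auto simp: supp_def)
    then obtain \<F> where F: "finite \<F>" "\<F> \<subseteq> ?\<U>" "C \<subseteq> \<Union>\<F>"
      using compactinD[OF C(1), of ?\<U>] by auto
    have "emeasure \<omega> C \<le> emeasure \<omega> (\<Union>\<F>)"
      by (rule emeasure_mono) (use F sets_open in auto)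
    also have "\<dots> \<le> (\<Sum>U\<in>\<F>. emeasure \<omega> U)"
      using emeasure_subadditive_finite[OF F(1), of "\<lambda>U. U" \<omega>] F sets_open by auto
    also have "\<dots> = 0" using F by (intro sum.neutral) auto
    finally show ?thesis by simp
  qed
  then have "(SUP C\<in>{C. compactin V C \<and> C \<subseteq> ?N}. emeasure \<omega> C) = 0"
    by (auto simp: SUP_eq_const bot_ennreal intro!: antisym SUP_least)
  then show ?thesis using radon N unfolding Radon_measure_on_def by metis
qed

lemma AE_supp: "AE x in \<omega>. x \<in> supp"
proof (rule AE_I)
  show "{x \<in> space \<omega>. x \<notin> supp} \<subseteq> topspace V - supp" by auto
  show "emeasure \<omega> (topspace V - supp) = 0" by (rule null_compl_supp)
  show "topspace V - supp \<in> sets \<omega>" using sets_supp by (metis sets.compl_sets space_eq)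
qed

text \<open>An open subset of the product need not belong to the product
  \<open>\<sigma>\<close>-algebra, so openness of \<open>{f > a}\<close> is not enough. The closed
  set \<open>{f \<ge> a + 1/(n+1)}\<close> is compact, and a finite union of open boxes fits between
  it and \<open>{f > a}\<close>; the union of these over all \<open>n\<close> is
  \<open>{f > a}\<close>.\<close>

lemma continuous_measurable_PiM:
  fixes f :: "('i \<Rightarrow> 'a) \<Rightarrow> real"
  assumes I: "finite I" and f: "continuous_map (product_topology (\<lambda>_. V) I) euclideanreal f"
  shows "f \<in> borel_measurable (PiM I (\<lambda>_. \<omega>))"
  unfolding borel_measurable_iff_greater
proof
  fix a
  let ?X = "product_topology (\<lambda>_::'i. V) I"
  let ?M = "PiM I (\<lambda>_. \<omega>)"
  have sp: "space ?M = topspace ?X" by (simp add: space_PiM)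
  have cX: "compact_space ?X" using compact by (simp add: compact_space_product_topology)
  let ?U = "{v \<in> topspace ?X. f v \<in> {a<..}}"
  have U: "openin ?X ?U"
    by (rule openin_continuous_map_preimage[OF f]) auto
  have "\<exists>C\<in>sets ?M. {v \<in> topspace ?X. f v \<in> {a + 1 / real (Suc n)..}} \<subseteq> C \<and> C \<subseteq> ?U" for n
  proof -
    let ?K = "{v \<in> topspace ?X. f v \<in> {a + 1 / real (Suc n)..}}"
    have "closedin ?X ?K"
      by (rule closedin_continuous_map_preimage[OF f]) auto
    then have K: "compactin ?X ?K" by (rule closedin_compact_space[OF cX])
    let ?\<B> = "{B. \<exists>W. B = PiE I W \<and> (\<forall>i\<in>I. openin V (W i)) \<and> B \<subseteq> ?U}"
    have opB: "openin ?X B" "B \<in> sets ?M" if B: "B \<in> ?\<B>" for B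
    proof -
      obtain W where W: "B = PiE I W" "\<forall>i\<in>I. openin V (W i)" using B by blast
      then show "openin ?X B" by (simp add: openin_PiE[OF I])
      show "B \<in> sets ?M" unfolding W(1) by (rule sets_PiM_I_finite[OF I]) (use W sets_open in auto)
    qed
    have "?K \<subseteq> \<Union>?\<B>"
    proof
      fix v assume v: "v \<in> ?K"
      have "1 / real (Suc n) > 0" by simp
      moreover have "f v \<ge> a + 1 / real (Suc n)" using v by auto
      ultimately have "f v > a" by linarith
      then have vU: "v \<in> ?U" using v by auto
      obtain W where W: "\<forall>i\<in>I. openin V (W i)" "v \<in> PiE I W" "PiE I W \<subseteq> ?U"
        using bspec[OF iffD1[OF openin_product_topology_alt U] vU]
        by (elim exE conjE) (rule that)
      then show "v \<in> \<Union>?\<B>" by blast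
    qed
    then obtain \<F> where F: "finite \<F>" "\<F> \<subseteq> ?\<B>" "?K \<subseteq> \<Union>\<F>"
      using compactinD[OF K, of ?\<B>] opB(1) by auto
    have "\<Union>\<F> \<in> sets ?M"
      by (rule sets.finite_Union[OF F(1)]) (use F(2) opB(2) in blast)
    moreover have "\<Union>\<F> \<subseteq> ?U" using F(2) by blast
    ultimately show ?thesis using F(3) by blast
  qed
  then have "\<forall>n. \<exists>C. C \<in> sets ?M \<and> {v \<in> topspace ?X. f v \<in> {a + 1 / real (Suc n)..}} \<subseteq> C \<and> C \<subseteq> ?U"
    by (intro allI) (simp only: Bex_def)
  from choice[OF this] obtain C where C': "\<forall>n. C n \<in> sets ?M \<and>
      {v \<in> topspace ?X. f v \<in> {a + 1 / real (Suc n)..}} \<subseteq> C n \<and> C n \<subseteq> ?U" by (elim exE)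
  have C: "C n \<in> sets ?M" "{v \<in> topspace ?X. f v \<in> {a + 1 / real (Suc n)..}} \<subseteq> C n" "C n \<subseteq> ?U" for n
    using spec[OF C', of n] by (simp_all only: simp_thms)
  have "?U \<subseteq> (\<Union>n. C n)"
  proof
    fix v assume v: "v \<in> ?U"
    then obtain n where "1 / real (Suc n) < f v - a"
      using reals_Archimedean[of "f v - a"] by (auto simp: inverse_eq_divide)
    then have "v \<in> {v \<in> topspace ?X. f v \<in> {a + 1 / real (Suc n)..}}" using v by auto
    then show "v \<in> (\<Union>n. C n)" using C(2) by blast
  qed
  then have "?U = (\<Union>n. C n)" using C(3) by blast
  moreover have "{v \<in> space ?M. a < f v} = ?U" by (auto simp: sp)
  ultimately show "{v \<in> space ?M. a < f v} \<in> sets ?M" using C(1) by auto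
qed

text \<open>The space is cut into cells by the first member of a finite cover that contains a point,
  and each cell is sent to a representative. A cell gets separate representatives for its part on
  the support and its part off it: this keeps the support invariant, as
  \<open>pointwise_imp_psd_kernel\<close> demands of \<Omega>.\<close>

lemma finite_approximation:
  fixes D :: "'a \<Rightarrow> 'a \<Rightarrow> real"
  assumes D: "\<And>x. x \<in> topspace V \<Longrightarrow> \<exists>U. openin V U \<and> x \<in> U \<and> (\<forall>y\<in>U. \<forall>z\<in>U. D y z \<le> \<epsilon>)"
  obtains p A where "finite A" "A \<subseteq> topspace V" "p \<in> measurable \<omega> (count_space A)"
    "\<And>x. x \<in> supp \<Longrightarrow> p x \<in> supp" "\<And>x. x \<in> topspace V \<Longrightarrow> D x (p x) \<le> \<epsilon>"
proof -
  let ?\<U> = "{U. openin V U \<and> (\<forall>y\<in>U. \<forall>z\<in>U. D y z \<le> \<epsilon>)}"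
  have "topspace V \<subseteq> \<Union>?\<U>" using D by blast
  then obtain \<F> where F: "finite \<F>" "\<F> \<subseteq> ?\<U>" "topspace V \<subseteq> \<Union>\<F>"
    using compactinD[of V "topspace V" ?\<U>] compact unfolding compact_space_def by auto
  obtain n and U :: "nat \<Rightarrow> 'a set" where U: "\<F> = U ` {i. i < n}"
    using finite_imp_nat_seg_image_inj_on[OF F(1)] by (elim exE conjE) (rule that)
  have Uop: "openin V (U i)" and UD: "\<forall>y\<in>U i. \<forall>z\<in>U i. D y z \<le> \<epsilon>" if "i < n" for i
    using F(2) U that by auto
  define L where "L x = (LEAST i. i < n \<and> x \<in> U i)" for x
  have L: "L x < n" "x \<in> U (L x)" if x: "x \<in> topspace V" for x
  proof -
    have "\<exists>i. i < n \<and> x \<in> U i" using F(3) x by (auto simp: U)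
    from LeastI_ex[OF this] show "L x < n" "x \<in> U (L x)" by (auto simp: L_def)
  qed
  have Lm [measurable]: "L \<in> measurable \<omega> (count_space UNIV)"
    unfolding L_def
  proof (rule measurable_Least)
    fix i
    have "{x \<in> space \<omega>. i < n \<and> x \<in> U i} = (if i < n then U i else {})"
      using Uop openin_subset[of V "U i"] by auto
    also have "\<dots> \<in> sets \<omega>" using Uop sets_open by auto
    finally show "(\<lambda>x. i < n \<and> x \<in> U i) \<in> measurable \<omega> (count_space UNIV)"
      unfolding pred_def .
  qed
  define g1 where "g1 i = (SOME y. y \<in> supp \<and> L y = i)" for i
  define g0 where "g0 i = (SOME y. y \<in> topspace V - supp \<and> L y = i)" for i
  define p where "p x = (if x \<in> supp then g1 (L x) else g0 (L x))" for x
  have g1: "p x \<in> supp \<and> L (p x) = L x" if "x \<in> supp" for x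
  proof -
    have "\<exists>y. y \<in> supp \<and> L y = L x" using that by auto
    from someI_ex[OF this] show ?thesis using that by (simp add: p_def g1_def)
  qed
  have g0: "p x \<in> topspace V - supp \<and> L (p x) = L x" if "x \<in> topspace V - supp" for x
  proof -
    have "\<exists>y. y \<in> topspace V - supp \<and> L y = L x" using that by auto
    from someI_ex[OF this] show ?thesis using that by (simp add: p_def g0_def)
  qed
  have pL: "p x \<in> topspace V \<and> L (p x) = L x" if "x \<in> topspace V" for x
    using g1[of x] g0[of x] supp_subset that by blast
  let ?A = "(g1 ` {..<n} \<union> g0 ` {..<n}) \<inter> topspace V"
  have pm: "p \<in> measurable \<omega> (count_space UNIV)"
  proof -
    have [measurable]: "Measurable.pred \<omega> (\<lambda>x. x \<in> supp)"
      using sets_supp by measurable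
    show ?thesis unfolding p_def by measurable
  qed
  have pA: "p x \<in> ?A" if "x \<in> topspace V" for x
    using pL[OF that] L(1)[OF that] by (auto simp: p_def)
  show ?thesis
  proof
    show "finite ?A" "?A \<subseteq> topspace V" by auto
    show "p \<in> measurable \<omega> (count_space ?A)"
      using pA measurable_sets[OF pm] by (subst measurable_count_space_eq2) auto
    show "p x \<in> supp" if "x \<in> supp" for x using g1[OF that] by auto
    show "D x (p x) \<le> \<epsilon>" if "x \<in> topspace V" for x
      using UD[OF L(1)[OF that]] L(2)[OF that] L(2)[of "p x"] pL[OF that] by auto
  qed
qed

lemma disjoint_neighbourhoods:
  assumes "finite S" "S \<subseteq> topspace V"
  obtains U where "\<And>a. a \<in> S \<Longrightarrow> openin V (U a)" "\<And>a. a \<in> S \<Longrightarrow> a \<in> U a"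
    "\<And>a b. a \<in> S \<Longrightarrow> b \<in> S \<Longrightarrow> a \<noteq> b \<Longrightarrow> U a \<inter> U b = {}"
proof -
  define sep where "sep a b z \<longleftrightarrow> openin V (fst z) \<and> openin V (snd z) \<and>
    a \<in> fst z \<and> b \<in> snd z \<and> disjnt (fst z) (snd z)" for a b z
  define P where "P a b = fst (SOME z. sep a b z)" for a b
  define Q where "Q a b = snd (SOME z. sep a b z)" for a b
  have PQ: "openin V (P a b) \<and> openin V (Q a b) \<and> a \<in> P a b \<and> b \<in> Q a b \<and> disjnt (P a b) (Q a b)"
    if ab: "a \<in> topspace V" "b \<in> topspace V" "a \<noteq> b" for a b
  proof -
    obtain X Y where "openin V X" "openin V Y" "a \<in> X" "b \<in> Y" "disjnt X Y"
      using Hausdorff[unfolded Hausdorff_space_def, rule_format, OF conjI[OF ab(1) conjI[OF ab(2,3)]]]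
      by (elim exE conjE) (rule that)
    then have "\<exists>z. sep a b z"
      unfolding sep_def by (intro exI[of _ "(X, Y)"]) simp
    from someI_ex[OF this] show ?thesis by (simp add: sep_def P_def Q_def)
  qed
  define U where "U a = topspace V \<inter> \<Inter>((\<lambda>b. P a b \<inter> Q b a) ` (S - {a}))" for a
  show ?thesis
  proof
    fix a assume a: "a \<in> S"
    show "openin V (U a)"
      unfolding U_def
    proof (rule openin_Int_Inter)
      fix X assume "X \<in> (\<lambda>b. P a b \<inter> Q b a) ` (S - {a})"
      then obtain b where "b \<in> S" "b \<noteq> a" "X = P a b \<inter> Q b a" by auto
      then show "openin V X" using PQ[of a b] PQ[of b a] assms(2) a by auto
    qed (use assms in auto)
    have "a \<in> P a b \<inter> Q b a" if "b \<in> S - {a}" for b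
      using PQ[of a b] PQ[of b a] that assms(2) a by auto
    then show "a \<in> U a" unfolding U_def using assms(2) a by auto
  next
    fix a b assume ab: "a \<in> S" "b \<in> S" "a \<noteq> b"
    have "U a \<subseteq> P a b" "U b \<subseteq> Q a b" using ab by (auto simp: U_def)
    then show "U a \<inter> U b = {}" using PQ[of a b] ab assms by (auto simp: disjnt_def)
  qed
qed

end

section \<open>The pseudometric of a continuous function on \<open>Sub(V,k)\<close>\<close>

lemma continuous_map_tuple_set:
  assumes "k \<ge> 1"
  shows "continuous_map (product_topology (\<lambda>_. V) {..<k}) (Sub_topology V k) (tuple_set k)"
  unfolding continuous_map_def
proof (intro conjI allI impI)
  let ?X = "product_topology (\<lambda>_. V) {..<k}"
  have im: "tuple_set k ` topspace ?X = Sub (topspace V) k - {{}}"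
    using tuple_set_image[OF assms] by simp
  then show "tuple_set k \<in> topspace ?X \<rightarrow> topspace (Sub_topology V k)"
    unfolding topspace_Sub_topology[OF assms] by blast
  fix U assume "openin (Sub_topology V k) U"
  then have "openin ?X {v \<in> topspace ?X. tuple_set k v \<in> U - {{}}}"
    by (simp only: openin_Sub_topology openin_quotient_topology)
  moreover have "{v \<in> topspace ?X. tuple_set k v \<in> U - {{}}} = {v \<in> topspace ?X. tuple_set k v \<in> U}"
    using im by blast
  ultimately show "openin ?X {v \<in> topspace ?X. tuple_set k v \<in> U}" by simp
qed

text \<open>The point \<open>{}\<close> is isolated and the rest carries a quotient topology, so
  continuity is tested on tuples.\<close>

lemma continuous_map_Sub_topologyI:
  assumes k: "k \<ge> 1"
    and f: "continuous_map (product_topology (\<lambda>_. V) {..<k}) Y (\<lambda>v. f (tuple_set k v))"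
    and e: "f {} \<in> topspace Y"
  shows "continuous_map (Sub_topology V k) Y f"
  unfolding continuous_map_def topspace_Sub_topology[OF k]
proof (intro conjI allI impI)
  let ?X = "product_topology (\<lambda>_. V) {..<k}"
  have im: "tuple_set k ` topspace ?X = Sub (topspace V) k - {{}}"
    using tuple_set_image[OF k] by simp
  have fv: "f (tuple_set k v) \<in> topspace Y" if "v \<in> topspace ?X" for v
    using f that unfolding continuous_map_def by blast
  show "f \<in> Sub (topspace V) k \<rightarrow> topspace Y"
  proof
    fix S assume S: "S \<in> Sub (topspace V) k"
    show "f S \<in> topspace Y"
    proof (cases "S = {}")
      case False
      then have "S \<in> tuple_set k ` topspace ?X" using S im by blast
      then show ?thesis using fv by blast
    qed (simp add: e)
  qed
  fix U assume U: "openin Y U"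
  let ?W = "{S \<in> Sub (topspace V) k. f S \<in> U}"
  have "{v \<in> topspace ?X. tuple_set k v \<in> ?W - {{}}} = {v \<in> topspace ?X. f (tuple_set k v) \<in> U}"
    using im by blast
  moreover have "openin ?X {v \<in> topspace ?X. f (tuple_set k v) \<in> U}"
    by (rule openin_continuous_map_preimage[OF f U])
  ultimately show "openin (Sub_topology V k) ?W"
    unfolding openin_Sub_topology openin_quotient_topology im by auto
qed

lemma insert_in_Sub: "S \<in> Sub X k \<Longrightarrow> x \<in> X \<Longrightarrow> k < n \<Longrightarrow> insert x S \<in> Sub X n"
  using card_insert_le_m1[of n S x] by (auto simp: Sub_def card_insert_if)

locale Sub_function = radon_space V \<omega> for V :: "'a topology" and \<omega> :: "'a measure" +
  fixes K :: nat and \<nu> :: "'a set \<Rightarrow> real"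
  assumes K_pos: "K \<ge> 1" and cont: "continuous_map (Sub_topology V K) euclideanreal \<nu>"
begin

lemma bounded_fun: "\<exists>B. \<forall>S\<in>Sub (topspace V) K. \<bar>\<nu> S\<bar> \<le> B"
proof -
  let ?X = "product_topology (\<lambda>_. V) {..<K}"
  have "compactin ?X (topspace ?X)"
    unfolding compact_space_def[symmetric] using compact by (simp add: compact_space_product_topology)
  moreover have "continuous_map ?X euclideanreal (\<nu> \<circ> tuple_set K)"
    by (rule continuous_map_compose[OF continuous_map_tuple_set[OF K_pos] cont])
  ultimately have "compact ((\<nu> \<circ> tuple_set K) ` topspace ?X)"
    using image_compactin by fastforce
  from compact_imp_bounded[OF this] obtain B where B: "\<forall>v\<in>topspace ?X. \<bar>\<nu> (tuple_set K v)\<bar> \<le> B"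
    unfolding bounded_iff by auto
  have "\<bar>\<nu> S\<bar> \<le> max B \<bar>\<nu> {}\<bar>" if S: "S \<in> Sub (topspace V) K" for S
  proof (cases "S = {}")
    case False
    then have "S \<in> tuple_set K ` topspace ?X"
      using S tuple_set_image[OF K_pos, of "topspace V"] by auto
    then show ?thesis using B by auto
  qed auto
  then show ?thesis by blast
qed

text \<open>The sup-norm distance between the functions that \<nu> induces on the remaining
  vertices. The bound \<open>K - 1\<close> leaves room for the inserted vertex. Distinct vertices at
  distance 0 are indistinguishable for \<nu>.\<close>

definition d :: "'a \<Rightarrow> 'a \<Rightarrow> real" where
  "d x y = (SUP R\<in>Sub (topspace V) (K - 1). \<bar>\<nu> (insert x R) - \<nu> (insert y R)\<bar>)"

lemma empty_in_Sub [simp]: "{} \<in> Sub X k"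
  by (simp add: Sub_def)

lemma d_upper:
  assumes "x \<in> topspace V" "y \<in> topspace V" "R \<in> Sub (topspace V) (K - 1)"
  shows "\<bar>\<nu> (insert x R) - \<nu> (insert y R)\<bar> \<le> d x y"
  unfolding d_def
proof (rule cSUP_upper[OF assms(3)])
  obtain B where B: "\<forall>S\<in>Sub (topspace V) K. \<bar>\<nu> S\<bar> \<le> B" using bounded_fun by blast
  show "bdd_above ((\<lambda>R. \<bar>\<nu> (insert x R) - \<nu> (insert y R)\<bar>) ` Sub (topspace V) (K - 1))"
  proof (rule bdd_aboveI2)
    fix R assume R: "R \<in> Sub (topspace V) (K - 1)"
    have "insert x R \<in> Sub (topspace V) K" "insert y R \<in> Sub (topspace V) K"
      using insert_in_Sub[OF R] assms K_pos by auto
    then have "\<bar>\<nu> (insert x R)\<bar> \<le> B" "\<bar>\<nu> (insert y R)\<bar> \<le> B" using B by blast+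
    then show "\<bar>\<nu> (insert x R) - \<nu> (insert y R)\<bar> \<le> B + B" by linarith
  qed
qed

lemma d_least:
  assumes "\<And>R. R \<in> Sub (topspace V) (K - 1) \<Longrightarrow> \<bar>\<nu> (insert x R) - \<nu> (insert y R)\<bar> \<le> e"
  shows "d x y \<le> e"
  unfolding d_def by (rule cSUP_least) (use assms empty_in_Sub in blast)+

lemma d_nonneg: "x \<in> topspace V \<Longrightarrow> y \<in> topspace V \<Longrightarrow> 0 \<le> d x y"
  using d_upper[of x y "{}"] by simp

lemma d_refl [simp]: "d x x = 0"
proof -
  have "(\<lambda>R. \<bar>\<nu> (insert x R) - \<nu> (insert x R)\<bar>) ` Sub (topspace V) (K - 1) = {0}"
    using empty_in_Sub by fastforce
  then show ?thesis unfolding d_def by (metis cSup_singleton)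
qed

lemma d_commute: "d x y = d y x"
  unfolding d_def by (simp add: abs_minus_commute)

lemma d_triangle:
  assumes "x \<in> topspace V" "y \<in> topspace V" "z \<in> topspace V"
  shows "d x z \<le> d x y + d y z"
proof (rule d_least)
  fix R assume R: "R \<in> Sub (topspace V) (K - 1)"
  show "\<bar>\<nu> (insert x R) - \<nu> (insert z R)\<bar> \<le> d x y + d y z"
    using d_upper[OF assms(1,2) R] d_upper[OF assms(2,3) R] by linarith
qed

text \<open>The supremum in \<open>d\<close> runs over infinitely many sets, so continuity in one
  vertex must be uniform in the others. The tube lemma on \<open>V \<times> V^K\<close> provides
  this, its second factor being compact.\<close>

lemma d_neighbourhood:
  assumes x0: "x0 \<in> topspace V" and \<epsilon>: "\<epsilon> > 0"
  shows "\<exists>U. openin V U \<and> x0 \<in> U \<and> (\<forall>y\<in>U. d x0 y \<le> \<epsilon>)"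
proof -
  let ?X = "product_topology (\<lambda>_. V) {..<K}"
  \<comment> \<open>Tuples describe nonempty sets only. With \<open>b\<close> true every coordinate
    is the varying vertex, which gives the case \<open>R = {}\<close>; with \<open>b\<close> false
    only coordinate 0 varies, which gives nonempty \<open>R\<close>.\<close>
  define H where "H b = (\<lambda>z. \<nu> (tuple_set K (\<lambda>i\<in>{..<K}. if i = 0 \<or> b then fst z else snd z i)))"
    for b and z :: "'a \<times> (nat \<Rightarrow> 'a)"
  have H: "continuous_map (prod_topology V ?X) euclideanreal (H b)" for b
  proof -
    have "continuous_map (prod_topology V ?X) ?X
      (\<lambda>z. \<lambda>i\<in>{..<K}. if i = 0 \<or> b then fst z else snd z i)"
      unfolding continuous_map_componentwise
    proof (intro conjI ballI)
      fix k assume k: "k \<in> {..<K}"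
      show "continuous_map (prod_topology V ?X) V
          (\<lambda>z. (\<lambda>i\<in>{..<K}. if i = 0 \<or> b then fst z else snd z i) k)"
      proof (cases "k = 0 \<or> b")
        case True
        then show ?thesis using k by (simp add: continuous_map_fst)
      next
        case False
        have "continuous_map (prod_topology V ?X) V ((\<lambda>v. v k) \<circ> snd)"
          by (rule continuous_map_compose[OF continuous_map_snd continuous_map_product_projection[OF k]])
        then show ?thesis using k False by (simp add: comp_def)
      qed
    qed auto
    from continuous_map_compose[OF continuous_map_compose[OF this continuous_map_tuple_set[OF K_pos]] cont]
    show ?thesis by (simp add: H_def comp_def)
  qed
  have "\<exists>U. openin V U \<and> x0 \<in> U \<and> (\<forall>x\<in>U. \<forall>v\<in>topspace ?X. \<bar>H b (x0, v) - H b (x, v)\<bar> \<le> \<epsilon>)" for b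
  proof -
    let ?W = "{z \<in> topspace (prod_topology V ?X). H b (x0, snd z) - H b z \<in> {-\<epsilon><..<\<epsilon>}}"
    have "continuous_map (prod_topology V ?X) (prod_topology V ?X) (\<lambda>z. (x0, snd z))"
      by (rule continuous_map_pairedI) (use x0 in \<open>auto simp: continuous_map_snd\<close>)
    from continuous_map_compose[OF this H]
    have "continuous_map (prod_topology V ?X) euclideanreal (\<lambda>z. H b (x0, snd z))"
      by (simp add: comp_def)
    then have "continuous_map (prod_topology V ?X) euclideanreal (\<lambda>z. H b (x0, snd z) - H b z)"
      by (intro continuous_map_diff H)
    then have W: "openin (prod_topology V ?X) ?W"
      by (rule openin_continuous_map_preimage) auto
    have "compactin ?X (topspace ?X)"
      unfolding compact_space_def[symmetric] using compact by (simp add: compact_space_product_topology)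
    note C = this
    have S: "{x0} \<times> topspace ?X \<subseteq> ?W"
    proof
      fix z assume "z \<in> {x0} \<times> topspace ?X"
      then obtain v where "z = (x0, v)" "v \<in> topspace ?X" by blast
      then show "z \<in> ?W" using x0 \<epsilon> by (simp del: topspace_product_topology)
    qed
    obtain U U' where U: "openin V U" "x0 \<in> U" "topspace ?X \<subseteq> U'" "U \<times> U' \<subseteq> ?W"
      using tube_lemma_right[OF W C x0 S] by (elim exE conjE) (rule that)
    have "\<bar>H b (x0, v) - H b (x, v)\<bar> \<le> \<epsilon>" if "x \<in> U" "v \<in> topspace ?X" for x v
    proof -
      have "(x, v) \<in> ?W" using U(3,4) that by blast
      then show ?thesis by (simp del: topspace_product_topology) linarith
    qed
    then show ?thesis using U(1,2) by blast
  qed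
  then have "\<forall>b. \<exists>U. openin V U \<and> x0 \<in> U \<and> (\<forall>x\<in>U. \<forall>v\<in>topspace ?X. \<bar>H b (x0, v) - H b (x, v)\<bar> \<le> \<epsilon>)"
    by (rule allI)
  from choice[OF this] obtain U where
    U': "\<forall>b. openin V (U b) \<and> x0 \<in> U b \<and> (\<forall>x\<in>U b. \<forall>v\<in>topspace ?X. \<bar>H b (x0, v) - H b (x, v)\<bar> \<le> \<epsilon>)" ..
  have U: "openin V (U b)" "x0 \<in> U b"
    "\<And>x v. x \<in> U b \<Longrightarrow> v \<in> topspace ?X \<Longrightarrow> \<bar>H b (x0, v) - H b (x, v)\<bar> \<le> \<epsilon>" for b
    using spec[OF U', of b] by blast+
  show ?thesis
  proof (intro exI[of _ "U True \<inter> U False"] conjI ballI)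
    show "openin V (U True \<inter> U False)" "x0 \<in> U True \<inter> U False" using U by auto
    fix y assume y: "y \<in> U True \<inter> U False"
    show "d x0 y \<le> \<epsilon>"
    proof (rule d_least)
      fix R assume R: "R \<in> Sub (topspace V) (K - 1)"
      show "\<bar>\<nu> (insert x0 R) - \<nu> (insert y R)\<bar> \<le> \<epsilon>"
      proof (cases "R = {}")
        case True
        have "tuple_set K (\<lambda>i\<in>{..<K}. x) = {x}" for x :: 'a
          using K_pos by (simp add: tuple_set_def image_constant_conv lessThan_empty_iff)
        then have "H True (x, v) = \<nu> {x}" for x v by (simp add: H_def)
        then show ?thesis
          using U(3)[of y True "\<lambda>i\<in>{..<K}. x0"] y x0 True by simp
      next
        case False
        then have "K - 1 \<ge> 1" using R by (cases "K - 1") (auto simp: Sub_def)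
        then obtain w where w: "w \<in> PiE {..<K - 1} (\<lambda>_. topspace V)" "R = tuple_set (K - 1) w"
          using tuple_set_image[of "K - 1" "topspace V"] R False by blast
        \<comment> \<open>Coordinate 0 is kept for the vertex that varies; a tuple listing
          \<open>R\<close> fills the other \<open>K - 1\<close> places.\<close>
        define v where "v = (\<lambda>i\<in>{..<K}. if i = 0 then x0 else w (i - 1))"
        have "w (i - 1) \<in> topspace V" if "i < K" "i \<noteq> 0" for i
          using that by (intro PiE_mem[OF w(1)]) auto
        then have v: "v \<in> topspace ?X"
          unfolding topspace_product_topology v_def restrict_PiE_iff using x0 by simp
        have eq: "tuple_set K (\<lambda>i\<in>{..<K}. if i = 0 then x else v i) = insert x R" for x
        proof -
          have "{..<K} = insert 0 (Suc ` {..<K - 1})"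
            using K_pos lessThan_Suc_eq_insert_0[of "K - 1"] by simp
          then have "tuple_set K (\<lambda>i\<in>{..<K}. if i = 0 then x else v i)
              = insert x ((\<lambda>i. if i = 0 then x else v i) ` Suc ` {..<K - 1})"
            by (simp only: tuple_set_def image_restrict_eq) simp
          also have "(\<lambda>i. if i = 0 then x else v i) ` Suc ` {..<K - 1} = R"
            unfolding image_image w(2) tuple_set_def by (rule image_cong) (auto simp: v_def)
          finally show ?thesis .
        qed
        have "H False (x, v) = \<nu> (insert x R)" for x
          by (simp only: H_def fst_conv snd_conv eq simp_thms)
        then show ?thesis using U(3)[of y False v] y v by simp
      qed
    qed
  qed
qed

text \<open>Vertices are exchanged one at a time. The vertex already exchanged joins
  \<open>R\<close>, so the induction needs \<open>R\<close> arbitrary; the bound on the sum of the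
  two cardinalities keeps all intermediate sets in the domain of \<nu>, even if \<open>f\<close> or
  \<open>g\<close> identifies indices.\<close>

lemma lipschitz:
  assumes "finite I" "f \<in> I \<rightarrow> topspace V" "g \<in> I \<rightarrow> topspace V" "finite R" "R \<subseteq> topspace V"
    "card I + card R \<le> K"
  shows "\<bar>\<nu> (f ` I \<union> R) - \<nu> (g ` I \<union> R)\<bar> \<le> (\<Sum>i\<in>I. d (f i) (g i))"
  using assms
proof (induction I arbitrary: R rule: finite_induct)
  case empty
  then show ?case by simp
next
  case (insert i I)
  have cf: "card (f ` I \<union> R) \<le> K - 1"
    using card_Un_le[of "f ` I" R] card_image_le[OF insert.hyps(1), of f] insert by simp
  have "f ` I \<union> R \<in> Sub (topspace V) (K - 1)"
    using cf insert.hyps(1) insert.prems by (auto simp: Sub_def)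
  then have 1: "\<bar>\<nu> (insert (f i) (f ` I \<union> R)) - \<nu> (insert (g i) (f ` I \<union> R))\<bar> \<le> d (f i) (g i)"
    using insert.prems by (intro d_upper) auto
  have "card (insert (g i) R) \<le> Suc (card R)" by (rule card_insert_le_m1) auto
  then have 2: "\<bar>\<nu> (f ` I \<union> insert (g i) R) - \<nu> (g ` I \<union> insert (g i) R)\<bar> \<le> (\<Sum>i\<in>I. d (f i) (g i))"
    using insert.prems insert.hyps by (intro insert.IH) auto
  show ?case using 1 2 insert.hyps by simp
qed

text \<open>Sequences suffice although V need not be first countable: if continuity fails at
  \<open>v\<close>, then each box of \<open>d\<close>-balls of radius \<open>1/(n+1)\<close>
  contains a violating tuple, and these tuples converge to \<open>v\<close> for \<open>d\<close>.
  The sequential form is what allows dominated convergence to be used for the averages over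
  thresholds.\<close>

lemma continuous_map_d_sequentialI:
  fixes F :: "('i \<Rightarrow> 'a) \<Rightarrow> real"
  assumes I: "finite I"
    and F: "\<And>v w. v \<in> PiE I (\<lambda>_. topspace V) \<Longrightarrow> (\<And>n. w n \<in> PiE I (\<lambda>_. topspace V)) \<Longrightarrow>
      (\<And>i. i \<in> I \<Longrightarrow> (\<lambda>n. d (v i) (w n i)) \<longlonglongrightarrow> 0) \<Longrightarrow> (\<lambda>n. F (w n)) \<longlonglongrightarrow> F v"
  shows "continuous_map (product_topology (\<lambda>_. V) I) euclideanreal F"
proof (rule continuous_map_realI, rule ccontr)
  fix v and \<epsilon> :: real
  let ?X = "product_topology (\<lambda>_::'i. V) I"
  assume v: "v \<in> topspace ?X" and \<epsilon>: "\<epsilon> > 0"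
    and neg: "\<not> (\<exists>U. openin ?X U \<and> v \<in> U \<and> (\<forall>y\<in>U. \<bar>F y - F v\<bar> \<le> \<epsilon>))"
  have "\<exists>w. w \<in> topspace ?X \<and> (\<forall>i\<in>I. d (v i) (w i) \<le> 1 / real (Suc n)) \<and> \<bar>F w - F v\<bar> > \<epsilon>" for n
  proof -
    have "\<forall>i\<in>I. \<exists>U. openin V U \<and> v i \<in> U \<and> (\<forall>y\<in>U. d (v i) y \<le> 1 / real (Suc n))"
      using v by (intro ballI d_neighbourhood) (auto simp: PiE_iff)
    from bchoice[OF this] obtain U where
      U: "\<forall>i\<in>I. openin V (U i) \<and> v i \<in> U i \<and> (\<forall>y\<in>U i. d (v i) y \<le> 1 / real (Suc n))" ..
    have "openin ?X (PiE I U)" using U by (simp add: openin_PiE[OF I])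
    moreover have "v \<in> PiE I U" using U v by (auto simp: PiE_iff)
    ultimately obtain w where w: "w \<in> PiE I U" "\<not> \<bar>F w - F v\<bar> \<le> \<epsilon>"
      using neg by blast
    have "w \<in> topspace ?X" using w(1) \<open>openin ?X (PiE I U)\<close> openin_subset by blast
    then show ?thesis using w U by (intro exI[of _ w]) (auto simp: PiE_iff not_le)
  qed
  then have "\<forall>n. \<exists>w. w \<in> topspace ?X \<and> (\<forall>i\<in>I. d (v i) (w i) \<le> 1 / real (Suc n)) \<and> \<bar>F w - F v\<bar> > \<epsilon>"
    by blast
  from choice[OF this] obtain w where
    w: "\<forall>n. w n \<in> topspace ?X \<and> (\<forall>i\<in>I. d (v i) (w n i) \<le> 1 / real (Suc n)) \<and> \<bar>F (w n) - F v\<bar> > \<epsilon>" ..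
  have "(\<lambda>n. F (w n)) \<longlonglongrightarrow> F v"
  proof (rule F)
    show "v \<in> PiE I (\<lambda>_. topspace V)" "w n \<in> PiE I (\<lambda>_. topspace V)" for n
      using v spec[OF w, of n] by simp_all
    fix i assume i: "i \<in> I"
    show "(\<lambda>n. d (v i) (w n i)) \<longlonglongrightarrow> 0"
    proof (rule Lim_null_comparison)
      have "norm (d (v i) (w n i)) \<le> 1 / real (Suc n)" for n
      proof -
        have "0 \<le> d (v i) (w n i)"
          using v i spec[OF w, of n] by (intro d_nonneg) (auto simp: PiE_iff)
        then show ?thesis using i spec[OF w, of n] by auto
      qed
      then show "\<forall>\<^sub>F n in sequentially. norm (d (v i) (w n i)) \<le> 1 / real (Suc n)" by simp
      show "(\<lambda>n. 1 / real (Suc n)) \<longlonglongrightarrow> 0" by (rule LIMSEQ_Suc[OF lim_1_over_n])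
    qed
  qed
  from LIMSEQ_D[OF this \<epsilon>] obtain n where "norm (F (w n) - F v) < \<epsilon>" by blast
  then show False using spec[OF w, of n] by simp
qed

lemma continuous_map_lipschitzI:
  fixes F :: "('i \<Rightarrow> 'a) \<Rightarrow> real"
  assumes I: "finite I"
    and F: "\<And>v w. v \<in> PiE I (\<lambda>_. topspace V) \<Longrightarrow> w \<in> PiE I (\<lambda>_. topspace V) \<Longrightarrow>
      \<bar>F w - F v\<bar> \<le> C * (\<Sum>i\<in>I. d (v i) (w i))"
  shows "continuous_map (product_topology (\<lambda>_. V) I) euclideanreal F"
proof (rule continuous_map_d_sequentialI[OF I])
  fix v w assume v: "v \<in> PiE I (\<lambda>_. topspace V)" "\<And>n. w n \<in> PiE I (\<lambda>_. topspace V)"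
    and lim: "\<And>i. i \<in> I \<Longrightarrow> (\<lambda>n. d (v i) (w n i)) \<longlonglongrightarrow> 0"
  have "(\<lambda>n. C * (\<Sum>i\<in>I. d (v i) (w n i))) \<longlonglongrightarrow> C * (\<Sum>i\<in>I. 0)"
    by (intro tendsto_mult tendsto_const tendsto_sum lim)
  then have "(\<lambda>n. C * (\<Sum>i\<in>I. d (v i) (w n i))) \<longlonglongrightarrow> 0" by simp
  then have "(\<lambda>n. F (w n) - F v) \<longlonglongrightarrow> 0"
    by (rule Lim_null_comparison[rotated]) (use F[OF v(1) v(2)] in simp)
  then show "(\<lambda>n. F (w n)) \<longlonglongrightarrow> F v" by (simp add: LIM_zero_iff)
qed

lemma continuous_map_image:
  assumes "finite I" "finite R" "R \<subseteq> topspace V" "card I + card R \<le> K"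
  shows "continuous_map (product_topology (\<lambda>_. V) I) euclideanreal (\<lambda>v. \<nu> (v ` I \<union> R))"
proof (rule continuous_map_lipschitzI[OF assms(1), where C=1])
  fix v w assume "v \<in> PiE I (\<lambda>_. topspace V)" "w \<in> PiE I (\<lambda>_. topspace V)"
  then show "\<bar>\<nu> (w ` I \<union> R) - \<nu> (v ` I \<union> R)\<bar> \<le> 1 * (\<Sum>i\<in>I. d (v i) (w i))"
    using lipschitz[of I v w R] assms by (simp add: abs_minus_commute PiE_def)
qed

end

section \<open>The measure on \<open>Sub(V,k)\<close> and its restriction to the support\<close>

context radon_space
begin

lemma Sub_measure_tuples:
  fixes A :: "'a set set"
  assumes k: "k \<ge> 1" and A: "A \<subseteq> Sub (topspace V) k"
    and m: "{v \<in> space (PiM {..<k} (\<lambda>_. \<omega>)). tuple_set k v \<in> A} \<in> sets (PiM {..<k} (\<lambda>_. \<omega>))"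
  shows "A \<in> sets (Sub_measure \<omega> k)"
    and "emeasure (Sub_measure \<omega> k) A =
      emeasure (PiM {..<k} (\<lambda>_. \<omega>)) {v \<in> space (PiM {..<k} (\<lambda>_. \<omega>)). tuple_set k v \<in> A} + indicator A {}"
proof -
  let ?M = "PiM {..<k} (\<lambda>_. \<omega>)"
  have im: "tuple_set k ` space ?M = Sub (topspace V) k - {{}}"
    using tuple_set_image[OF k] by (simp add: space_PiM)
  have "tuple_set k v \<noteq> {}" for v :: "nat \<Rightarrow> 'a"
    using k by (simp add: tuple_set_def lessThan_empty_iff)
  then have pre: "tuple_set k -` (A - {{}}) \<inter> space ?M = {v \<in> space ?M. tuple_set k v \<in> A}"
    by auto
  have P: "A - {{}} \<in> sets (pushforward ?M (tuple_set k))"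
    unfolding sets_pushforward mem_Collect_eq pre im using A m by blast
  then show S: "A \<in> sets (Sub_measure \<omega> k)"
    using A by (simp add: sets_Sub_measure[OF k])
  show "emeasure (Sub_measure \<omega> k) A =
      emeasure ?M {v \<in> space ?M. tuple_set k v \<in> A} + indicator A {}"
    unfolding emeasure_Sub_measure[OF k S] emeasure_pushforward[OF P] pre ..
qed

lemma finite_measure_Sub:
  assumes k: "k \<ge> 1"
  shows "finite_measure (Sub_measure \<omega> k)"
proof
  let ?M = "PiM {..<k} (\<lambda>_. \<omega>)"
  interpret M: finite_measure ?M by (rule finite_measure_PiM) simp
  have im: "tuple_set k ` space ?M = Sub (topspace V) k - {{}}"
    using tuple_set_image[OF k] by (simp add: space_PiM)
  then have eq: "{v \<in> space ?M. tuple_set k v \<in> Sub (topspace V) k} = space ?M"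
    by auto
  have "emeasure (Sub_measure \<omega> k) (Sub (topspace V) k) = emeasure ?M (space ?M) + indicator (Sub (topspace V) k) {}"
    using Sub_measure_tuples(2)[OF k subset_refl] unfolding eq by simp
  also have "\<dots> < \<infinity>"
    using M.finite_emeasure_space by (simp add: less_top[symmetric] indicator_def)
  finally show "emeasure (Sub_measure \<omega> k) (space (Sub_measure \<omega> k)) \<noteq> \<infinity>"
    by (simp add: space_Sub_measure[OF k])
qed

lemma sets_component:
  assumes "finite I" "j \<in> I" "U \<in> sets \<omega>"
  shows "{v \<in> space (PiM I (\<lambda>_. \<omega>)). v j \<in> U} \<in> sets (PiM I (\<lambda>_. \<omega>))"
proof -
  have "(\<lambda>v. v j) \<in> measurable (PiM I (\<lambda>_. \<omega>)) \<omega>"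
    by (rule measurable_component_singleton[OF assms(2)])
  from measurable_sets[OF this assms(3)] show ?thesis
    by (simp add: vimage_def Int_def conj_commute)
qed

lemma AE_PiM_supp:
  assumes I: "finite I" and j: "j \<in> I"
  shows "AE v in PiM I (\<lambda>_. \<omega>). v j \<in> supp"
proof (rule AE_I)
  let ?N = "PiE I (\<lambda>i. if i = j then topspace V - supp else topspace V)"
  show "{v \<in> space (PiM I (\<lambda>_. \<omega>)). v j \<notin> supp} \<subseteq> ?N"
    by (auto simp: space_PiM PiE_def Pi_iff)
  have N: "topspace V - supp \<in> sets \<omega>" using sets_supp by (metis sets.compl_sets space_eq)
  show "?N \<in> sets (PiM I (\<lambda>_. \<omega>))"
    by (rule sets_PiM_I_finite[OF I]) (use N in auto)
  have "emeasure (PiM I (\<lambda>_. \<omega>)) ?N = (\<Prod>i\<in>I. emeasure \<omega> (if i = j then topspace V - supp else topspace V))"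
    by (rule emeasure_PiM[OF I]) (use N in auto)
  also have "\<dots> = 0"
    by (rule prod_zero[OF I]) (use j null_compl_supp in auto)
  finally show "emeasure (PiM I (\<lambda>_. \<omega>)) ?N = 0" .
qed

text \<open>The atom \<open>{}\<close> lies in \<open>Sub supp 1\<close>. What is left out consists
  of singletons off the support, and these pull back to a null set of one-tuples.\<close>

lemma AE_Sub_measure_1: "AE S in Sub_measure \<omega> 1. S \<in> Sub supp 1"
proof (rule AE_I)
  let ?M = "PiM {..<1::nat} (\<lambda>_. \<omega>)"
  let ?N = "{S \<in> Sub (topspace V) 1. \<not> S \<subseteq> supp}"
  have "tuple_set 1 v = {v 0}" for v :: "nat \<Rightarrow> 'a" by (auto simp: tuple_set_def)
  then have eq: "{v \<in> space ?M. tuple_set 1 v \<in> ?N} = {v \<in> space ?M. v 0 \<in> topspace V - supp}"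
    by (auto simp: space_PiM Sub_def PiE_iff)
  have N: "topspace V - supp \<in> sets \<omega>" using sets_supp by (metis sets.compl_sets space_eq)
  have m: "{v \<in> space ?M. v 0 \<in> topspace V - supp} \<in> sets ?M"
    by (rule sets_component) (use N in auto)
  show "{S \<in> space (Sub_measure \<omega> 1). S \<notin> Sub supp 1} \<subseteq> ?N"
    by (auto simp: space_Sub_measure Sub_def)
  show "?N \<in> sets (Sub_measure \<omega> 1)"
    by (rule Sub_measure_tuples(1)) (use eq m in auto)
  have "AE v in ?M. v 0 \<in> supp" by (rule AE_PiM_supp) auto
  then have "emeasure ?M {v \<in> space ?M. v 0 \<in> topspace V - supp} = 0"
    by (subst (asm) AE_iff_measurable[OF m]) (auto simp: space_PiM)
  then show "emeasure (Sub_measure \<omega> 1) ?N = 0"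
    using Sub_measure_tuples(2)[of 1 ?N] eq m by simp
qed

end

context Sub_function
begin

text \<open>\<open>N\<close> consists of the sets covered by small disjoint neighbourhoods of the
  points of \<open>S0\<close> and meeting each of them. Disjointness assigns every vertex to one
  point of \<open>S0\<close>, and meeting all of them makes the assignment onto. The mass is
  positive because the tuples in question contain a box around support points, or, if
  \<open>S0\<close> is empty, because of the atom at \<open>{}\<close>.\<close>

lemma Sub_neighbourhood:
  assumes k: "k \<ge> 1" and S0: "S0 \<in> Sub supp k" and e: "e > 0"
  shows "\<exists>N. N \<in> sets (Sub_measure \<omega> k) \<and> measure (Sub_measure \<omega> k) N > 0 \<and>
    (\<forall>S\<in>N. S \<in> Sub (topspace V) k \<and> (\<exists>a. a ` S = S0 \<and> (\<forall>y\<in>S. d y (a y) \<le> e)))"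
proof -
  let ?M = "PiM {..<k} (\<lambda>_. \<omega>)"
  interpret SM: finite_measure "Sub_measure \<omega> k" by (rule finite_measure_Sub[OF k])
  have S0': "finite S0" "S0 \<subseteq> supp" "S0 \<subseteq> topspace V" "card S0 \<le> k"
    using S0 supp_subset by (auto simp: Sub_def)
  obtain U1 where U1: "\<And>a. a \<in> S0 \<Longrightarrow> openin V (U1 a)" "\<And>a. a \<in> S0 \<Longrightarrow> a \<in> U1 a"
    "\<And>a b. a \<in> S0 \<Longrightarrow> b \<in> S0 \<Longrightarrow> a \<noteq> b \<Longrightarrow> U1 a \<inter> U1 b = {}"
    using disjoint_neighbourhoods[OF S0'(1,3)] by blast
  have "\<forall>a\<in>S0. \<exists>U. openin V U \<and> a \<in> U \<and> (\<forall>y\<in>U. d a y \<le> e)"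
    using S0' e by (intro ballI d_neighbourhood) auto
  from bchoice[OF this] obtain U2 where
    U2: "\<forall>a\<in>S0. openin V (U2 a) \<and> a \<in> U2 a \<and> (\<forall>y\<in>U2 a. d a y \<le> e)" ..
  define U where "U a = U1 a \<inter> U2 a" for a
  have U: "openin V (U a)" "a \<in> U a" "\<And>y. y \<in> U a \<Longrightarrow> d y a \<le> e" if "a \<in> S0" for a
    using U1(1,2)[OF that] bspec[OF U2 that] by (auto simp: U_def d_commute)
  have Udisj: "a = b" if "a \<in> S0" "b \<in> S0" "y \<in> U a" "y \<in> U b" for a b y
    using U1(3)[of a b] that by (auto simp: U_def)
  define N where "N = {S \<in> Sub (topspace V) k. (\<forall>y\<in>S. \<exists>a\<in>S0. y \<in> U a) \<and> (\<forall>a\<in>S0. \<exists>y\<in>S. y \<in> U a)}"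
  let ?B = "{v \<in> space ?M. (\<forall>j\<in>{..<k}. \<exists>a\<in>S0. v j \<in> U a) \<and> (\<forall>a\<in>S0. \<exists>j\<in>{..<k}. v j \<in> U a)}"
  have pre: "{v \<in> space ?M. tuple_set k v \<in> N} = ?B"
  proof -
    have "tuple_set k v \<in> Sub (topspace V) k" if "v \<in> space ?M" for v
      using tuple_set_image[OF k, of "topspace V"] that by (auto simp: space_PiM)
    then show ?thesis by (auto simp: N_def tuple_set_def)
  qed
  have "{v \<in> space ?M. v j \<in> U a} \<in> sets ?M" if "j \<in> {..<k}" "a \<in> S0" for j a
    by (rule sets_component) (use that U(1) sets_open in auto)
  then have B: "?B \<in> sets ?M"
    by (intro sets.sets_Collect_conj sets.sets_Collect_finite_All sets.sets_Collect_finite_Ex S0'(1) finite_lessThan)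
  have NS: "N \<subseteq> Sub (topspace V) k" by (auto simp: N_def)
  note N = Sub_measure_tuples[OF k NS, unfolded pre, OF B]
  have "emeasure (Sub_measure \<omega> k) N \<noteq> 0"
  proof (cases "S0 = {}")
    case True
    then have "{} \<in> N" by (auto simp: N_def Sub_def)
    then show ?thesis by (simp add: N(2))
  next
    case False
    then obtain w where w: "w \<in> PiE {..<k} (\<lambda>_. supp)" "S0 = tuple_set k w"
      using tuple_set_image[OF k, of supp] S0 by blast
    have wS: "w j \<in> S0" "w j \<in> supp" if "j < k" for j
      using w that by (auto simp: tuple_set_def)
    have "PiE {..<k} (\<lambda>j. U (w j)) \<subseteq> ?B"
    proof
      fix v assume v: "v \<in> PiE {..<k} (\<lambda>j. U (w j))"
      have vU: "v j \<in> U (w j)" if "j < k" for j using v that by (auto simp: PiE_iff)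
      have "v j \<in> topspace V" if "j < k" for j
        using vU[OF that] U(1)[OF wS(1)[OF that]] openin_subset by blast
      then have "v \<in> space ?M" using v by (auto simp: space_PiM PiE_iff)
      moreover have "\<exists>j\<in>{..<k}. v j \<in> U a" if a: "a \<in> S0" for a
        using vU a by (auto simp: w(2) tuple_set_def)
      ultimately show "v \<in> ?B" using vU wS by auto
    qed
    then have "emeasure ?M (PiE {..<k} (\<lambda>j. U (w j))) \<le> emeasure ?M ?B"
      by (rule emeasure_mono[OF _ B])
    moreover have "emeasure ?M (PiE {..<k} (\<lambda>j. U (w j))) = (\<Prod>j<k. emeasure \<omega> (U (w j)))"
      by (rule emeasure_PiM) (use U(1) wS sets_open in auto)
    moreover have "emeasure \<omega> (U (w j)) \<noteq> 0" if "j < k" for j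
      using measure_open_pos[OF U(1,2)[OF wS(1)[OF that]] wS(2)[OF that]] by (simp add: emeasure_eq_measure)
    ultimately have "emeasure ?M ?B \<noteq> 0" by auto
    then show ?thesis by (simp add: N(2))
  qed
  then have "measure (Sub_measure \<omega> k) N > 0"
    by (simp add: SM.emeasure_eq_measure zero_less_measure_iff)
  moreover have "\<exists>a. a ` S = S0 \<and> (\<forall>y\<in>S. d y (a y) \<le> e)" if S: "S \<in> N" for S
  proof -
    have "\<forall>y\<in>S. \<exists>a. a \<in> S0 \<and> y \<in> U a" using S by (auto simp: N_def)
    from bchoice[OF this] obtain a where a: "\<forall>y\<in>S. a y \<in> S0 \<and> y \<in> U (a y)" ..
    have "b \<in> a ` S" if b: "b \<in> S0" for b
    proof -
      obtain y where "y \<in> S" "y \<in> U b" using S b by (auto simp: N_def)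
      then show ?thesis using a Udisj[of b "a y" y] b by blast
    qed
    then have "a ` S = S0" using a by blast
    then show ?thesis using a U(3) by blast
  qed
  ultimately show ?thesis using N(1) NS by blast
qed

lemma union_lipschitz:
  assumes Q: "finite Q" "Q \<subseteq> topspace V" "card Q + 2 * k \<le> K"
    and S: "S \<in> Sub (topspace V) k" "a ` S \<subseteq> topspace V" "\<And>y. y \<in> S \<Longrightarrow> d y (a y) \<le> e"
    and T: "T \<in> Sub (topspace V) k" "b ` T \<subseteq> topspace V" "\<And>y. y \<in> T \<Longrightarrow> d y (b y) \<le> e"
    and e: "e \<ge> 0"
  shows "\<bar>\<nu> (Q \<union> S \<union> T) - \<nu> (Q \<union> a ` S \<union> b ` T)\<bar> \<le> 2 * real k * e"
proof -
  have ST: "finite S" "S \<subseteq> topspace V" "card S \<le> k" "finite T" "T \<subseteq> topspace V" "card T \<le> k"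
    using S(1) T(1) by (auto simp: Sub_def)
  have sum_le: "(\<Sum>y\<in>X. d y (f y)) \<le> real k * e" if "\<And>y. y \<in> X \<Longrightarrow> d y (f y) \<le> e" "card X \<le> k" for X f
  proof -
    have "(\<Sum>y\<in>X. d y (f y)) \<le> real (card X) * e" using that(1) by (rule sum_bounded_above)
    also have "\<dots> \<le> real k * e" using that(2) e by (intro mult_right_mono) auto
    finally show ?thesis .
  qed
  have "card (Q \<union> T) \<le> card Q + k" using card_Un_le[of Q T] ST by linarith
  then have "\<bar>\<nu> (id ` S \<union> (Q \<union> T)) - \<nu> (a ` S \<union> (Q \<union> T))\<bar> \<le> (\<Sum>y\<in>S. d (id y) (a y))"
    using ST Q S by (intro lipschitz) auto
  moreover have "card (a ` S) \<le> k" using card_image_le[OF ST(1), of a] ST by linarith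
  then have "card (Q \<union> a ` S) \<le> card Q + k" using card_Un_le[of Q "a ` S"] by linarith
  then have "\<bar>\<nu> (id ` T \<union> (Q \<union> a ` S)) - \<nu> (b ` T \<union> (Q \<union> a ` S))\<bar> \<le> (\<Sum>y\<in>T. d (id y) (b y))"
    using ST Q S T by (intro lipschitz) auto
  moreover have "(\<Sum>y\<in>S. d (id y) (a y)) \<le> real k * e" "(\<Sum>y\<in>T. d (id y) (b y)) \<le> real k * e"
    using sum_le[of S a] sum_le[of T b] S(3) T(3) ST by auto
  moreover have "id ` S \<union> (Q \<union> T) = Q \<union> S \<union> T" "id ` T \<union> (Q \<union> a ` S) = a ` S \<union> (Q \<union> T)"
    "b ` T \<union> (Q \<union> a ` S) = Q \<union> a ` S \<union> b ` T" by auto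
  ultimately show ?thesis by simp
qed

text \<open>The sets are given by an indexed family that may repeat: this is essential when
  different sets of vertices are snapped to the same subset of the support.\<close>

lemma pointwise_psd:
  fixes s :: "'i \<Rightarrow> 'a set" and c :: "'i \<Rightarrow> real"
  assumes k: "k \<ge> 1" and Q: "finite Q" "Q \<subseteq> topspace V" "card Q + 2 * k \<le> K"
    and psd: "psd_kernel (Sub_measure \<omega> k) (\<lambda>S T. \<nu> (Q \<union> S \<union> T))"
    and I: "finite I" and s: "\<And>i. i \<in> I \<Longrightarrow> s i \<in> Sub supp k"
  shows "0 \<le> (\<Sum>i\<in>I. \<Sum>j\<in>I. c i * c j * \<nu> (Q \<union> s i \<union> s j))"
proof (rule psd_kernel_imp_pointwise[OF finite_measure_Sub[OF k] psd I])
  fix \<epsilon> :: real assume \<epsilon>: "\<epsilon> > 0"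
  \<comment> \<open>At most \<open>2 * k\<close> vertices move, each by at most
    \<open>e\<close>.\<close>
  define e where "e = \<epsilon> / (2 * real k)"
  have e: "e > 0" "2 * real k * e = \<epsilon>" using \<epsilon> k by (auto simp: e_def)
  have "\<forall>i\<in>I. \<exists>N. N \<in> sets (Sub_measure \<omega> k) \<and> measure (Sub_measure \<omega> k) N > 0 \<and>
    (\<forall>S\<in>N. S \<in> Sub (topspace V) k \<and> (\<exists>a. a ` S = s i \<and> (\<forall>y\<in>S. d y (a y) \<le> e)))"
    by (intro ballI Sub_neighbourhood k s e)
  from bchoice[OF this] obtain N where N: "\<forall>i\<in>I. N i \<in> sets (Sub_measure \<omega> k) \<and> measure (Sub_measure \<omega> k) (N i) > 0 \<and>
    (\<forall>S\<in>N i. S \<in> Sub (topspace V) k \<and> (\<exists>a. a ` S = s i \<and> (\<forall>y\<in>S. d y (a y) \<le> e)))" ..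
  have "\<bar>\<nu> (Q \<union> S \<union> T) - \<nu> (Q \<union> s i \<union> s j)\<bar> \<le> \<epsilon>"
    if ij: "i \<in> I" "j \<in> I" and ST: "S \<in> N i" "T \<in> N j" for i j S T
  proof -
    obtain a where a: "S \<in> Sub (topspace V) k" "a ` S = s i" "\<forall>y\<in>S. d y (a y) \<le> e"
      using N ij ST by blast
    obtain b where b: "T \<in> Sub (topspace V) k" "b ` T = s j" "\<forall>y\<in>T. d y (b y) \<le> e"
      using N ij ST by blast
    have "s i \<subseteq> topspace V" "s j \<subseteq> topspace V"
      using s[OF ij(1)] s[OF ij(2)] supp_subset by (auto simp: Sub_def)
    then show ?thesis
      using union_lipschitz[OF Q a(1) _ _ b(1), of a e b] a b e by simp
  qed
  then show "\<exists>N. \<forall>i\<in>I. N i \<in> sets (Sub_measure \<omega> k) \<and> measure (Sub_measure \<omega> k) (N i) > 0 \<and>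
      (\<forall>j\<in>I. \<forall>x\<in>N i. \<forall>y\<in>N j. \<bar>\<nu> (Q \<union> x \<union> y) - \<nu> (Q \<union> s i \<union> s j)\<bar> \<le> \<epsilon>)"
    using N by (intro exI[of _ N]) simp
qed

lemma finite_d_approximation:
  assumes e: "e > 0"
  obtains p A where "finite A" "A \<subseteq> topspace V" "p \<in> measurable \<omega> (count_space A)"
    "\<And>x. x \<in> supp \<Longrightarrow> p x \<in> supp" "\<And>x. x \<in> topspace V \<Longrightarrow> d x (p x) \<le> e"
proof (rule finite_approximation[of d e])
  fix x assume x: "x \<in> topspace V"
  obtain U where U: "openin V U" "x \<in> U" "\<forall>y\<in>U. d x y \<le> e / 2"
    using d_neighbourhood[OF x, of "e / 2"] e by auto
  have "d y z \<le> e" if "y \<in> U" "z \<in> U" for y z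
  proof -
    have yz: "y \<in> topspace V" "z \<in> topspace V" using that U(1) openin_subset by blast+
    have "d x y \<le> e / 2" "d x z \<le> e / 2" using U(3) that by auto
    then show ?thesis using d_triangle[OF yz(1) x yz(2)] by (simp add: d_commute)
  qed
  then show "\<exists>U. openin V U \<and> x \<in> U \<and> (\<forall>y\<in>U. \<forall>z\<in>U. d y z \<le> e)" using U by blast
qed (rule that)

text \<open>Positivity over the support is enough because almost every set of at most one vertex
  lies inside it. Moving vertices by a finite-valued map that preserves the support induces the
  required step map, whose values are \<open>{}\<close> and finitely many singletons.\<close>

lemma psd_kernel_Sub1I:
  assumes Q: "finite Q" "Q \<subseteq> topspace V" "card Q + 2 \<le> K"
    and psd: "\<And>A c. finite A \<Longrightarrow> A \<subseteq> Sub supp 1 \<Longrightarrow> 0 \<le> (\<Sum>S\<in>A. \<Sum>T\<in>A. c S * c T * \<nu> (Q \<union> S \<union> T))"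
  shows "psd_kernel (Sub_measure \<omega> 1) (\<lambda>S T. \<nu> (Q \<union> S \<union> T))"
proof (rule pointwise_imp_psd_kernel[where \<Omega> = "Sub supp 1"])
  show "finite_measure (Sub_measure \<omega> 1)" by (rule finite_measure_Sub) simp
  show "\<nu> (Q \<union> S \<union> T) = \<nu> (Q \<union> T \<union> S)" for S T by (simp add: Un_ac)
  show "AE S in Sub_measure \<omega> 1. S \<in> Sub supp 1" by (rule AE_Sub_measure_1)
  fix \<epsilon> :: real assume \<epsilon>: "\<epsilon> > 0"
  obtain p A where p: "finite A" "A \<subseteq> topspace V" "p \<in> measurable \<omega> (count_space A)"
    "\<And>x. x \<in> supp \<Longrightarrow> p x \<in> supp" "\<And>x. x \<in> topspace V \<Longrightarrow> d x (p x) \<le> \<epsilon> / 2"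
    using finite_d_approximation[of "\<epsilon> / 2"] \<epsilon> by (metis half_gt_zero)
  let ?M = "PiM {..<1::nat} (\<lambda>_. \<omega>)"
  let ?A = "insert {} ((\<lambda>x. {x}) ` A)"
  have pA: "p x \<in> A" if "x \<in> topspace V" for x
    using measurable_space[OF p(3)] that by simp
  have Sub1: "S = {} \<or> (\<exists>x\<in>X. S = {x})" if "S \<in> Sub X 1" for S and X :: "'a set"
    using that by (auto simp: Sub_def le_Suc_eq card_1_singleton_iff)
  have "(\<lambda>S. p ` S) \<in> measurable (Sub_measure \<omega> 1) (count_space ?A)"
    unfolding measurable_count_space_eq2[OF finite.insertI[OF finite_imageI[OF p(1)]]]
  proof (intro conjI ballI)
    show "(\<lambda>S. p ` S) \<in> space (Sub_measure \<omega> 1) \<rightarrow> ?A"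
      using Sub1[where X="topspace V"] pA by (fastforce simp: space_Sub_measure)
    fix a assume "a \<in> ?A"
    then consider "a = {}" | x where "a = {x}" "x \<in> A" by blast
    then show "(\<lambda>S. p ` S) -` {a} \<inter> space (Sub_measure \<omega> 1) \<in> sets (Sub_measure \<omega> 1)"
    proof cases
      case 1
      then have "(\<lambda>S. p ` S) -` {a} \<inter> space (Sub_measure \<omega> 1) = {{}}"
        by (auto simp: space_Sub_measure)
      moreover have "{{}} \<in> sets (Sub_measure \<omega> 1)"
        by (simp add: sets_Sub_measure)
      ultimately show ?thesis by simp
    next
      case (2 x)
      have eq: "{v \<in> space ?M. tuple_set 1 v \<in> {S \<in> Sub (topspace V) 1. p ` S = {x}}}
          = {v \<in> space ?M. v 0 \<in> p -` {x} \<inter> space \<omega>}"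
      proof (rule Collect_cong, rule conj_cong[OF refl])
        fix v assume "v \<in> space ?M"
        then have "v 0 \<in> topspace V" by (simp add: space_PiM PiE_iff)
        then show "tuple_set 1 v \<in> {S \<in> Sub (topspace V) 1. p ` S = {x}} \<longleftrightarrow> v 0 \<in> p -` {x} \<inter> space \<omega>"
          by (simp add: tuple_set_def lessThan_Suc Sub_def)
      qed
      have "p -` {x} \<inter> space \<omega> \<in> sets \<omega>"
        by (rule measurable_sets[OF p(3)]) (simp add: 2(2))
      then have "{v \<in> space ?M. v 0 \<in> p -` {x} \<inter> space \<omega>} \<in> sets ?M"
        by (intro sets_component) auto
      then have "{S \<in> Sub (topspace V) 1. p ` S = {x}} \<in> sets (Sub_measure \<omega> 1)"
        by (intro Sub_measure_tuples(1)) (auto simp only: eq)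
      moreover have "(\<lambda>S. p ` S) -` {a} \<inter> space (Sub_measure \<omega> 1) = {S \<in> Sub (topspace V) 1. p ` S = {x}}"
        using 2 by (auto simp: space_Sub_measure)
      ultimately show ?thesis by simp
    qed
  qed
  moreover have "p ` S \<in> Sub supp 1" if "S \<in> Sub supp 1" for S
    using Sub1[OF that] p(4) by (auto simp: Sub_def)
  moreover have "\<bar>\<nu> (Q \<union> S \<union> T) - \<nu> (Q \<union> p ` S \<union> p ` T)\<bar> \<le> \<epsilon>"
    if ST: "S \<in> Sub (topspace V) 1" "T \<in> Sub (topspace V) 1" for S T
  proof -
    have im: "p ` X \<subseteq> topspace V" "\<forall>y\<in>X. d y (p y) \<le> \<epsilon> / 2" if "X \<in> Sub (topspace V) 1" for X
      using that pA p(2,5) by (auto simp: Sub_def)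
    show ?thesis
      using union_lipschitz[of Q 1 S p "\<epsilon> / 2" T p] Q ST im[OF ST(1)] im[OF ST(2)] \<epsilon> by simp
  qed
  ultimately show "\<exists>p A. finite A \<and> p \<in> measurable (Sub_measure \<omega> 1) (count_space A) \<and>
      (\<forall>S\<in>space (Sub_measure \<omega> 1) \<inter> Sub supp 1. p S \<in> Sub supp 1) \<and>
      (\<forall>S\<in>space (Sub_measure \<omega> 1). \<forall>T\<in>space (Sub_measure \<omega> 1).
        \<bar>\<nu> (Q \<union> S \<union> T) - \<nu> (Q \<union> p S \<union> p T)\<bar> \<le> \<epsilon>)"
    using p(1) by (intro exI[of _ "\<lambda>S. p ` S"] exI[of _ ?A]) (simp add: space_Sub_measure)
qed (rule psd)

text \<open>The counterpart for kernels on V, applied to kernels made from averages of \<nu>, which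
  are Lipschitz for \<open>d\<close> with the total mass of a product measure as a factor.\<close>

lemma psd_kernel_vertexI:
  assumes sym: "\<And>x y. k x y = k y x"
    and lip: "\<And>x y x' y'. x \<in> topspace V \<Longrightarrow> y \<in> topspace V \<Longrightarrow> x' \<in> topspace V \<Longrightarrow> y' \<in> topspace V \<Longrightarrow>
      \<bar>k x y - k x' y'\<bar> \<le> C * (d x x' + d y y')"
    and psd: "\<And>A c. finite A \<Longrightarrow> A \<subseteq> supp \<Longrightarrow> 0 \<le> (\<Sum>x\<in>A. \<Sum>y\<in>A. c x * c y * k x y)"
  shows "psd_kernel \<omega> k"
proof (rule pointwise_imp_psd_kernel[OF finite_measure sym AE_supp _ psd])
  fix \<epsilon> :: real assume \<epsilon>: "\<epsilon> > 0"
  define e where "e = \<epsilon> / (2 * \<bar>C\<bar> + 1)"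
  have e: "e > 0" "2 * \<bar>C\<bar> * e \<le> \<epsilon>" using \<epsilon> by (auto simp: e_def field_simps)
  obtain p A where p: "finite A" "A \<subseteq> topspace V" "p \<in> measurable \<omega> (count_space A)"
    "\<And>x. x \<in> supp \<Longrightarrow> p x \<in> supp" "\<And>x. x \<in> topspace V \<Longrightarrow> d x (p x) \<le> e"
    using finite_d_approximation[OF e(1)] by metis
  have "\<bar>k x y - k (p x) (p y)\<bar> \<le> \<epsilon>" if xy: "x \<in> topspace V" "y \<in> topspace V" for x y
  proof -
    have pxy: "p x \<in> topspace V" "p y \<in> topspace V"
      using measurable_space[OF p(3)] xy p(2) by auto
    have "\<bar>k x y - k (p x) (p y)\<bar> \<le> C * (d x (p x) + d y (p y))" by (rule lip) fact+
    also have "\<dots> \<le> \<bar>C\<bar> * (d x (p x) + d y (p y))"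
      using d_nonneg[OF xy(1) pxy(1)] d_nonneg[OF xy(2) pxy(2)] by (intro mult_right_mono) auto
    also have "\<dots> \<le> \<bar>C\<bar> * (e + e)"
      by (intro mult_left_mono add_mono p xy) auto
    finally show ?thesis using e(2) by (simp add: mult.commute mult.left_commute)
  qed
  then show "\<exists>p A. finite A \<and> p \<in> measurable \<omega> (count_space A) \<and>
      (\<forall>x\<in>space \<omega> \<inter> supp. p x \<in> supp) \<and>
      (\<forall>x\<in>space \<omega>. \<forall>y\<in>space \<omega>. \<bar>k x y - k (p x) (p y)\<bar> \<le> \<epsilon>)"
    using p by (intro exI[of _ p] exI[of _ A]) simp
qed

end

section \<open>Permuting coordinates of product measures, and integrability of functions of two
  coordinates\<close>

context radon_space
begin

lemma distr_PiM_permutes: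
  assumes I: "finite I" and \<pi>: "\<pi> permutes I"
  shows "distr (PiM I (\<lambda>_. \<omega>)) (PiM I (\<lambda>_. \<omega>)) (\<lambda>w. \<lambda>i\<in>I. w (\<pi> i)) = PiM I (\<lambda>_. \<omega>)"
    and "(\<lambda>w. \<lambda>i\<in>I. w (\<pi> i)) \<in> measurable (PiM I (\<lambda>_. \<omega>)) (PiM I (\<lambda>_. \<omega>))"
proof -
  let ?M = "PiM I (\<lambda>_. \<omega>)" and ?f = "\<lambda>w. \<lambda>i\<in>I. w (\<pi> i)"
  have \<pi>I: "\<pi> i \<in> I" if "i \<in> I" for i using permutes_in_image[OF \<pi>] that by simp
  show f: "?f \<in> measurable ?M ?M"
    by (rule measurable_restrict, rule measurable_component_singleton, rule \<pi>I)
  show "distr ?M ?M ?f = ?M"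
  proof (rule PiM_eqI[OF I])
    show "sets (distr ?M ?M ?f) = sets ?M" by simp
    fix A :: "_ \<Rightarrow> 'a set" assume A: "\<And>i. i \<in> I \<Longrightarrow> A i \<in> sets \<omega>"
    have AI: "A (inv \<pi> i) \<in> sets \<omega>" if "i \<in> I" for i
      using A permutes_in_image[OF permutes_inv[OF \<pi>]] that by simp
    have Asub: "A i \<subseteq> topspace V" if "i \<in> I" for i
      using sets.sets_into_space[OF A[OF that]] by simp
    have "?f -` PiE I A \<inter> space ?M = PiE I (\<lambda>i. A (inv \<pi> i))"
    proof (intro equalityI subsetI)
      fix w assume "w \<in> ?f -` PiE I A \<inter> space ?M"
      then have w: "\<And>i. i \<in> I \<Longrightarrow> w (\<pi> i) \<in> A i" "w \<in> extensional I"
        by (auto simp: PiE_iff space_PiM)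
      have "w i \<in> A (inv \<pi> i)" if "i \<in> I" for i
      proof -
        have "inv \<pi> i \<in> I" using permutes_in_image[OF permutes_inv[OF \<pi>]] that by simp
        from w(1)[OF this] show ?thesis by (simp add: permutes_inverses(1)[OF \<pi>])
      qed
      then show "w \<in> PiE I (\<lambda>i. A (inv \<pi> i))" using w(2) by (simp add: PiE_iff)
    next
      fix w assume w: "w \<in> PiE I (\<lambda>i. A (inv \<pi> i))"
      have "w (\<pi> i) \<in> A i" if "i \<in> I" for i
        using PiE_mem[OF w \<pi>I[OF that]] by (simp add: permutes_inverses(2)[OF \<pi>])
      moreover have "w i \<in> topspace V" if "i \<in> I" for i
        using PiE_mem[OF w that] Asub permutes_in_image[OF permutes_inv[OF \<pi>]] that by blast
      ultimately show "w \<in> ?f -` PiE I A \<inter> space ?M"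
        using w by (simp add: PiE_iff space_PiM)
    qed
    then have "emeasure (distr ?M ?M ?f) (PiE I A) = emeasure ?M (PiE I (\<lambda>i. A (inv \<pi> i)))"
      using f sets_PiM_I_finite[OF I, of A "\<lambda>_. \<omega>"] A by (simp add: emeasure_distr)
    also have "\<dots> = (\<Prod>i\<in>I. emeasure \<omega> (A (inv \<pi> i)))"
      by (rule emeasure_PiM[OF I]) (rule AI)
    also have "\<dots> = (\<Prod>i\<in>I. emeasure \<omega> (A i))"
      using prod.permute[OF permutes_inv[OF \<pi>], of "\<lambda>i. emeasure \<omega> (A i)"] by (simp add: comp_def)
    finally show "emeasure (distr ?M ?M ?f) (PiE I A) = (\<Prod>i\<in>I. emeasure \<omega> (A i))" .
  qed
qed

lemma PiM_permutes:
  fixes h :: "('i \<Rightarrow> 'a) \<Rightarrow> real"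
  assumes I: "finite I" and \<pi>: "\<pi> permutes I" and h: "h \<in> borel_measurable (PiM I (\<lambda>_. \<omega>))"
  shows "(\<integral>w. h (\<lambda>i\<in>I. w (\<pi> i)) \<partial>PiM I (\<lambda>_. \<omega>)) = (\<integral>w. h w \<partial>PiM I (\<lambda>_. \<omega>))"
    and "integrable (PiM I (\<lambda>_. \<omega>)) (\<lambda>w. h (\<lambda>i\<in>I. w (\<pi> i))) \<longleftrightarrow> integrable (PiM I (\<lambda>_. \<omega>)) h"
  unfolding integral_distr[OF distr_PiM_permutes(2)[OF I \<pi>] h, symmetric]
    integrable_distr_eq[OF distr_PiM_permutes(2)[OF I \<pi>] h, symmetric]
  unfolding distr_PiM_permutes(1)[OF I \<pi>] by (rule refl)+

lemma integrable_PiM_pair: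
  fixes Z :: "'a \<Rightarrow> 'a \<Rightarrow> real"
  assumes Z: "integrable (\<omega> \<Otimes>\<^sub>M \<omega>) (\<lambda>(x, y). Z x y)"
  shows "integrable (PiM {..<n + 2} (\<lambda>_. \<omega>)) (\<lambda>w. Z (w n) (w (Suc n)))"
proof -
  let ?P = "\<lambda>I::nat set. PiM I (\<lambda>_. \<omega>)"
  interpret P: pair_sigma_finite \<omega> \<omega> ..
  interpret Pn: finite_measure "?P {..<n}" by (rule finite_measure_PiM) simp
  note Zm [measurable] = borel_measurable_integrable[OF Z]
  have I: "{..<n + 2} = insert (Suc n) {..<Suc n}" by auto
  have m: "(\<lambda>w. Z (w n) (w (Suc n))) \<in> borel_measurable (?P {..<n + 2})"
  proof -
    have "(\<lambda>w. (w n, w (Suc n))) \<in> measurable (?P {..<n + 2}) (\<omega> \<Otimes>\<^sub>M \<omega>)"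
      by (intro measurable_Pair measurable_component_singleton) auto
    from measurable_compose[OF this Zm] show ?thesis by simp
  qed
  have m2: "(\<lambda>x. \<integral>\<^sup>+y. ennreal \<bar>Z x y\<bar> \<partial>\<omega>) \<in> borel_measurable \<omega>"
    by measurable
  have "(\<lambda>v. v n) \<in> measurable (?P (insert n {..<n})) \<omega>"
    by (rule measurable_component_singleton) simp
  from measurable_compose[OF this m2]
  have m2': "(\<lambda>v. \<integral>\<^sup>+y. ennreal \<bar>Z (v n) y\<bar> \<partial>\<omega>) \<in> borel_measurable (?P (insert n {..<n}))" .
  have "(\<integral>\<^sup>+w. ennreal \<bar>Z (w n) (w (Suc n))\<bar> \<partial>?P {..<n + 2})
      = (\<integral>\<^sup>+v. \<integral>\<^sup>+y. ennreal \<bar>Z ((v(Suc n := y)) n) ((v(Suc n := y)) (Suc n))\<bar> \<partial>\<omega> \<partial>?P {..<Suc n})"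
    unfolding I by (rule product_nn_integral_insert) (use m I in auto)
  also have "\<dots> = (\<integral>\<^sup>+v. \<integral>\<^sup>+y. ennreal \<bar>Z (v n) y\<bar> \<partial>\<omega> \<partial>?P (insert n {..<n}))"
    by (simp add: lessThan_Suc)
  also have "\<dots> = (\<integral>\<^sup>+u. \<integral>\<^sup>+x. \<integral>\<^sup>+y. ennreal \<bar>Z ((u(n := x)) n) y\<bar> \<partial>\<omega> \<partial>\<omega> \<partial>?P {..<n})"
    by (rule product_nn_integral_insert[OF _ _ m2']) auto
  also have "\<dots> = (\<integral>\<^sup>+x. \<integral>\<^sup>+y. ennreal \<bar>Z x y\<bar> \<partial>\<omega> \<partial>\<omega>) * emeasure (?P {..<n}) (space (?P {..<n}))"
    by simp
  also have "(\<integral>\<^sup>+x. \<integral>\<^sup>+y. ennreal \<bar>Z x y\<bar> \<partial>\<omega> \<partial>\<omega>) = (\<integral>\<^sup>+z. ennreal \<bar>case_prod Z z\<bar> \<partial>(\<omega> \<Otimes>\<^sub>M \<omega>))"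
    using nn_integral_fst[of "\<lambda>z. ennreal \<bar>case_prod Z z\<bar>" \<omega>] by simp
  also have "\<dots> * emeasure (?P {..<n}) (space (?P {..<n})) < \<infinity>"
    using Z Pn.finite_emeasure_space
    by (auto simp: integrable_iff_bounded ennreal_mult_eq_top_iff less_top[symmetric] case_prod_beta')
  finally show ?thesis using m by (simp add: integrable_iff_bounded)
qed

end

lemma L2_integrable:
  assumes "finite_measure M" "f \<in> L2 M"
  shows "integrable M f"
  using assms(2) unfolding L2_def by (auto intro: finite_measure.square_integrable_imp_integrable[OF assms(1)])

lemma L2_sym_integrable:
  assumes "finite_measure M" "K \<in> L2_sym M"
  shows "integrable (M \<Otimes>\<^sub>M M) (\<lambda>(x, y). K x y)"
  by (rule L2_integrable[OF finite_measure_pair_measure[OF assms(1,1)]]) (use assms(2) in \<open>simp add: L2_sym_def\<close>)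

lemma psd_kernel_integral_nonneg:
  assumes M: "finite_measure M" and K: "psd_kernel M K"
  shows "0 \<le> (\<integral>x. \<integral>y. K x y \<partial>M \<partial>M)" and "0 \<le> kernel_inner M K (\<lambda>_ _. 1)"
proof -
  interpret finite_measure M by fact
  interpret P: pair_sigma_finite M M ..
  have "(\<lambda>_. 1) \<in> L2 M" by (simp add: L2_def)
  then have "0 \<le> (\<integral>x. kernel_op M K (\<lambda>_. 1) x * 1 \<partial>M)"
    using K unfolding psd_kernel_def by blast
  then show *: "0 \<le> (\<integral>x. \<integral>y. K x y \<partial>M \<partial>M)" by (simp add: kernel_op_def)
  have "integrable (M \<Otimes>\<^sub>M M) (\<lambda>(x, y). K x y)"
    using K L2_sym_integrable[OF M] by (auto simp: psd_kernel_def)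
  from P.integral_fst'[OF this] * show "0 \<le> kernel_inner M K (\<lambda>_ _. 1)"
    by (simp add: kernel_inner_def)
qed

text \<open>Serves the case where \<nu> has a value at most 0, so that no kernel of trace 1 is built
  from it.\<close>

lemma gamma_nonneg:
  assumes "finite_measure \<omega>"
  shows "0 \<le> gamma V E \<omega> r"
proof (cases "\<exists>A. gamma_feasible V E \<omega> r A")
  case True
  then obtain A where A: "gamma_feasible V E \<omega> r A" by blast
  then have "psd_kernel \<omega> A" by (simp add: gamma_feasible_def)
  then have "0 \<le> kernel_inner \<omega> A (\<lambda>_ _. 1)" by (rule psd_kernel_integral_nonneg(2)[OF assms])
  then have "0 \<le> ereal (kernel_inner \<omega> A (\<lambda>_ _. 1))" by simp
  also have "\<dots> \<le> gamma V E \<omega> r"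
    unfolding gamma_def using A by (auto intro!: Sup_upper)
  finally show ?thesis .
qed (simp add: gamma_def)

section \<open>Averages of \<nu> over tuples of vertices\<close>

context Sub_function
begin

text \<open>The integral is not divided by the total mass of \<omega>. Coordinates of the tuple may
  coincide with each other or with points of \<open>S\<close>, in which case the union is
  smaller.\<close>

definition avg :: "nat \<Rightarrow> 'a set \<Rightarrow> real" where
  "avg n S = (\<integral>v. \<nu> (v ` {..<n} \<union> S) \<partial>PiM {..<n} (\<lambda>_. \<omega>))"

lemma measurable_image:
  assumes "finite I" "finite R" "R \<subseteq> topspace V" "card I + card R \<le> K"
  shows "(\<lambda>v. \<nu> (v ` I \<union> R)) \<in> borel_measurable (PiM I (\<lambda>_. \<omega>))"
  by (intro continuous_measurable_PiM continuous_map_image assms)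

lemma image_in_Sub:
  assumes "v \<in> space (PiM I (\<lambda>_. \<omega>))" "finite I" "finite R" "R \<subseteq> topspace V" "card I + card R \<le> n"
  shows "v ` I \<union> R \<in> Sub (topspace V) n"
proof -
  have "card (v ` I \<union> R) \<le> n"
    using card_Un_le[of "v ` I" R] card_image_le[OF assms(2), of v] assms(5) by linarith
  then show ?thesis using assms by (auto simp: Sub_def space_PiM PiE_iff)
qed

lemma integrable_image:
  assumes "finite I" "finite R" "R \<subseteq> topspace V" "card I + card R \<le> K"
  shows "integrable (PiM I (\<lambda>_. \<omega>)) (\<lambda>v. \<nu> (v ` I \<union> R))"
proof -
  interpret P: finite_measure "PiM I (\<lambda>_. \<omega>)" by (rule finite_measure_PiM[OF assms(1)])
  obtain B where B: "\<forall>S\<in>Sub (topspace V) K. \<bar>\<nu> S\<bar> \<le> B" using bounded_fun by blast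
  show ?thesis
  proof (rule P.integrable_const_bound[OF _ measurable_image[OF assms]])
    show "AE v in PiM I (\<lambda>_. \<omega>). norm (\<nu> (v ` I \<union> R)) \<le> B"
      using B image_in_Sub[OF _ assms] by (intro AE_I2) (simp only: real_norm_def)
  qed
qed

lemma avg_Suc:
  assumes S: "finite S" "S \<subseteq> topspace V" "Suc n + card S \<le> K"
  shows "avg (Suc n) S = (\<integral>x. avg n (insert x S) \<partial>\<omega>)"
proof -
  let ?M = "PiM {..<n} (\<lambda>_. \<omega>)"
  interpret Pn: finite_measure ?M by (rule finite_measure_PiM) simp
  interpret PP: pair_sigma_finite ?M \<omega> ..
  interpret PF: finite_measure "?M \<Otimes>\<^sub>M \<omega>"
    by (rule finite_measure_pair_measure[OF finite_measure Pn.finite_measure_axioms])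
  obtain B where B: "\<forall>S\<in>Sub (topspace V) K. \<bar>\<nu> S\<bar> \<le> B" using bounded_fun by blast
  have im: "(v(n := x)) ` insert n {..<n} \<union> S = v ` {..<n} \<union> insert x S" for v x
    by auto
  have int: "integrable (PiM (insert n {..<n}) (\<lambda>_. \<omega>)) (\<lambda>v. \<nu> (v ` insert n {..<n} \<union> S))"
    by (rule integrable_image) (use S in auto)
  have m: "(\<lambda>(v, x). \<nu> (v ` {..<n} \<union> insert x S)) \<in> borel_measurable (?M \<Otimes>\<^sub>M \<omega>)"
    using measurable_compose[OF measurable_add_dim borel_measurable_integrable[OF int]]
    by (simp only: case_prod_beta' im)
  have "integrable (?M \<Otimes>\<^sub>M \<omega>) (\<lambda>(v, x). \<nu> (v ` {..<n} \<union> insert x S))"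
  proof (rule PF.integrable_const_bound[OF _ m])
    show "AE z in ?M \<Otimes>\<^sub>M \<omega>. norm ((\<lambda>(v, x). \<nu> (v ` {..<n} \<union> insert x S)) z) \<le> B"
    proof (rule AE_I2)
      fix z assume "z \<in> space (?M \<Otimes>\<^sub>M \<omega>)"
      then obtain v x where z: "z = (v, x)" "v \<in> space ?M" "x \<in> topspace V"
        by (auto simp: space_pair_measure)
      have "card (insert x S) \<le> Suc (card S)" by (rule card_insert_le_m1) auto
      then have "v ` {..<n} \<union> insert x S \<in> Sub (topspace V) K"
        by (intro image_in_Sub) (use z S in auto)
      then show "norm ((\<lambda>(v, x). \<nu> (v ` {..<n} \<union> insert x S)) z) \<le> B" using B z by simp
    qed
  qed
  from PP.Fubini_integral[OF this]
  have "(\<integral>x. avg n (insert x S) \<partial>\<omega>) = (\<integral>v. \<integral>x. \<nu> (v ` {..<n} \<union> insert x S) \<partial>\<omega> \<partial>?M)"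
    by (simp add: avg_def)
  also have "\<dots> = avg (Suc n) S"
    unfolding avg_def lessThan_Suc
    by (subst product_integral_insert[OF _ _ int]) (simp_all only: im finite_lessThan lessThan_iff less_irrefl not_False_eq_True)
  finally show ?thesis by simp
qed

lemma avg_lipschitz:
  assumes S: "finite S" "S \<subseteq> topspace V" "Suc n + card S \<le> K" and xy: "x \<in> topspace V" "y \<in> topspace V"
  shows "\<bar>avg n (insert x S) - avg n (insert y S)\<bar> \<le> measure (PiM {..<n} (\<lambda>_. \<omega>)) (space (PiM {..<n} (\<lambda>_. \<omega>))) * d x y"
proof -
  let ?M = "PiM {..<n} (\<lambda>_. \<omega>)"
  interpret Pn: finite_measure ?M by (rule finite_measure_PiM) simp
  have c: "card (insert z S) \<le> Suc (card S)" for z by (rule card_insert_le_m1) auto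
  have int: "integrable ?M (\<lambda>v. \<nu> (v ` {..<n} \<union> insert z S))" if "z \<in> topspace V" for z
    using S that c[of z] by (intro integrable_image) auto
  have b: "\<bar>\<nu> (v ` {..<n} \<union> insert x S) - \<nu> (v ` {..<n} \<union> insert y S)\<bar> \<le> d x y" if v: "v \<in> space ?M" for v
  proof -
    have "v ` {..<n} \<union> S \<in> Sub (topspace V) (K - 1)"
      by (rule image_in_Sub[OF v]) (use S in auto)
    from d_upper[OF xy this] show ?thesis by simp
  qed
  have "\<bar>avg n (insert x S) - avg n (insert y S)\<bar>
      = \<bar>\<integral>v. \<nu> (v ` {..<n} \<union> insert x S) - \<nu> (v ` {..<n} \<union> insert y S) \<partial>?M\<bar>"
    unfolding avg_def by (simp only: Bochner_Integration.integral_diff[OF int[OF xy(1)] int[OF xy(2)]])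
  also have "\<dots> \<le> (\<integral>v. \<bar>\<nu> (v ` {..<n} \<union> insert x S) - \<nu> (v ` {..<n} \<union> insert y S)\<bar> \<partial>?M)"
    by (rule integral_abs_bound)
  also have "\<dots> \<le> (\<integral>v. d x y \<partial>?M)"
    by (rule integral_mono[OF integrable_abs[OF Bochner_Integration.integrable_diff[OF int[OF xy(1)] int[OF xy(2)]]]])
      (use b in auto)
  also have "\<dots> = measure ?M (space ?M) * d x y" by simp
  finally show ?thesis .
qed

end

section \<open>The bound by the completely positive hierarchy\<close>

text \<open>The cone places its kernel at the first two coordinates, while Fubini splits off the
  last two. This permutation mediates between the conventions.\<close>

lemma exists_permutation_pair:
  "\<exists>\<pi>. \<pi> permutes {..<r + 2} \<and> \<pi> 0 = r \<and> \<pi> 1 = Suc r"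
proof (intro exI conjI)
  \<comment> \<open>The order of composition matters for \<open>r = 1\<close>, where the two
    transpositions share the index 1.\<close>
  let ?\<pi> = "Transposition.transpose 0 r \<circ> Transposition.transpose 1 (Suc r)"
  show "?\<pi> permutes {..<r + 2}"
    by (intro permutes_compose permutes_swap_id) auto
  show "?\<pi> 0 = r" "?\<pi> 1 = Suc r"
    by (auto simp: Transposition.transpose_def)
qed

context Sub_function
begin

lemma avg_0: "avg 0 S = \<nu> S"
proof -
  have "emeasure (PiM {..<0::nat} (\<lambda>_. \<omega>)) (space (PiM {..<0} (\<lambda>_. \<omega>))) = 1"
    by (simp add: PiM_empty space_PiM)
  then show ?thesis by (simp add: avg_def measure_def)
qed

lemma integrable_avg:
  assumes S: "finite S" "S \<subseteq> topspace V" "Suc n + card S \<le> K"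
  shows "integrable \<omega> (\<lambda>x. avg n (insert x S))"
proof -
  define L where "L = measure (PiM {..<n} (\<lambda>_. \<omega>)) (space (PiM {..<n} (\<lambda>_. \<omega>)))"
  \<comment> \<open>Viewing V as a product over the one-element index set makes the continuity and
    measurability criteria for products available.\<close>
  have "continuous_map (product_topology (\<lambda>_. V) {()}) euclideanreal (\<lambda>v. avg n (insert (v ()) S))"
  proof (rule continuous_map_lipschitzI[where C=L])
    fix v w assume "v \<in> PiE {()} (\<lambda>_. topspace V)" "w \<in> PiE {()} (\<lambda>_. topspace V)"
    then show "\<bar>avg n (insert (w ()) S) - avg n (insert (v ()) S)\<bar> \<le> L * (\<Sum>i\<in>{()}. d (v i) (w i))"
      using avg_lipschitz[OF S, of "v ()" "w ()"] by (simp add: L_def abs_minus_commute PiE_iff)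
  qed simp
  then have m: "(\<lambda>v. avg n (insert (v ()) S)) \<in> borel_measurable (PiM {()} (\<lambda>_. \<omega>))"
    by (intro continuous_measurable_PiM) auto
  have "(\<lambda>x. \<lambda>i\<in>{()}. x) \<in> measurable \<omega> (PiM {()} (\<lambda>_. \<omega>))"
    by (rule measurable_restrict) simp
  from measurable_compose[OF this m] have "(\<lambda>x. avg n (insert x S)) \<in> borel_measurable \<omega>" by simp
  moreover obtain B where B: "\<forall>S\<in>Sub (topspace V) K. \<bar>\<nu> S\<bar> \<le> B" using bounded_fun by blast
  have "\<bar>avg n (insert x S)\<bar> \<le> B * L" if x: "x \<in> topspace V" for x
  proof -
    interpret Pn: finite_measure "PiM {..<n} (\<lambda>_. \<omega>)" by (rule finite_measure_PiM) simp
    have c: "card (insert x S) \<le> Suc (card S)" by (rule card_insert_le_m1) auto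
    have int: "integrable (PiM {..<n} (\<lambda>_. \<omega>)) (\<lambda>v. \<nu> (v ` {..<n} \<union> insert x S))"
      using S x c by (intro integrable_image) auto
    have "\<bar>avg n (insert x S)\<bar> \<le> (\<integral>v. \<bar>\<nu> (v ` {..<n} \<union> insert x S)\<bar> \<partial>PiM {..<n} (\<lambda>_. \<omega>))"
      unfolding avg_def by (rule integral_abs_bound)
    also have "\<dots> \<le> (\<integral>v. B \<partial>PiM {..<n} (\<lambda>_. \<omega>))"
    proof (rule integral_mono[OF integrable_abs[OF int]])
      fix v assume "v \<in> space (PiM {..<n} (\<lambda>_. \<omega>))"
      then have "v ` {..<n} \<union> insert x S \<in> Sub (topspace V) (K)"
        by (rule image_in_Sub) (use S x c in auto)
      then show "\<bar>\<nu> (v ` {..<n} \<union> insert x S)\<bar> \<le> B" using B by blast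
    qed simp
    finally show ?thesis by (simp add: L_def mult.commute)
  qed
  then have "AE x in \<omega>. norm (avg n (insert x S)) \<le> B * L" by (intro AE_I2) simp
  ultimately show ?thesis by (intro integrable_const_bound)
qed

lemma avg_pair_lipschitz:
  assumes n: "n + 2 \<le> K" and V: "x \<in> topspace V" "x' \<in> topspace V" "y \<in> topspace V" "y' \<in> topspace V"
  shows "\<bar>avg n {x, y} - avg n {x', y'}\<bar>
    \<le> measure (PiM {..<n} (\<lambda>_. \<omega>)) (space (PiM {..<n} (\<lambda>_. \<omega>))) * (d x x' + d y y')"
  using avg_lipschitz[of "{y}" n x x'] avg_lipschitz[of "{x'}" n y y'] n V
  by (simp add: insert_commute distrib_left)

end

section \<open>Moments of a function feasible for the k-point bound\<close>

locale Delta_function = radon_space V \<omega> for V :: "'a topology" and \<omega> :: "'a measure" +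
  fixes E :: "('a \<times> 'a) set" and r :: nat and \<nu> :: "'a set \<Rightarrow> real"
  assumes graph: "topological_graph V E" and feasible: "Delta_feasible V E \<omega> (r + 3) \<nu>"
begin

sublocale Sub_function V \<omega> "r + 3" \<nu>
  by unfold_locales (use feasible in \<open>auto simp: Delta_feasible_def\<close>)

lemma fun_empty: "\<nu> {} = 1"
  and fun_dependent: "S \<in> Sub (topspace V) (r + 3) \<Longrightarrow> \<not> independent_set E S \<Longrightarrow> \<nu> S = 0"
  using feasible by (auto simp: Delta_feasible_def)

text \<open>For dependent \<open>Q\<close> all entries of the matrix vanish. Positivity therefore
  holds for every \<open>Q\<close> of admissible size, and one may integrate over \<open>Q\<close>
  without distinguishing independent sets.\<close>

lemma psd_points:
  fixes s :: "'i \<Rightarrow> 'a set" and c :: "'i \<Rightarrow> real"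
  assumes Q: "Q \<in> Sub (topspace V) (r + 1)"
    and I: "finite I" and s: "\<And>i. i \<in> I \<Longrightarrow> s i \<in> Sub supp 1"
  shows "0 \<le> (\<Sum>i\<in>I. \<Sum>j\<in>I. c i * c j * \<nu> (Q \<union> (s i \<union> s j)))"
proof (cases "independent_set E Q")
  case True
  then have "psd_kernel (Sub_measure \<omega> 1) (\<lambda>S T. \<nu> (Q \<union> S \<union> T))"
    using feasible Q by (auto simp: Delta_feasible_def)
  from pointwise_psd[OF _ _ _ _ this I s, where c=c] Q show ?thesis
    by (simp add: Sub_def Un_assoc)
next
  case False
  have "\<nu> (Q \<union> (s i \<union> s j)) = 0" if "i \<in> I" "j \<in> I" for i j
  proof (rule fun_dependent)
    have "card (Q \<union> (s i \<union> s j)) \<le> card Q + (card (s i) + card (s j))"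
      using card_Un_le[of Q "s i \<union> s j"] card_Un_le[of "s i" "s j"] by linarith
    then show "Q \<union> (s i \<union> s j) \<in> Sub (topspace V) (r + 3)"
      using Q s[OF that(1)] s[OF that(2)] supp_subset by (auto simp: Sub_def)
    show "\<not> independent_set E (Q \<union> (s i \<union> s j))"
      using False unfolding independent_set_def by blast
  qed
  then show ?thesis by (simp cong: sum.cong)
qed

lemma psd_avg:
  fixes s :: "'i \<Rightarrow> 'a set" and c :: "'i \<Rightarrow> real"
  assumes n: "n \<le> r + 1" and I: "finite I" and s: "\<And>i. i \<in> I \<Longrightarrow> s i \<in> Sub supp 1"
  shows "0 \<le> (\<Sum>i\<in>I. \<Sum>j\<in>I. c i * c j * avg n (s i \<union> s j))"
proof -
  let ?M = "PiM {..<n} (\<lambda>_. \<omega>)"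
  have int: "integrable ?M (\<lambda>v. \<nu> (v ` {..<n} \<union> (s i \<union> s j)))" if "i \<in> I" "j \<in> I" for i j
  proof (rule integrable_image)
    show "card {..<n} + card (s i \<union> s j) \<le> r + 3"
      using card_Un_le[of "s i" "s j"] s[OF that(1)] s[OF that(2)] n by (simp add: Sub_def)
  qed (use s[OF that(1)] s[OF that(2)] supp_subset in \<open>auto simp: Sub_def\<close>)
  have "0 \<le> (\<integral>v. (\<Sum>i\<in>I. \<Sum>j\<in>I. c i * c j * \<nu> (v ` {..<n} \<union> (s i \<union> s j))) \<partial>?M)"
  proof (rule integral_nonneg_AE, rule AE_I2)
    fix v assume v: "v \<in> space ?M"
    have "v ` {..<n} \<union> {} \<in> Sub (topspace V) (r + 1)"
      by (rule image_in_Sub[OF v]) (use n in auto)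
    then show "0 \<le> (\<Sum>i\<in>I. \<Sum>j\<in>I. c i * c j * \<nu> (v ` {..<n} \<union> (s i \<union> s j)))"
      using psd_points[OF _ I s] by simp
  qed
  also have "\<dots> = (\<Sum>i\<in>I. \<integral>v. (\<Sum>j\<in>I. c i * c j * \<nu> (v ` {..<n} \<union> (s i \<union> s j))) \<partial>?M)"
    by (intro Bochner_Integration.integral_sum Bochner_Integration.integrable_sum integrable_mult_right int)
  also have "\<dots> = (\<Sum>i\<in>I. \<Sum>j\<in>I. \<integral>v. c i * c j * \<nu> (v ` {..<n} \<union> (s i \<union> s j)) \<partial>?M)"
    by (intro sum.cong refl Bochner_Integration.integral_sum integrable_mult_right int)
  also have "\<dots> = (\<Sum>i\<in>I. \<Sum>j\<in>I. c i * c j * avg n (s i \<union> s j))"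
    by (simp add: avg_def)
  finally show ?thesis .
qed

text \<open>A \<open>1 \<times> 1\<close> matrix suffices: the first \<open>r + 1\<close>
  coordinates form \<open>Q\<close> and the last one is the only test set. It must lie in the
  support, whence the statement holds almost everywhere.\<close>

lemma AE_nonneg: "AE v in PiM {..<r + 2} (\<lambda>_. \<omega>). 0 \<le> \<nu> (v ` {..<r + 2})"
proof -
  let ?M = "PiM {..<r + 2} (\<lambda>_. \<omega>)"
  have "AE v in ?M. v (Suc r) \<in> supp" by (rule AE_PiM_supp) auto
  then show ?thesis
    using AE_space
  proof eventually_elim
    fix v assume v: "v (Suc r) \<in> supp" "v \<in> space ?M"
    have "card (v ` {..<Suc r}) \<le> Suc r" using card_image_le[of "{..<Suc r}" v] by simp
    then have "v ` {..<Suc r} \<in> Sub (topspace V) (r + 1)"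
      using v(2) by (auto simp: Sub_def space_PiM PiE_iff)
    from psd_points[OF this, of "{()}" "\<lambda>_. {v (Suc r)}" "\<lambda>_. 1"] v(1)
    have "0 \<le> \<nu> (insert (v (Suc r)) (v ` {..<Suc r}))" by (simp add: Sub_def)
    moreover have "insert (v (Suc r)) (v ` {..<Suc r}) = v ` {..<r + 2}"
      by (simp add: lessThan_Suc)
    ultimately show "0 \<le> \<nu> (v ` {..<r + 2})" by simp
  qed
qed

abbreviation mass :: "nat \<Rightarrow> real" where
  "mass n \<equiv> avg n {}"

lemma mass_0: "mass 0 = 1"
  by (simp add: avg_0 fun_empty)

lemma mass_1: "mass (Suc 0) = (\<integral>x. \<nu> {x} \<partial>\<omega>)"
  by (simp add: avg_Suc avg_0)

text \<open>Testing \<open>t \<cdot> \<emptyset> + 1\<close> against the averaged moment matrix gives a nonnegative quadratic in \<open>t\<close>,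
  and its discriminant inequality is log-convexity of \<open>mass\<close>.\<close>

lemma mass_quadratic:
  assumes n: "n \<le> r + 1"
  shows "0 \<le> (t * measure \<omega> (space \<omega>))\<^sup>2 * mass n + 2 * (t * measure \<omega> (space \<omega>)) * mass (Suc n) + mass (Suc (Suc n))"
proof -
  define W where "W = measure \<omega> (space \<omega>)"
  define L where "L = measure (PiM {..<n} (\<lambda>_. \<omega>)) (space (PiM {..<n} (\<lambda>_. \<omega>)))"
  have L: "L \<ge> 0" by (simp add: L_def)
  \<comment> \<open>The form of \<open>k\<close> at a function f is that of the averaged moment
    matrix at the vector with entry t times the integral of f at \<open>{}\<close> and entries f on
    singletons. For f = 1 this produces the powers of \<open>t * W\<close>.\<close>
  define k where "k x y = t\<^sup>2 * mass n + t * (avg n {x} + avg n {y}) + avg n {x, y}" for x y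
  have lip1: "\<bar>avg n {x} - avg n {x'}\<bar> \<le> L * d x x'" if "x \<in> topspace V" "x' \<in> topspace V" for x x'
    using avg_lipschitz[of "{}" n x x'] n that by (simp add: L_def)
  have lip2: "\<bar>avg n {x, y} - avg n {x', y'}\<bar> \<le> L * (d x x' + d y y')"
    if "x \<in> topspace V" "x' \<in> topspace V" "y \<in> topspace V" "y' \<in> topspace V" for x y x' y'
    using avg_pair_lipschitz[of n x x' y y'] n that by (simp add: L_def)
  have psd: "psd_kernel \<omega> k"
  proof (rule psd_kernel_vertexI)
    show "k x y = k y x" for x y by (simp add: k_def insert_commute add.commute)
    fix x y x' y' assume V: "x \<in> topspace V" "y \<in> topspace V" "x' \<in> topspace V" "y' \<in> topspace V"
    have "k x y - k x' y' = t * (avg n {x} - avg n {x'}) + t * (avg n {y} - avg n {y'})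
        + (avg n {x, y} - avg n {x', y'})"
      by (simp add: k_def algebra_simps)
    then have "\<bar>k x y - k x' y'\<bar> \<le> \<bar>t * (avg n {x} - avg n {x'})\<bar> + \<bar>t * (avg n {y} - avg n {y'})\<bar>
        + \<bar>avg n {x, y} - avg n {x', y'}\<bar>" by linarith
    also have "\<dots> \<le> \<bar>t\<bar> * (L * d x x') + \<bar>t\<bar> * (L * d y y') + L * (d x x' + d y y')"
      unfolding abs_mult by (intro add_mono mult_left_mono lip1 lip2 V) auto
    finally show "\<bar>k x y - k x' y'\<bar> \<le> ((\<bar>t\<bar> + 1) * L) * (d x x' + d y y')"
      by (simp add: algebra_simps)
  next
    fix A and c :: "'a \<Rightarrow> real" assume A: "finite A" "A \<subseteq> supp"
    define s :: "'a option \<Rightarrow> 'a set" where "s i = set_option i" for i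
    \<comment> \<open>\<open>None\<close> stands for the empty set. Its coefficient is t times the
      sum of the others, the finite analogue of t times the integral of a test function; with it the
      form over \<open>{}\<close> and the singletons collapses to the form of
      \<open>k\<close>.\<close>
    define c' where "c' i = (case i of None \<Rightarrow> t * sum c A | Some x \<Rightarrow> c x)" for i
    have "0 \<le> (\<Sum>i\<in>insert None (Some ` A). \<Sum>j\<in>insert None (Some ` A). c' i * c' j * avg n (s i \<union> s j))"
      by (rule psd_avg[OF n]) (use A in \<open>auto simp: s_def Sub_def\<close>)
    also have "\<dots> = (t * sum c A)\<^sup>2 * mass n + (\<Sum>x\<in>A. t * sum c A * c x * avg n {x})
        + (\<Sum>x\<in>A. t * sum c A * c x * avg n {x} + (\<Sum>y\<in>A. c x * c y * avg n {x, y}))"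
      using A(1) by (simp add: sum.reindex c'_def s_def power2_eq_square insert_commute ac_simps)
    also have "\<dots> = (\<Sum>x\<in>A. \<Sum>y\<in>A. c x * c y * k x y)"
    proof -
      have 1: "(t * sum c A)\<^sup>2 * mass n = (\<Sum>x\<in>A. \<Sum>y\<in>A. c x * c y * (t\<^sup>2 * mass n))"
        by (simp add: power_mult_distrib power2_eq_square sum_product sum_distrib_right sum_distrib_left ac_simps)
      have 2: "(\<Sum>x\<in>A. t * sum c A * c x * avg n {x}) = (\<Sum>x\<in>A. \<Sum>y\<in>A. c x * c y * (t * avg n {x}))"
        by (simp add: sum_distrib_right sum_distrib_left ac_simps)
      have 3: "(\<Sum>x\<in>A. t * sum c A * c x * avg n {x}) = (\<Sum>x\<in>A. \<Sum>y\<in>A. c x * c y * (t * avg n {y}))"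
        unfolding 2 by (subst sum.swap) (simp add: ac_simps)
      show ?thesis
        unfolding sum.distrib 1 by (subst 2, subst 3) (simp add: k_def sum.distrib distrib_left)
    qed
    finally show "0 \<le> (\<Sum>x\<in>A. \<Sum>y\<in>A. c x * c y * k x y)" .
  qed
  have "(\<integral>x. \<integral>y. k x y \<partial>\<omega> \<partial>\<omega>) = (\<integral>x. (t\<^sup>2 * mass n * W + t * avg n {x} * W + t * mass (Suc n)) + avg (Suc n) {x} \<partial>\<omega>)"
  proof (rule Bochner_Integration.integral_cong[OF refl])
    fix x assume "x \<in> space \<omega>"
    then have x: "x \<in> topspace V" by simp
    have i: "integrable \<omega> (\<lambda>y. avg n {y})" "integrable \<omega> (\<lambda>y. avg n {y, x})"
      using integrable_avg[of "{}"] integrable_avg[of "{x}"] n x by auto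
    have e: "(\<integral>y. avg n {y} \<partial>\<omega>) = mass (Suc n)" "(\<integral>y. avg n {y, x} \<partial>\<omega>) = avg (Suc n) {x}"
      using avg_Suc[of "{}" n] avg_Suc[of "{x}" n] n x by auto
    have "(\<integral>y. k x y \<partial>\<omega>) = (\<integral>y. (t\<^sup>2 * mass n + t * avg n {x}) + t * avg n {y} + avg n {y, x} \<partial>\<omega>)"
      by (simp add: k_def distrib_left insert_commute add.assoc)
    also have "\<dots> = (t\<^sup>2 * mass n + t * avg n {x}) * W + t * mass (Suc n) + avg (Suc n) {x}"
      using i by (simp add: e W_def mult.commute)
    finally show "(\<integral>y. k x y \<partial>\<omega>) = (t\<^sup>2 * mass n * W + t * avg n {x} * W + t * mass (Suc n)) + avg (Suc n) {x}"
      by (simp add: algebra_simps)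
  qed
  also have "\<dots> = (t * W)\<^sup>2 * mass n + 2 * (t * W) * mass (Suc n) + mass (Suc (Suc n))"
  proof -
    have i: "integrable \<omega> (\<lambda>x. avg n {x})" using integrable_avg[of "{}"] n by auto
    have e: "(\<integral>y. avg n {y} \<partial>\<omega>) = mass (Suc n)" "(\<integral>x. avg (Suc n) {x} \<partial>\<omega>) = mass (Suc (Suc n))"
      using avg_Suc[of "{}" n] avg_Suc[of "{}" "Suc n"] n by auto
    have i2: "integrable \<omega> (\<lambda>x. avg (Suc n) {x})" using integrable_avg[of "{}" "Suc n"] n by auto
    show ?thesis
      using i i2 by (simp add: e W_def power2_eq_square algebra_simps)
  qed
  finally show ?thesis
    using psd_kernel_integral_nonneg(1)[OF finite_measure psd] by (simp add: W_def)
qed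

end

section \<open>Pairing averaged kernels with the cone\<close>

context radon_space
begin

text \<open>Appending two coordinates preserves the product measures, as is seen on boxes. This is
  the form of Fubini in which the two vertices of a kernel are the outer variables and a tuple is
  the inner one.\<close>

lemma distr_PiM_pair:
  fixes n :: nat
  defines "f \<equiv> \<lambda>z. ((fst z)(n := fst (snd z)))(Suc n := snd (snd z))"
  shows "f \<in> measurable (PiM {..<n} (\<lambda>_. \<omega>) \<Otimes>\<^sub>M (\<omega> \<Otimes>\<^sub>M \<omega>)) (PiM {..<n + 2} (\<lambda>_. \<omega>))"
    and "distr (PiM {..<n} (\<lambda>_. \<omega>) \<Otimes>\<^sub>M (\<omega> \<Otimes>\<^sub>M \<omega>)) (PiM {..<n + 2} (\<lambda>_. \<omega>)) f = PiM {..<n + 2} (\<lambda>_. \<omega>)"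
proof -
  let ?P = "PiM {..<n} (\<lambda>_. \<omega>)" and ?M = "PiM {..<n + 2} (\<lambda>_. \<omega>)"
  let ?N = "?P \<Otimes>\<^sub>M (\<omega> \<Otimes>\<^sub>M \<omega>)"
  interpret Pn: finite_measure ?P by (rule finite_measure_PiM) simp
  interpret WW: finite_measure "\<omega> \<Otimes>\<^sub>M \<omega>" by (rule finite_measure_pair_measure[OF finite_measure finite_measure])
  show f: "f \<in> measurable ?N ?M"
    unfolding f_def
  proof (rule measurable_fun_upd)
    show "{..<n + 2} = {..<Suc n} \<union> {Suc n}" by auto
    show "(\<lambda>z. (fst z)(n := fst (snd z))) \<in> measurable ?N (PiM {..<Suc n} (\<lambda>_. \<omega>))"
      by (rule measurable_fun_upd[where J="{..<n}"]) auto
  qed measurable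
  show "distr ?N ?M f = ?M"
  proof (rule PiM_eqI)
    fix A :: "nat \<Rightarrow> 'a set" assume A: "\<And>i. i \<in> {..<n + 2} \<Longrightarrow> A i \<in> sets \<omega>"
    have A': "A i \<subseteq> topspace V" if "i < n + 2" for i
      using sets.sets_into_space[OF A, of i] that by simp
    have box: "PiE {..<n + 2} A \<in> sets ?M" by (rule sets_PiM_I_finite) (use A in auto)
    have box': "PiE {..<n} A \<in> sets ?P" by (rule sets_PiM_I_finite) (use A in auto)
    have "f -` PiE {..<n + 2} A \<inter> space ?N = PiE {..<n} A \<times> (A n \<times> A (Suc n))"
    proof (intro equalityI subsetI)
      fix z assume z: "z \<in> f -` PiE {..<n + 2} A \<inter> space ?N"
      have fz: "f z i \<in> A i" if "i < n + 2" for i using z that by (auto simp: PiE_iff)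
      have "fst z i \<in> A i" if "i < n" for i using fz[of i] that by (simp add: f_def)
      moreover have "fst z \<in> extensional {..<n}" using z by (auto simp: space_pair_measure space_PiM PiE_iff)
      moreover have "fst (snd z) \<in> A n" using fz[of n] by (simp add: f_def)
      moreover have "snd (snd z) \<in> A (Suc n)" using fz[of "Suc n"] by (simp add: f_def)
      ultimately show "z \<in> PiE {..<n} A \<times> (A n \<times> A (Suc n))"
        by (simp add: mem_Times_iff PiE_iff)
    next
      fix z assume z: "z \<in> PiE {..<n} A \<times> (A n \<times> A (Suc n))"
      have zz: "fst z \<in> PiE {..<n} A" using z by (simp only: mem_Times_iff)
      have z1: "fst z i \<in> A i" if "i < n" for i using PiE_mem[OF zz] that by simp
      have z2: "fst z \<in> extensional {..<n}" "fst (snd z) \<in> A n" "snd (snd z) \<in> A (Suc n)"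
        using z zz by (simp_all only: mem_Times_iff PiE_iff)
      have "f z i \<in> A i" if i: "i < n + 2" for i
      proof -
        consider "i < n" | "i = n" | "i = Suc n" using i by linarith
        then show ?thesis by cases (use z1 z2 in \<open>auto simp: f_def\<close>)
      qed
      moreover have "f z \<in> extensional {..<n + 2}"
        using z2(1) by (auto simp: f_def extensional_def)
      moreover have "fst z i \<in> topspace V" if "i < n" for i using z1[OF that] A'[of i] that by auto
      then have "z \<in> space ?N"
        using z2 A'[of n] A'[of "Suc n"] by (auto simp: space_pair_measure space_PiM PiE_iff mem_Times_iff)
      ultimately show "z \<in> f -` PiE {..<n + 2} A \<inter> space ?N" by (simp add: PiE_iff)
    qed
    then have "emeasure (distr ?N ?M f) (PiE {..<n + 2} A) = emeasure ?N (PiE {..<n} A \<times> (A n \<times> A (Suc n)))"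
      by (simp only: emeasure_distr[OF f box])
    also have "\<dots> = emeasure ?P (PiE {..<n} A) * (emeasure \<omega> (A n) * emeasure \<omega> (A (Suc n)))"
      using A box' by (subst WW.emeasure_pair_measure_Times) (auto simp: emeasure_pair_measure_Times)
    also have "\<dots> = (\<Prod>i\<in>{..<n + 2}. emeasure \<omega> (A i))"
      using A by (subst emeasure_PiM) (auto simp: mult.assoc)
    finally show "emeasure (distr ?N ?M f) (PiE {..<n + 2} A) = (\<Prod>i\<in>{..<n + 2}. emeasure \<omega> (A i))" .
  qed auto
qed

end

context Delta_function
begin

text \<open>Integrating out all coordinates but the last two turns the value of \<nu> on the whole
  tuple into \<open>avg r {x, y}\<close>. Since \<nu> is bounded, the integrand is dominated by a
  multiple of \<open>Z\<close> alone.\<close>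

lemma dual_pairing_eq:
  assumes Z: "integrable (\<omega> \<Otimes>\<^sub>M \<omega>) (\<lambda>(x, y). Z x y)"
  shows "integrable (PiM {..<r + 2} (\<lambda>_. \<omega>)) (\<lambda>w. \<nu> (w ` {..<r + 2}) * Z (w r) (w (Suc r)))"
    and "(\<integral>w. \<nu> (w ` {..<r + 2}) * Z (w r) (w (Suc r)) \<partial>PiM {..<r + 2} (\<lambda>_. \<omega>))
      = kernel_inner \<omega> (\<lambda>x y. avg r {x, y}) Z"
proof -
  let ?P = "PiM {..<r} (\<lambda>_. \<omega>)" and ?M = "PiM {..<r + 2} (\<lambda>_. \<omega>)"
  let ?N = "?P \<Otimes>\<^sub>M (\<omega> \<Otimes>\<^sub>M \<omega>)"
  interpret Pn: finite_measure ?P by (rule finite_measure_PiM) simp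
  interpret WW: finite_measure "\<omega> \<Otimes>\<^sub>M \<omega>" by (rule finite_measure_pair_measure[OF finite_measure finite_measure])
  interpret PP: pair_sigma_finite ?P "\<omega> \<Otimes>\<^sub>M \<omega>" ..
  let ?h = "\<lambda>w. \<nu> (w ` {..<r + 2}) * Z (w r) (w (Suc r))"
  let ?f = "\<lambda>z. ((fst z)(r := fst (snd z)))(Suc r := snd (snd z))"
  obtain B where B: "\<forall>S\<in>Sub (topspace V) (r + 3). \<bar>\<nu> S\<bar> \<le> B" using bounded_fun by blast
  have bd: "\<bar>\<nu> (w ` {..<r + 2})\<bar> \<le> B" if "w \<in> space ?M" for w
    using B image_in_Sub[OF that, of "{}" "r + 3"] by simp
  have \<nu>m: "(\<lambda>w. \<nu> (w ` {..<r + 2})) \<in> borel_measurable ?M"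
    using measurable_image[of "{..<r + 2}" "{}"] by simp
  have Zi: "integrable ?M (\<lambda>w. Z (w r) (w (Suc r)))"
    by (rule integrable_PiM_pair[OF Z])
  show hi: "integrable ?M ?h"
  proof (rule Bochner_Integration.integrable_bound)
    show "integrable ?M (\<lambda>w. B * Z (w r) (w (Suc r)))" using Zi by simp
    show "?h \<in> borel_measurable ?M"
      using \<nu>m borel_measurable_integrable[OF Zi] by (rule borel_measurable_times)
    show "AE w in ?M. norm (?h w) \<le> norm (B * Z (w r) (w (Suc r)))"
    proof (rule AE_I2)
      fix w assume "w \<in> space ?M"
      then have "\<bar>\<nu> (w ` {..<r + 2})\<bar> \<le> \<bar>B\<bar>" using bd by fastforce
      then show "norm (?h w) \<le> norm (B * Z (w r) (w (Suc r)))"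
        by (simp add: abs_mult mult_right_mono)
    qed
  qed
  have him: "?h \<in> borel_measurable ?M" using hi by (rule borel_measurable_integrable)
  have im: "?f (u, x, y) ` {..<r + 2} = u ` {..<r} \<union> {x, y}" for u x y
    by (auto simp: lessThan_Suc image_iff)
  have eq: "?h (?f (u, x, y)) = \<nu> (u ` {..<r} \<union> {x, y}) * Z x y" for u x y
    unfolding im by simp
  have "integrable ?N (\<lambda>z. ?h (?f z))"
    using integrable_distr_eq[OF distr_PiM_pair(1) him] hi unfolding distr_PiM_pair(2) by (rule iffD1)
  moreover have fun_eq: "(\<lambda>z. ?h (?f z)) = (\<lambda>(u, z). (\<lambda>(x, y). \<nu> (u ` {..<r} \<union> {x, y}) * Z x y) z)"
  proof
    fix q :: "(nat \<Rightarrow> 'a) \<times> 'a \<times> 'a"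
    obtain u x y where q: "q = (u, x, y)" by (cases q) auto
    show "?h (?f q) = (\<lambda>(u, z). (\<lambda>(x, y). \<nu> (u ` {..<r} \<union> {x, y}) * Z x y) z) q"
      unfolding q prod.case by (rule eq)
  qed
  ultimately have i: "integrable ?N (\<lambda>(u, z). (\<lambda>(x, y). \<nu> (u ` {..<r} \<union> {x, y}) * Z x y) z)"
    by (simp only:)
  have "(\<integral>w. ?h w \<partial>?M) = (\<integral>z. ?h (?f z) \<partial>?N)"
    using integral_distr[OF distr_PiM_pair(1) him] unfolding distr_PiM_pair(2) .
  also have "\<dots> = (\<integral>(u, z). (\<lambda>(x, y). \<nu> (u ` {..<r} \<union> {x, y}) * Z x y) z \<partial>?N)"
    by (simp only: fun_eq)
  also have "\<dots> = (\<integral>z. \<integral>u. (\<lambda>(x, y). \<nu> (u ` {..<r} \<union> {x, y}) * Z x y) z \<partial>?P \<partial>(\<omega> \<Otimes>\<^sub>M \<omega>))"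
    by (rule PP.integral_snd[OF i, symmetric])
  also have "\<dots> = kernel_inner \<omega> (\<lambda>x y. avg r {x, y}) Z"
    unfolding kernel_inner_def by (rule Bochner_Integration.integral_cong) (auto simp: avg_def)
  finally show "(\<integral>w. ?h w \<partial>?M) = kernel_inner \<omega> (\<lambda>x y. avg r {x, y}) Z" .
qed

text \<open>The value of \<nu> depends only on the set of coordinates and the product measure is
  invariant under permutations. Hence all \<open>(r + 2)!\<close> terms of the symmetrization
  contribute the same integral, and the one with the pair in the last two places is the
  pairing.\<close>

lemma dual_pairing_nonneg:
  assumes Z: "Z \<in> C_cone \<omega> r"
  shows "0 \<le> kernel_inner \<omega> (\<lambda>x y. avg r {x, y}) Z"
proof -
  let ?I = "{..<r + 2}"
  let ?M = "PiM ?I (\<lambda>_. \<omega>)"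
  have Zs: "Z \<in> L2_sym \<omega>" and Z0: "AE w in ?M. 0 \<le> symmetrize (r + 2) (\<lambda>x. Z (x 0) (x 1)) w"
    using Z by (auto simp: C_cone_def)
  have Zi: "integrable (\<omega> \<Otimes>\<^sub>M \<omega>) (\<lambda>(x, y). Z x y)" by (rule L2_sym_integrable[OF finite_measure Zs])
  let ?h = "\<lambda>\<pi> w. \<nu> (w ` ?I) * Z (w (\<pi> (0::nat))) (w (\<pi> 1))"
  have h_eq: "?h \<pi> w = ?h id (\<lambda>i\<in>?I. w (\<pi> i))" if \<pi>: "\<pi> permutes ?I" for \<pi> w
  proof -
    have "(\<lambda>i\<in>?I. w (\<pi> i)) ` ?I = w ` (\<pi> ` ?I)" by (simp only: image_restrict_eq image_image)
    then have "(\<lambda>i\<in>?I. w (\<pi> i)) ` ?I = w ` ?I" by (simp only: permutes_image[OF \<pi>])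
    then show ?thesis by simp
  qed
  obtain \<tau> where \<tau>: "\<tau> permutes ?I" "\<tau> 0 = r" "\<tau> 1 = Suc r"
    using exists_permutation_pair by blast
  have \<tau>i: "integrable ?M (?h \<tau>)" using dual_pairing_eq(1)[OF Zi] by (simp only: \<tau>)
  have idm: "?h id \<in> borel_measurable ?M"
  proof -
    have "(\<lambda>w. (w 0, w 1)) \<in> measurable ?M (\<omega> \<Otimes>\<^sub>M \<omega>)"
      by (intro measurable_Pair measurable_component_singleton) auto
    from measurable_compose[OF this borel_measurable_integrable[OF Zi]]
    have "(\<lambda>w. Z (w 0) (w 1)) \<in> borel_measurable ?M" by simp
    moreover have "(\<lambda>w. \<nu> (w ` ?I)) \<in> borel_measurable ?M"
      using measurable_image[of ?I "{}"] by simp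
    ultimately show ?thesis by simp
  qed
  have h_fun: "?h \<pi> = (\<lambda>w. ?h id (\<lambda>i\<in>?I. w (\<pi> i)))" if "\<pi> permutes ?I" for \<pi>
    using h_eq[OF that] by (rule ext)
  \<comment> \<open>Integrability is known with the pair at the last two places; permuting carries
    it to the first two, and from there to every position.\<close>
  have idi: "integrable ?M (?h id)"
    using \<tau>i unfolding h_fun[OF \<tau>(1)] PiM_permutes(2)[OF finite_lessThan \<tau>(1) idm] .
  have hi: "integrable ?M (?h \<pi>)" if "\<pi> permutes ?I" for \<pi>
    unfolding h_fun[OF that] PiM_permutes(2)[OF finite_lessThan that idm] by (rule idi)
  have hv: "(\<integral>w. ?h \<pi> w \<partial>?M) = (\<integral>w. ?h id w \<partial>?M)" if "\<pi> permutes ?I" for \<pi>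
    unfolding h_eq[OF that] by (rule PiM_permutes(1)[OF finite_lessThan that idm])
  have "0 \<le> (\<integral>w. \<nu> (w ` ?I) * symmetrize (r + 2) (\<lambda>x. Z (x 0) (x 1)) w \<partial>?M)"
    by (rule integral_nonneg_AE) (use AE_nonneg Z0 in \<open>eventually_elim, simp\<close>)
  also have "\<dots> = (\<integral>w. (1 / fact (r + 2)) * (\<Sum>\<pi> | \<pi> permutes ?I. ?h \<pi> w) \<partial>?M)"
    by (simp add: symmetrize_def sum_distrib_left mult.left_commute)
  also have "\<dots> = (1 / fact (r + 2)) * (\<Sum>\<pi> | \<pi> permutes ?I. \<integral>w. ?h \<pi> w \<partial>?M)"
    by (simp only: integral_mult_right_zero, subst Bochner_Integration.integral_sum) (use hi in auto)
  also have "\<dots> = (\<integral>w. ?h id w \<partial>?M)"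
  proof -
    have "(\<Sum>\<pi> | \<pi> permutes ?I. \<integral>w. ?h \<pi> w \<partial>?M) = (\<Sum>\<pi> | \<pi> permutes ?I. \<integral>w. ?h id w \<partial>?M)"
      by (rule sum.cong[OF refl], rule hv) simp
    also have "\<dots> = real (card {\<pi>. \<pi> permutes ?I}) * (\<integral>w. ?h id w \<partial>?M)"
      by (rule sum_constant)
    also have "card {\<pi>. \<pi> permutes ?I} = fact (r + 2)"
      by (rule card_permutations) auto
    finally show ?thesis using fact_nonzero[of "r + 2", where 'a=real] by (simp only: of_nat_fact) (simp add: field_simps del: fact_Suc)
  qed
  also have "\<dots> = (\<integral>w. ?h \<tau> w \<partial>?M)" by (rule hv[OF \<tau>(1), symmetric])
  also have "\<dots> = kernel_inner \<omega> (\<lambda>x y. avg r {x, y}) Z"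
    using dual_pairing_eq(2)[OF Zi] by (simp only: \<tau>)
  finally show ?thesis .
qed

text \<open>Log-convexity bounds successive ratios from below by the previous one, but dividing
  needs a positive denominator, so positivity is carried along in the induction.\<close>

lemma mass_growth:
  assumes m1: "mass (Suc 0) > 0" and n: "n \<le> r + 1"
  shows "mass n > 0 \<and> mass (Suc n) \<ge> mass (Suc 0) * mass n"
  using n
proof (induction n)
  case 0
  then show ?case by (simp add: mass_0)
next
  case (Suc n)
  then have IH: "mass n > 0" "mass (Suc n) \<ge> mass (Suc 0) * mass n" by auto
  have pos: "mass (Suc n) > 0" using IH m1 by (meson less_le_trans mult_pos_pos)
  let ?W = "measure \<omega> (space \<omega>)"
  \<comment> \<open>The choice of \<open>t\<close> below divides by the total mass, and
    \<open>\<omega> = 0\<close> would force \<open>mass (Suc 0) = 0\<close>.\<close>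
  have W: "?W \<noteq> 0"
  proof
    assume "?W = 0"
    then have "emeasure \<omega> (space \<omega>) = 0" by (simp add: emeasure_eq_measure)
    then have "AE x in \<omega>. \<nu> {x} = 0" by (auto intro!: AE_I[where N="space \<omega>"])
    then have "(\<integral>x. \<nu> {x} \<partial>\<omega>) = 0" by (rule integral_eq_zero_AE)
    then show False using m1 by (simp add: mass_1)
  qed
  \<comment> \<open>With this \<open>t\<close> the product \<open>t * ?W\<close> minimizes the
    quadratic of \<open>mass_quadratic\<close>, so the minimum value is its discriminant
    inequality.\<close>
  define t where "t = - mass (Suc n) / (mass n * ?W)"
  have t: "t * ?W = - mass (Suc n) / mass n" using W by (simp add: t_def)
  have "0 \<le> (t * ?W)\<^sup>2 * mass n + 2 * (t * ?W) * mass (Suc n) + mass (Suc (Suc n))"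
    by (rule mass_quadratic) (use Suc.prems in simp)
  then have "mass (Suc n) * mass (Suc n) / mass n \<le> mass (Suc (Suc n))"
    unfolding t using IH(1) by (simp add: power2_eq_square field_simps)
  moreover have "mass (Suc 0) * mass (Suc n) \<le> mass (Suc n) * mass (Suc n) / mass n"
    using mult_right_mono[OF IH(2), of "mass (Suc n)"] pos IH(1) by (simp add: field_simps)
  ultimately show ?case using pos by linarith
qed

text \<open>On the diagonal \<open>{x, x}\<close> is a singleton, so the trace of the averaged
  kernel has one integration variable fewer than its total integral: before normalization they are
  \<open>mass (r + 1)\<close> and \<open>mass (r + 2)\<close>.\<close>

lemma gamma_feasible_avg:
  assumes m1: "mass (Suc 0) > 0"
  defines "A \<equiv> \<lambda>x y. avg r {x, y} / mass (r + 1)"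
  shows "gamma_feasible V E \<omega> r A" and "kernel_inner \<omega> A (\<lambda>_ _. 1) \<ge> mass (Suc 0)"
proof -
  have pos: "mass (r + 1) > 0" using mass_growth[OF m1, of "r + 1"] by simp
  define L where "L = measure (PiM {..<r} (\<lambda>_. \<omega>)) (space (PiM {..<r} (\<lambda>_. \<omega>))) / mass (r + 1)"
  have L: "L \<ge> 0" using pos by (simp add: L_def)
  have lip: "\<bar>A x y - A x' y'\<bar> \<le> L * (d x x' + d y y')"
    if "x \<in> topspace V" "y \<in> topspace V" "x' \<in> topspace V" "y' \<in> topspace V" for x y x' y'
    using avg_pair_lipschitz[of r x x' y y'] that pos
    by (simp add: A_def L_def diff_divide_distrib[symmetric] divide_right_mono)
  have psd: "psd_kernel \<omega> A"
  proof (rule psd_kernel_vertexI[OF _ lip])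
    show "A x y = A y x" for x y by (simp add: A_def insert_commute)
    fix X and c :: "'a \<Rightarrow> real" assume X: "finite X" "X \<subseteq> supp"
    have "0 \<le> (\<Sum>x\<in>X. \<Sum>y\<in>X. c x * c y * avg r ({x} \<union> {y}))"
      by (rule psd_avg) (use X in \<open>auto simp: Sub_def\<close>)
    then have "0 \<le> (\<Sum>x\<in>X. \<Sum>y\<in>X. c x * c y * avg r {x, y}) / mass (r + 1)"
      using pos by (simp add: insert_commute)
    then show "0 \<le> (\<Sum>x\<in>X. \<Sum>y\<in>X. c x * c y * A x y)"
      by (simp add: A_def sum_divide_distrib)
  qed
  then have Ai: "integrable (\<omega> \<Otimes>\<^sub>M \<omega>) (\<lambda>(x, y). A x y)"
    using L2_sym_integrable[OF finite_measure] by (auto simp: psd_kernel_def)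
  interpret PP: pair_sigma_finite \<omega> \<omega> ..
  have avg1: "(\<integral>y. avg r {x, y} \<partial>\<omega>) = avg (r + 1) {x}" if "x \<in> topspace V" for x
    using avg_Suc[of "{x}" r] that by (simp add: insert_commute)
  have "kernel_inner \<omega> A (\<lambda>_ _. 1) = (\<integral>x. \<integral>y. A x y \<partial>\<omega> \<partial>\<omega>)"
    using PP.integral_fst'[OF Ai] by (simp add: kernel_inner_def)
  also have "\<dots> = (\<integral>x. avg (r + 1) {x} / mass (r + 1) \<partial>\<omega>)"
    by (rule Bochner_Integration.integral_cong) (simp_all add: A_def avg1)
  also have "\<dots> = mass (r + 2) / mass (r + 1)"
    using avg_Suc[of "{}" "r + 1"] by simp
  also have "\<dots> \<ge> mass (Suc 0)"
    using mass_growth[OF m1, of "r + 1"] pos by (simp add: field_simps)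
  finally show "kernel_inner \<omega> A (\<lambda>_ _. 1) \<ge> mass (Suc 0)" .
  have cont: "continuous_map (prod_topology V V) euclideanreal (\<lambda>(x, y). A x y)"
  proof (rule continuous_map_realI)
    fix z and \<epsilon> :: real assume "z \<in> topspace (prod_topology V V)" and \<epsilon>: "\<epsilon> > 0"
    then obtain x y where z: "z = (x, y)" "x \<in> topspace V" "y \<in> topspace V" by auto
    define e where "e = \<epsilon> / (2 * L + 1)"
    have "e > 0" using \<epsilon> L by (simp add: e_def)
    moreover have "(2 * L + 1) * e = \<epsilon>" using L by (simp add: e_def)
    ultimately have e: "e > 0" "L * (e + e) \<le> \<epsilon>" by (auto simp: algebra_simps)
    obtain U where U: "openin V U" "x \<in> U" "\<forall>x'\<in>U. d x x' \<le> e" using d_neighbourhood[OF z(2) e(1)] by blast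
    obtain U' where U': "openin V U'" "y \<in> U'" "\<forall>y'\<in>U'. d y y' \<le> e" using d_neighbourhood[OF z(3) e(1)] by blast
    have "\<bar>A x' y' - A x y\<bar> \<le> \<epsilon>" if "x' \<in> U" "y' \<in> U'" for x' y'
    proof -
      have "x' \<in> topspace V" "y' \<in> topspace V" using that U(1) U'(1) openin_subset by blast+
      then have "\<bar>A x y - A x' y'\<bar> \<le> L * (d x x' + d y y')" using lip z by blast
      also have "\<dots> \<le> L * (e + e)" using that U(3) U'(3) L by (intro mult_left_mono add_mono) auto
      finally show ?thesis using e(2) by (simp add: abs_minus_commute)
    qed
    then show "\<exists>U. openin (prod_topology V V) U \<and> z \<in> U \<and>
        (\<forall>y\<in>U. \<bar>(\<lambda>(x, y). A x y) y - (\<lambda>(x, y). A x y) z\<bar> \<le> \<epsilon>)"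
      using U U' z by (intro exI[of _ "U \<times> U'"]) (simp add: openin_prod_Times_iff)
  qed
  have "0 \<le> kernel_inner \<omega> A Z" if "Z \<in> C_cone \<omega> r" for Z
  proof -
    have "kernel_inner \<omega> A Z = (\<integral>z. (\<lambda>(x, y). avg r {x, y} * Z x y) z / mass (r + 1) \<partial>(\<omega> \<Otimes>\<^sub>M \<omega>))"
      unfolding kernel_inner_def A_def by (rule Bochner_Integration.integral_cong) auto
    also have "\<dots> = kernel_inner \<omega> (\<lambda>x y. avg r {x, y}) Z / mass (r + 1)"
      by (simp add: kernel_inner_def)
    finally show ?thesis using dual_pairing_nonneg[OF that] pos by simp
  qed
  then have dual: "A \<in> C_dual \<omega> r"
    using psd by (auto simp: C_dual_def psd_kernel_def)
  have trace: "(\<integral>x. A x x \<partial>\<omega>) = 1"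
    using avg_Suc[of "{}" r] pos by (simp add: A_def)
  have "A x y = 0" if xy: "(x, y) \<in> E" for x y
  proof -
    have V: "x \<in> topspace V" "y \<in> topspace V" using graph xy by (auto simp: topological_graph_def)
    have "\<nu> (v ` {..<r} \<union> {x, y}) = 0" if v: "v \<in> space (PiM {..<r} (\<lambda>_. \<omega>))" for v
    proof (rule fun_dependent)
      show "v ` {..<r} \<union> {x, y} \<in> Sub (topspace V) (r + 3)"
        by (rule image_in_Sub[OF v]) (use V card_insert_le_m1[of 2 "{y}" x] in auto)
      show "\<not> independent_set E (v ` {..<r} \<union> {x, y})"
        using xy by (auto simp: independent_set_def)
    qed
    then have "avg r {x, y} = (\<integral>v. 0 \<partial>PiM {..<r} (\<lambda>_. \<omega>))"
      unfolding avg_def by (intro Bochner_Integration.integral_cong) auto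
    then show ?thesis by (simp add: A_def)
  qed
  then show "gamma_feasible V E \<omega> r A"
    unfolding gamma_feasible_def using cont psd dual trace by auto
qed

text \<open>The normalization needs a positive first moment; otherwise the value is at most 0, and
  \<open>gamma\<close> is never negative.\<close>

lemma value_le_gamma: "ereal (\<integral>x. \<nu> {x} \<partial>\<omega>) \<le> gamma V E \<omega> r"
proof (cases "mass (Suc 0) > 0")
  case True
  note A = gamma_feasible_avg[OF True]
  have "ereal (\<integral>x. \<nu> {x} \<partial>\<omega>) \<le> ereal (kernel_inner \<omega> (\<lambda>x y. avg r {x, y} / mass (r + 1)) (\<lambda>_ _. 1))"
    using A(2) by (simp add: mass_1)
  also have "\<dots> \<le> gamma V E \<omega> r"
    unfolding gamma_def using A(1) by (auto intro!: Sup_upper)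
  finally show ?thesis .
next
  case False
  then have "ereal (\<integral>x. \<nu> {x} \<partial>\<omega>) \<le> 0" by (simp add: mass_1)
  also have "0 \<le> gamma V E \<omega> r" by (rule gamma_nonneg[OF finite_measure])
  finally show ?thesis .
qed

end

lemma Delta_le_gamma:
  assumes "topological_graph V E" "radon_space V \<omega>"
  shows "Delta V E \<omega> (r + 3) \<le> gamma V E \<omega> r"
  unfolding Delta_def
proof (rule Sup_least)
  fix z assume "z \<in> {ereal (\<integral>x. \<nu> {x} \<partial>\<omega>) |\<nu>. Delta_feasible V E \<omega> (r + 3) \<nu>}"
  then obtain \<nu> where z: "z = ereal (\<integral>x. \<nu> {x} \<partial>\<omega>)" "Delta_feasible V E \<omega> (r + 3) \<nu>" by blast
  interpret radon_space V \<omega> by fact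
  interpret Delta_function V \<omega> E r \<nu> by unfold_locales (use assms z in auto)
  show "z \<le> gamma V E \<omega> r" unfolding z(1) by (rule value_le_gamma)
qed

section \<open>Snapping vertices to the support\<close>

lemma eventually_less_LIMSEQ:
  fixes f g :: "nat \<Rightarrow> real"
  assumes "f \<longlonglongrightarrow> a" "g \<longlonglongrightarrow> b" "a < b"
  shows "\<forall>\<^sub>F n in sequentially. f n < g n"
proof -
  have "\<forall>\<^sub>F n in sequentially. 0 < g n - f n"
    by (rule order_tendstoD(1)[OF tendsto_diff[OF assms(2,1)]]) (use assms(3) in simp)
  then show ?thesis by eventually_elim simp
qed

section \<open>Geometry of the support for the pseudometric\<close>

context Sub_function
begin

lemma measurable_singleton_value: "(\<lambda>x. \<nu> {x}) \<in> borel_measurable \<omega>"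
  using integrable_avg[of "{}" 0] K_pos by (auto simp: avg_0)

lemma d_reverse_triangle:
  assumes "x \<in> topspace V" "y \<in> topspace V" "x' \<in> topspace V" "y' \<in> topspace V"
  shows "\<bar>d x y - d x' y'\<bar> \<le> d x x' + d y y'"
  using d_triangle[of x x' y] d_triangle[of x' y' y] d_triangle[of x' x y'] d_triangle[of x y y'] assms
    d_commute[of x x'] d_commute[of y y'] by linarith

lemma nearest_point:
  assumes "supp \<noteq> {}" and x: "x \<in> topspace V"
  shows "\<exists>z. z \<in> supp \<and> (\<forall>y\<in>supp. d x z \<le> d x y)"
proof -
  have "continuous_map V euclideanreal (d x)"
  proof (rule continuous_map_realI)
    fix y and \<epsilon> :: real assume y: "y \<in> topspace V" and "\<epsilon> > 0"
    then obtain U where U: "openin V U" "y \<in> U" "\<forall>z\<in>U. d y z \<le> \<epsilon>" using d_neighbourhood by blast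
    have "\<bar>d x z - d x y\<bar> \<le> \<epsilon>" if z: "z \<in> U" for z
    proof -
      have "z \<in> topspace V" using z U(1) openin_subset by blast
      then show ?thesis using d_reverse_triangle[of x z x y] x y U(3) z d_commute[of y z] by auto
    qed
    then show "\<exists>U. openin V U \<and> y \<in> U \<and> (\<forall>z\<in>U. \<bar>d x z - d x y\<bar> \<le> \<epsilon>)" using U by blast
  qed
  moreover have "compactin V supp" by (rule closedin_compact_space[OF compact closedin_supp])
  ultimately have "compactin euclideanreal (d x ` supp)" by (rule image_compactin[rotated])
  then have "compact (d x ` supp)" by simp
  from compact_attains_inf[OF this] obtain s where "s \<in> d x ` supp" "\<forall>t\<in>d x ` supp. s \<le> t"
    using assms(1) by blast
  then show ?thesis by auto
qed

text \<open>V may be nonseparable, but by compactness it is totally bounded for \<open>d\<close>.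
  Finite approximations of mesh \<open>1/(n+1)\<close> by points of the support combine to a
  countable set; its enumeration gives meaning to the first point that is close enough.\<close>

lemma dense_sequence:
  assumes "supp \<noteq> {}"
  shows "\<exists>z :: nat \<Rightarrow> 'a. (\<forall>i. z i \<in> supp) \<and> (\<forall>x\<in>supp. \<forall>e>0. \<exists>i. d x (z i) < e)"
proof -
  have "\<exists>A. finite A \<and> (\<forall>x\<in>supp. \<exists>a\<in>A \<inter> supp. d x a \<le> 1 / real (Suc n))" for n
  proof -
    obtain p A where p: "finite A" "p \<in> measurable \<omega> (count_space A)"
      "\<And>x. x \<in> supp \<Longrightarrow> p x \<in> supp" "\<And>x. x \<in> topspace V \<Longrightarrow> d x (p x) \<le> 1 / real (Suc n)"
      using finite_d_approximation[of "1 / real (Suc n)"] by (metis of_nat_0_less_iff zero_less_Suc zero_less_divide_1_iff)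
    have "p x \<in> A" if "x \<in> supp" for x
      using measurable_space[OF p(2), of x] supp_subset that by auto
    then show ?thesis using p supp_subset by (intro exI[of _ A]) blast
  qed
  then have "\<forall>n. \<exists>A. finite A \<and> (\<forall>x\<in>supp. \<exists>a\<in>A \<inter> supp. d x a \<le> 1 / real (Suc n))" by blast
  from choice[OF this] obtain A where
    A: "\<forall>n. finite (A n) \<and> (\<forall>x\<in>supp. \<exists>a\<in>A n \<inter> supp. d x a \<le> 1 / real (Suc n))" ..
  define D where "D = (\<Union>n. A n \<inter> supp)"
  have D: "countable D" "D \<noteq> {}" "D \<subseteq> supp"
  proof -
    have "countable (A n \<inter> supp)" for n using spec[OF A, of n] by (simp add: countable_finite)
    then show "countable D" unfolding D_def by (rule countable_UN[OF countableI_type])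
    obtain x where "x \<in> supp" using assms by blast
    then show "D \<noteq> {}" using spec[OF A, of 0] by (auto simp: D_def)
  qed (auto simp: D_def)
  show ?thesis
  proof (intro exI[of _ "from_nat_into D"] conjI allI ballI impI)
    show "from_nat_into D i \<in> supp" for i using from_nat_into[OF D(2)] D(3) by blast
    fix x and e :: real assume x: "x \<in> supp" and e: "e > 0"
    obtain n where n: "1 / real (Suc n) < e"
      using reals_Archimedean[OF e] by (auto simp: inverse_eq_divide)
    obtain a where a: "a \<in> A n \<inter> supp" "d x a \<le> 1 / real (Suc n)" using spec[OF A, of n] x by blast
    then have "a \<in> D" unfolding D_def by blast
    moreover note a(2)
    moreover obtain i where "from_nat_into D i = a" using from_nat_into_surj[OF D(1) \<open>a \<in> D\<close>] by blast
    ultimately show "\<exists>i. d x (from_nat_into D i) < e" using n by (intro exI[of _ i]) simp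
  qed
qed

text \<open>A continuous substitute for the edge relation, which carries no topological structure:
  it is Lipschitz for \<open>d\<close>, and it vanishes on edges whenever \<nu> vanishes on
  dependent sets. The bound \<open>K - 2\<close> leaves room for \<open>x\<close> and
  \<open>y\<close>.\<close>

definition strength :: "'a \<Rightarrow> 'a \<Rightarrow> real" where
  "strength x y = (SUP R\<in>Sub (topspace V) (K - 2). \<bar>\<nu> (insert x (insert y R))\<bar>)"

lemma strength_upper:
  assumes K: "K \<ge> 2" and "x \<in> topspace V" "y \<in> topspace V" "R \<in> Sub (topspace V) (K - 2)"
  shows "\<bar>\<nu> (insert x (insert y R))\<bar> \<le> strength x y"
  unfolding strength_def
proof (rule cSUP_upper[OF assms(4)])
  obtain B where B: "\<forall>S\<in>Sub (topspace V) K. \<bar>\<nu> S\<bar> \<le> B" using bounded_fun by blast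
  show "bdd_above ((\<lambda>R. \<bar>\<nu> (insert x (insert y R))\<bar>) ` Sub (topspace V) (K - 2))"
  proof (rule bdd_aboveI2)
    fix R assume R: "R \<in> Sub (topspace V) (K - 2)"
    have "insert x (insert y R) \<in> Sub (topspace V) K"
      by (rule insert_in_Sub[OF insert_in_Sub[OF R, of y "K - 1"]]) (use assms in auto)
    then show "\<bar>\<nu> (insert x (insert y R))\<bar> \<le> B" using B by blast
  qed
qed

lemma strength_nonneg:
  assumes "K \<ge> 2" "x \<in> topspace V" "y \<in> topspace V"
  shows "0 \<le> strength x y"
  using strength_upper[OF assms empty_in_Sub] by linarith

lemma strength_least:
  assumes "\<And>R. R \<in> Sub (topspace V) (K - 2) \<Longrightarrow> \<bar>\<nu> (insert x (insert y R))\<bar> \<le> e"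
  shows "strength x y \<le> e"
  unfolding strength_def by (rule cSUP_least) (use assms empty_in_Sub in blast)+

lemma strength_lipschitz_aux:
  assumes K: "K \<ge> 2" and V: "x \<in> topspace V" "y \<in> topspace V" "x' \<in> topspace V" "y' \<in> topspace V"
  shows "strength x y \<le> strength x' y' + (d x x' + d y y')"
proof (rule strength_least)
  fix R assume R: "R \<in> Sub (topspace V) (K - 2)"
  have 1: "insert y R \<in> Sub (topspace V) (K - 1)" "insert x' R \<in> Sub (topspace V) (K - 1)"
    using insert_in_Sub[OF R] V K by auto
  have "\<bar>\<nu> (insert x (insert y R)) - \<nu> (insert x' (insert y R))\<bar> \<le> d x x'"
    by (rule d_upper) (use V 1 in auto)
  moreover have "\<bar>\<nu> (insert y (insert x' R)) - \<nu> (insert y' (insert x' R))\<bar> \<le> d y y'"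
    by (rule d_upper) (use V 1 in auto)
  moreover have "\<bar>\<nu> (insert x' (insert y' R))\<bar> \<le> strength x' y'"
    by (rule strength_upper[OF K V(3,4) R])
  ultimately show "\<bar>\<nu> (insert x (insert y R))\<bar> \<le> strength x' y' + (d x x' + d y y')"
    by (simp add: insert_commute)
qed

lemma strength_lipschitz:
  assumes K: "K \<ge> 2" and V: "x \<in> topspace V" "y \<in> topspace V" "x' \<in> topspace V" "y' \<in> topspace V"
  shows "\<bar>strength x y - strength x' y'\<bar> \<le> d x x' + d y y'"
  using strength_lipschitz_aux[OF K V] strength_lipschitz_aux[OF K V(3,4,1,2)]
    d_commute[of x x'] d_commute[of y y'] by linarith

end

section \<open>The snapping rule and its cut-off for a fixed threshold\<close>

locale supported_Sub_function = Sub_function +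
  assumes supp_nonempty: "supp \<noteq> {}" and K2: "K \<ge> 2"
begin

definition proj :: "'a \<Rightarrow> 'a" where
  "proj x = (SOME z. z \<in> supp \<and> (\<forall>y\<in>supp. d x z \<le> d x y))"

definition gap :: "'a \<Rightarrow> real" where
  "gap x = d x (proj x)"

definition net :: "nat \<Rightarrow> 'a" where
  "net = (SOME z. (\<forall>i. z i \<in> supp) \<and> (\<forall>x\<in>supp. \<forall>e>0. \<exists>i. d x (z i) < e))"

text \<open>For \<open>gap x > 0\<close> the chosen index changes, as t varies, only at ratios
  \<open>d x (net i) / gap x\<close>, which form a countable set. For \<open>gap x = 0\<close> no
  point satisfies the strict inequality, and a nearest point, at distance 0, is taken
  instead.\<close>

definition snap :: "real \<Rightarrow> 'a \<Rightarrow> 'a" where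
  "snap t x = (if gap x = 0 then proj x else net (LEAST i. d x (net i) < t * gap x))"

text \<open>The displacement scale of a pair is weighed against the size of \<nu> on sets containing
  it. On an edge the strength is 0, so any vertex of it off the support in the sense of
  \<open>d\<close> triggers the cut-off. The condition concerns pairs only, which is what makes it
  factor in \<open>admissible_union\<close>.\<close>

definition admissible :: "real \<Rightarrow> 'a set \<Rightarrow> bool" where
  "admissible t S \<longleftrightarrow> (\<forall>x\<in>S. \<forall>y\<in>S. t * max (gap x) (gap y) \<le> strength x y)"

lemma proj_supp: "x \<in> topspace V \<Longrightarrow> proj x \<in> supp"
  and proj_least: "x \<in> topspace V \<Longrightarrow> y \<in> supp \<Longrightarrow> d x (proj x) \<le> d x y"
proof -
  assume x: "x \<in> topspace V"
  from someI_ex[OF nearest_point[OF supp_nonempty x]]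
  show "proj x \<in> supp" "y \<in> supp \<Longrightarrow> d x (proj x) \<le> d x y" by (auto simp: proj_def)
qed

lemma net_supp: "net i \<in> supp"
  and net_dense: "x \<in> supp \<Longrightarrow> e > 0 \<Longrightarrow> \<exists>i. d x (net i) < e"
  using someI_ex[OF dense_sequence[OF supp_nonempty]] by (auto simp: net_def)

lemma in_V: "x \<in> supp \<Longrightarrow> x \<in> topspace V"
  using supp_subset by blast

lemma gap_nonneg: "x \<in> topspace V \<Longrightarrow> 0 \<le> gap x"
  using d_nonneg[of x "proj x"] in_V[OF proj_supp[of x]] by (simp add: gap_def)

lemma gap_supp: "x \<in> supp \<Longrightarrow> gap x = 0"
  using proj_least[of x x] gap_nonneg[of x] in_V by (force simp: gap_def)

lemma gap_lipschitz_aux: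
  assumes "x \<in> topspace V" "y \<in> topspace V"
  shows "gap y \<le> gap x + d x y"
proof -
  have "gap y \<le> d y (proj x)" unfolding gap_def by (rule proj_least[OF assms(2) proj_supp[OF assms(1)]])
  also have "\<dots> \<le> d y x + d x (proj x)"
    by (rule d_triangle[OF assms(2,1) in_V[OF proj_supp[OF assms(1)]]])
  finally show ?thesis by (simp add: gap_def d_commute)
qed

lemma gap_lipschitz:
  assumes "x \<in> topspace V" "y \<in> topspace V"
  shows "\<bar>gap x - gap y\<bar> \<le> d x y"
  using gap_lipschitz_aux[OF assms] gap_lipschitz_aux[OF assms(2,1)] d_commute[of x y] by linarith

lemma snap_supp: "x \<in> topspace V \<Longrightarrow> snap t x \<in> supp"
  by (simp add: snap_def proj_supp net_supp)

text \<open>The nearest point of the support has distance \<open>gap x\<close>, and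
  \<open>t > 1\<close> leaves a margin of \<open>(t - 1) * gap x\<close> for approximating it by the
  net.\<close>

lemma net_close:
  assumes x: "x \<in> topspace V" and g: "gap x \<noteq> 0" and t: "t > 1"
  shows "\<exists>i. d x (net i) < t * gap x"
proof -
  have gp: "gap x > 0" using g gap_nonneg[OF x] by simp
  then have "(t - 1) * gap x > 0" using t by simp
  from net_dense[OF proj_supp[OF x] this] obtain i where i: "d (proj x) (net i) < (t - 1) * gap x" ..
  have "d x (net i) \<le> d x (proj x) + d (proj x) (net i)"
    by (intro d_triangle x in_V proj_supp net_supp)
  then show ?thesis using i by (intro exI[of _ i]) (simp add: gap_def algebra_simps)
qed

lemma snap_close:
  assumes x: "x \<in> topspace V" and t: "1 < t" "t < 2"
  shows "d x (snap t x) \<le> 2 * gap x"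
proof (cases "gap x = 0")
  case True
  then show ?thesis by (simp add: snap_def gap_def)
next
  case False
  have "d x (snap t x) < t * gap x"
    using LeastI_ex[OF net_close[OF x False t(1)]] False by (simp add: snap_def)
  also have "\<dots> \<le> 2 * gap x" using t gap_nonneg[OF x] by (intro mult_right_mono) auto
  finally show ?thesis by simp
qed

text \<open>If \<open>gap x = 0\<close>, both the vertex and its neighbours move by at most twice
  their gaps, which tend to 0. If \<open>gap x > 0\<close>, all comparisons up to the first
  successful index are strict and hence persist near \<open>x\<close>, so eventually the very same
  net point is chosen.\<close>

lemma snap_limit:
  assumes x: "x \<in> topspace V" and w: "\<And>n. w n \<in> topspace V" and lim: "(\<lambda>n. d x (w n)) \<longlonglongrightarrow> 0"
    and t: "1 < t" "t < 2"
    and generic: "\<And>m. gap x \<noteq> 0 \<Longrightarrow> t * gap x \<noteq> d x (net m)"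
  shows "(\<lambda>n. d (snap t x) (snap t (w n))) \<longlonglongrightarrow> 0"
proof -
  have glim: "(\<lambda>n. gap (w n)) \<longlonglongrightarrow> gap x"
  proof -
    have "(\<lambda>n. gap (w n) - gap x) \<longlonglongrightarrow> 0"
      by (rule Lim_null_comparison[OF _ lim])
        (use gap_lipschitz[OF x w] in \<open>simp add: abs_minus_commute\<close>)
    then show ?thesis by (simp add: LIM_zero_iff)
  qed
  show ?thesis
  proof (cases "gap x = 0")
    case True
    have "(\<lambda>n. d x (w n) + 2 * gap (w n)) \<longlonglongrightarrow> 0 + 2 * 0"
      by (intro tendsto_intros lim) (use glim True in simp)
    then have l: "(\<lambda>n. d x (w n) + 2 * gap (w n)) \<longlonglongrightarrow> 0" by simp
    show ?thesis
    proof (rule Lim_null_comparison[OF always_eventually l], rule allI)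
      fix n
      have s: "snap t x \<in> topspace V" "snap t (w n) \<in> topspace V"
        using snap_supp x w in_V by auto
      have "d (snap t x) (snap t (w n)) \<le> d (snap t x) x + (d x (w n) + d (w n) (snap t (w n)))"
        using d_triangle[OF s(1) x s(2)] d_triangle[OF x w s(2)] by (simp add: add_mono order_trans)
      moreover have "d (snap t x) x \<le> 0" using snap_close[OF x t] True by (simp add: d_commute)
      moreover have "d (w n) (snap t (w n)) \<le> 2 * gap (w n)" by (rule snap_close[OF w t])
      ultimately show "norm (d (snap t x) (snap t (w n))) \<le> d x (w n) + 2 * gap (w n)"
        using d_nonneg[OF s] by simp
    qed
  next
    case False
    then have gp: "gap x > 0" using gap_nonneg[OF x] by simp
    have dlim: "(\<lambda>n. d (w n) (net m)) \<longlonglongrightarrow> d x (net m)" for m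
    proof -
      have "(\<lambda>n. d (w n) (net m) - d x (net m)) \<longlonglongrightarrow> 0"
        by (rule Lim_null_comparison[OF _ lim])
          (use d_reverse_triangle[OF w in_V[OF net_supp[of m]] x in_V[OF net_supp[of m]]] in \<open>simp add: d_commute[of _ x]\<close>)
      then show ?thesis by (simp add: LIM_zero_iff)
    qed
    define N where "N = (LEAST i. d x (net i) < t * gap x)"
    have N: "d x (net N) < t * gap x"
      unfolding N_def by (rule LeastI_ex[OF net_close[OF x False t(1)]])
    \<comment> \<open>Minimality gives only a weak inequality; genericity of \<open>t\<close> makes
      it strict, so that no earlier index becomes eligible along the sequence.\<close>
    have below: "t * gap x < d x (net m)" if "m < N" for m
      using not_less_Least[of m "\<lambda>i. d x (net i) < t * gap x"] that generic[OF False, of m] by (simp add: N_def)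
    have tlim: "(\<lambda>n. t * gap (w n)) \<longlonglongrightarrow> t * gap x" by (intro tendsto_intros glim)
    have "\<forall>\<^sub>F n in sequentially. d (w n) (net N) < t * gap (w n)"
      by (rule eventually_less_LIMSEQ[OF dlim tlim N])
    moreover have "\<forall>\<^sub>F n in sequentially. \<forall>m\<in>{..<N}. t * gap (w n) < d (w n) (net m)"
      by (rule eventually_ball_finite) (use eventually_less_LIMSEQ[OF tlim dlim below] in auto)
    moreover have "\<forall>\<^sub>F n in sequentially. 0 < gap (w n)"
      by (rule order_tendstoD(1)[OF glim gp])
    ultimately have "\<forall>\<^sub>F n in sequentially. d (snap t x) (snap t (w n)) = 0"
    proof eventually_elim
      case (elim n)
      have "(LEAST i. d (w n) (net i) < t * gap (w n)) = N"
      proof (rule Least_equality)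
        show "d (w n) (net N) < t * gap (w n)" by (rule elim(1))
        fix m assume m: "d (w n) (net m) < t * gap (w n)"
        show "N \<le> m"
        proof (rule ccontr)
          assume "\<not> N \<le> m"
          then have "t * gap (w n) < d (w n) (net m)" using elim(2) by simp
          then show False using m by simp
        qed
      qed
      then show ?case using elim False by (simp add: snap_def N_def[symmetric])
    qed
    then show ?thesis by (rule tendsto_eventually)
  qed
qed

definition snapped :: "real \<Rightarrow> 'a set \<Rightarrow> real" where
  "snapped t S = \<nu> (snap t ` S) * of_bool (admissible t S)"

text \<open>For each vertex the snapped point depends on \<open>t\<close> through a measurable index
  with countably many values. Vertices are fixed one after the other, and each one already fixed is
  absorbed into \<open>F\<close>.\<close>

lemma measurable_snap_image:
  fixes F :: "'a set \<Rightarrow> real"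
  assumes "finite S" "S \<subseteq> topspace V"
  shows "(\<lambda>t. F (snap t ` S)) \<in> borel_measurable borel"
  using assms
proof (induction S arbitrary: F rule: finite_induct)
  case empty
  then show ?case by simp
next
  case (insert x S)
  have IH: "(\<lambda>t. F (insert y (snap t ` S))) \<in> borel_measurable borel" for y
    using insert.IH[of "\<lambda>X. F (insert y X)"] insert.prems by simp
  show ?case
  proof (cases "gap x = 0")
    case True
    then show ?thesis using IH[of "proj x"] by (simp add: snap_def)
  next
    case False
    have "(\<lambda>t. LEAST i. d x (net i) < t * gap x) \<in> measurable borel (count_space UNIV)"
      by measurable
    from measurable_compose_countable[OF IH this, of net]
    show ?thesis using False by (simp add: snap_def)
  qed
qed

lemma measurable_snapped:
  assumes "finite S" "S \<subseteq> topspace V"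
  shows "(\<lambda>t. snapped t S) \<in> borel_measurable borel"
proof -
  have "{t \<in> space borel. \<forall>x\<in>S. \<forall>y\<in>S. t * max (gap x) (gap y) \<le> strength x y} \<in> sets borel"
    by (intro sets.sets_Collect_finite_All assms(1)) measurable
  then have "(\<lambda>t. of_bool (admissible t S) :: real) \<in> borel_measurable borel"
    by (auto simp: admissible_def of_bool_def intro!: measurable_If)
  then show ?thesis
    unfolding snapped_def using measurable_snap_image[OF assms] by (rule borel_measurable_times[rotated])
qed

lemma snap_image_Sub: "S \<in> Sub (topspace V) n \<Longrightarrow> snap t ` S \<in> Sub supp n"
  using snap_supp by (auto simp: Sub_def intro: card_image_le le_trans)

lemma Sub_supp: "Sub supp n \<subseteq> Sub (topspace V) n"
  using supp_subset by (auto simp: Sub_def)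

lemma snapped_bounded: "\<exists>B. \<forall>t. \<forall>S\<in>Sub (topspace V) K. \<bar>snapped t S\<bar> \<le> B"
proof -
  obtain B where B: "\<forall>S\<in>Sub (topspace V) K. \<bar>\<nu> S\<bar> \<le> B" using bounded_fun by blast
  have "\<bar>snapped t S\<bar> \<le> B" if "S \<in> Sub (topspace V) K" for t S
  proof -
    have "snap t ` S \<in> Sub (topspace V) K" using snap_image_Sub[OF that] Sub_supp by blast
    then have "\<bar>\<nu> (snap t ` S)\<bar> \<le> B" using B by blast
    then show ?thesis by (auto simp: snapped_def)
  qed
  then show ?thesis by blast
qed

text \<open>A support point may be snapped to a different point, but one at distance 0, which \<nu>
  cannot distinguish. All gaps vanish, so admissibility is nonnegativity of
  \<open>strength\<close>.\<close>

lemma snapped_supp: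
  assumes S: "S \<in> Sub supp K" and t: "1 < t" "t < 2"
  shows "snapped t S = \<nu> S"
proof -
  have SV: "finite S" "S \<subseteq> topspace V" "card S \<le> K" "\<And>x. x \<in> S \<Longrightarrow> x \<in> supp"
    using S supp_subset by (auto simp: Sub_def)
  have adm: "admissible t S"
    unfolding admissible_def
  proof (intro ballI)
    fix x y assume xy: "x \<in> S" "y \<in> S"
    then have "0 \<le> strength x y" using SV(2) by (intro strength_nonneg K2) auto
    then show "t * max (gap x) (gap y) \<le> strength x y" using gap_supp[OF SV(4)] xy by simp
  qed
  have "d x (snap t x) = 0" if x: "x \<in> S" for x
    using snap_close[OF _ t, of x] gap_supp[OF SV(4)[OF x]] d_nonneg[of x "snap t x"] snap_supp[of x t]
      SV(2) x in_V by force
  then have "(\<Sum>x\<in>S. d (id x) (snap t x)) = 0" by simp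
  moreover have "\<bar>\<nu> (id ` S \<union> {}) - \<nu> (snap t ` S \<union> {})\<bar> \<le> (\<Sum>x\<in>S. d (id x) (snap t x))"
    using SV snap_supp in_V by (intro lipschitz) auto
  ultimately show ?thesis using adm by (simp add: snapped_def)
qed

text \<open>The snapped set contains the images of \<open>x\<close> and \<open>y\<close>, so \<nu>
  on it is bounded by their strength. That strength is Lipschitz, and each of the two has moved by
  at most twice its gap.\<close>

lemma snapped_weak:
  assumes S: "S \<in> Sub (topspace V) (K - 2)" and xy: "x \<in> S" "y \<in> S" and t: "1 < t" "t < 2"
  shows "\<bar>\<nu> (snap t ` S)\<bar> \<le> strength x y + (2 * gap x + 2 * gap y)"
proof -
  have V: "x \<in> topspace V" "y \<in> topspace V" using S xy by (auto simp: Sub_def)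
  have sV: "snap t x \<in> topspace V" "snap t y \<in> topspace V" using V snap_supp in_V by auto
  have "snap t ` S \<in> Sub (topspace V) (K - 2)" using snap_image_Sub[OF S] Sub_supp by blast
  \<comment> \<open>The whole snapped set is used as \<open>R\<close>, into which the two points are
    inserted without changing it. Hence the bound \<open>K - 2\<close> on \<open>S\<close>,
    inherited by the continuity and vanishing of the extension.\<close>
  from strength_upper[OF K2 sV this]
  have "\<bar>\<nu> (insert (snap t x) (insert (snap t y) (snap t ` S)))\<bar> \<le> strength (snap t x) (snap t y)" .
  moreover have "insert (snap t x) (insert (snap t y) (snap t ` S)) = snap t ` S" using xy by auto
  moreover have "strength (snap t x) (snap t y) \<le> strength x y + (d (snap t x) x + d (snap t y) y)"
    by (rule strength_lipschitz_aux[OF K2 sV V])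
  moreover have "d (snap t x) x \<le> 2 * gap x" "d (snap t y) y \<le> 2 * gap y"
    using snap_close[OF V(1) t] snap_close[OF V(2) t] by (simp_all add: d_commute)
  ultimately show ?thesis by simp
qed

text \<open>Applied to edges. If both gaps are 0, the bound of \<open>snapped_weak\<close> is 0; if
  one is positive, the pair violates admissibility.\<close>

lemma snapped_zero:
  assumes S: "S \<in> Sub (topspace V) (K - 2)" and xy: "x \<in> S" "y \<in> S" and t: "1 < t" "t < 2"
    and str: "strength x y = 0"
  shows "snapped t S = 0"
proof (cases "gap x = 0 \<and> gap y = 0")
  case True
  then show ?thesis using snapped_weak[OF S xy t] str by (simp add: snapped_def)
next
  case False
  have "0 \<le> gap x" "0 \<le> gap y" using S xy gap_nonneg by (auto simp: Sub_def)
  then have "max (gap x) (gap y) > 0" using False by auto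
  then have "t * max (gap x) (gap y) > strength x y" using t str by simp
  then have "\<not> admissible t S" using xy by (auto simp: admissible_def not_le)
  then show ?thesis by (simp add: snapped_def)
qed

text \<open>The critical situation is a pair whose gaps and strength all vanish at the limit:
  admissibility may then oscillate along the sequence, but \<open>snapped_weak\<close> squeezes the
  values to 0. Without such a pair every comparison at the limit is strict, so admissibility is
  eventually constant and convergence of the snapped vertices suffices.\<close>

lemma snapped_limit:
  assumes I: "finite I" "card I \<le> K - 2" and v: "v \<in> I \<rightarrow> topspace V" and w: "\<And>n. w n \<in> I \<rightarrow> topspace V"
    and lim: "\<And>i. i \<in> I \<Longrightarrow> (\<lambda>n. d (v i) (w n i)) \<longlonglongrightarrow> 0"
    and t: "1 < t" "t < 2"
    and generic_net: "\<And>i m. i \<in> I \<Longrightarrow> gap (v i) \<noteq> 0 \<Longrightarrow> t * gap (v i) \<noteq> d (v i) (net m)"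
    and generic_strength: "\<And>i j. i \<in> I \<Longrightarrow> j \<in> I \<Longrightarrow> max (gap (v i)) (gap (v j)) \<noteq> 0 \<Longrightarrow>
      t * max (gap (v i)) (gap (v j)) \<noteq> strength (v i) (v j)"
  shows "(\<lambda>n. snapped t (w n ` I)) \<longlonglongrightarrow> snapped t (v ` I)"
proof -
  have vV: "v i \<in> topspace V" and wV: "w n i \<in> topspace V" if "i \<in> I" for i n
    using v w that by auto
  have glim: "(\<lambda>n. gap (w n i)) \<longlonglongrightarrow> gap (v i)" if i: "i \<in> I" for i
  proof -
    have "(\<lambda>n. gap (w n i) - gap (v i)) \<longlonglongrightarrow> 0"
      by (rule Lim_null_comparison[OF _ lim[OF i]])
        (use gap_lipschitz[OF vV wV] i in \<open>simp add: abs_minus_commute\<close>)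
    then show ?thesis by (simp add: LIM_zero_iff)
  qed
  have slim: "(\<lambda>n. strength (w n i) (w n j)) \<longlonglongrightarrow> strength (v i) (v j)" if ij: "i \<in> I" "j \<in> I" for i j
  proof -
    have "(\<lambda>n. d (v i) (w n i) + d (v j) (w n j)) \<longlonglongrightarrow> 0"
      using tendsto_add[OF lim[OF ij(1)] lim[OF ij(2)]] by simp
    then have "(\<lambda>n. strength (w n i) (w n j) - strength (v i) (v j)) \<longlonglongrightarrow> 0"
      by (rule Lim_null_comparison[rotated])
        (use strength_lipschitz[OF K2 vV vV wV wV] ij in \<open>simp add: abs_minus_commute\<close>)
    then show ?thesis by (simp add: LIM_zero_iff)
  qed
  have mlim: "(\<lambda>n. t * max (gap (w n i)) (gap (w n j))) \<longlonglongrightarrow> t * max (gap (v i)) (gap (v j))"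
    if "i \<in> I" "j \<in> I" for i j
    by (intro tendsto_intros glim that)
  have vS: "v ` I \<in> Sub (topspace V) (K - 2)" and wS: "w n ` I \<in> Sub (topspace V) (K - 2)" for n
    using vV wV I card_image_le[OF I(1), of v] card_image_le[OF I(1), of "w n"] by (auto simp: Sub_def)
  show ?thesis
  proof (cases "\<exists>i\<in>I. \<exists>j\<in>I. gap (v i) = 0 \<and> gap (v j) = 0 \<and> strength (v i) (v j) = 0")
    case True
    then obtain i j where ij: "i \<in> I" "j \<in> I" "gap (v i) = 0" "gap (v j) = 0" "strength (v i) (v j) = 0" by blast
    have "snapped t (v ` I) = 0"
      by (rule snapped_zero[OF vS _ _ t ij(5)]) (use ij in auto)
    moreover have "(\<lambda>n. snapped t (w n ` I)) \<longlonglongrightarrow> 0"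
    proof (rule Lim_null_comparison)
      have "(\<lambda>n. strength (w n i) (w n j) + (2 * gap (w n i) + 2 * gap (w n j)))
          \<longlonglongrightarrow> strength (v i) (v j) + (2 * gap (v i) + 2 * gap (v j))"
        by (intro tendsto_intros slim glim ij)
      then show "(\<lambda>n. strength (w n i) (w n j) + (2 * gap (w n i) + 2 * gap (w n j))) \<longlonglongrightarrow> 0"
        by (simp add: ij)
      have "norm (snapped t (w n ` I)) \<le> strength (w n i) (w n j) + (2 * gap (w n i) + 2 * gap (w n j))" for n
      proof -
        have "\<bar>\<nu> (snap t ` w n ` I)\<bar> \<le> strength (w n i) (w n j) + (2 * gap (w n i) + 2 * gap (w n j))"
          by (rule snapped_weak[OF wS _ _ t]) (use ij in auto)
        moreover have "norm (snapped t (w n ` I)) \<le> \<bar>\<nu> (snap t ` w n ` I)\<bar>"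
          by (simp add: snapped_def)
        ultimately show ?thesis by linarith
      qed
      then show "\<forall>\<^sub>F n in sequentially. norm (snapped t (w n ` I))
          \<le> strength (w n i) (w n j) + (2 * gap (w n i) + 2 * gap (w n j))" by simp
    qed
    ultimately show ?thesis by simp
  next
    case False
    have pair: "\<forall>\<^sub>F n in sequentially. (t * max (gap (w n i)) (gap (w n j)) \<le> strength (w n i) (w n j))
        = (t * max (gap (v i)) (gap (v j)) \<le> strength (v i) (v j))" if ij: "i \<in> I" "j \<in> I" for i j
    proof -
      \<comment> \<open>Genericity excludes equality when some gap is nonzero. When both gaps are 0,
        equality would make the pair critical, a case already settled.\<close>
      have ne: "t * max (gap (v i)) (gap (v j)) \<noteq> strength (v i) (v j)"
      proof (cases "max (gap (v i)) (gap (v j)) = 0")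
        case True
        then have "gap (v i) = 0" "gap (v j) = 0"
          using gap_nonneg[OF vV[OF ij(1)]] gap_nonneg[OF vV[OF ij(2)]] by (auto simp: max_def split: if_splits)
        then show ?thesis using False ij by auto
      qed (rule generic_strength[OF ij])
      show ?thesis
      proof (cases "t * max (gap (v i)) (gap (v j)) < strength (v i) (v j)")
        case True
        have "\<forall>\<^sub>F n in sequentially. t * max (gap (w n i)) (gap (w n j)) < strength (w n i) (w n j)"
          by (rule eventually_less_LIMSEQ[OF mlim[OF ij] slim[OF ij] True])
        then show ?thesis by eventually_elim (use True in auto)
      next
        case F: False
        then have lt: "strength (v i) (v j) < t * max (gap (v i)) (gap (v j))" using ne by simp
        have "\<forall>\<^sub>F n in sequentially. strength (w n i) (w n j) < t * max (gap (w n i)) (gap (w n j))"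
          by (rule eventually_less_LIMSEQ[OF slim[OF ij] mlim[OF ij] lt])
        then show ?thesis by eventually_elim (use lt in auto)
      qed
    qed
    have "\<forall>\<^sub>F n in sequentially. \<forall>i\<in>I. \<forall>j\<in>I. (t * max (gap (w n i)) (gap (w n j)) \<le> strength (w n i) (w n j))
        = (t * max (gap (v i)) (gap (v j)) \<le> strength (v i) (v j))"
      by (intro eventually_ball_finite[OF I(1)] ballI pair)
    then have adm: "\<forall>\<^sub>F n in sequentially. admissible t (w n ` I) = admissible t (v ` I)"
      by eventually_elim (auto simp: admissible_def)
    have "(\<lambda>n. \<Sum>i\<in>I. d (snap t (v i)) (snap t (w n i))) \<longlonglongrightarrow> (\<Sum>i\<in>I. 0)"
      by (intro tendsto_sum snap_limit t generic_net lim) (auto intro: vV wV)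
    then have sl: "(\<lambda>n. \<Sum>i\<in>I. d (snap t (v i)) (snap t (w n i))) \<longlonglongrightarrow> 0" by simp
    have "(\<lambda>n. \<nu> (snap t ` w n ` I) - \<nu> (snap t ` v ` I)) \<longlonglongrightarrow> 0"
    proof (rule Lim_null_comparison[OF always_eventually sl], rule allI)
      fix n
      have "\<bar>\<nu> ((\<lambda>i. snap t (v i)) ` I \<union> {}) - \<nu> ((\<lambda>i. snap t (w n i)) ` I \<union> {})\<bar>
          \<le> (\<Sum>i\<in>I. d (snap t (v i)) (snap t (w n i)))"
        by (rule lipschitz) (use I vV wV snap_supp in_V in auto)
      then show "norm (\<nu> (snap t ` w n ` I) - \<nu> (snap t ` v ` I)) \<le> (\<Sum>i\<in>I. d (snap t (v i)) (snap t (w n i)))"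
        by (simp add: image_image abs_minus_commute)
    qed
    then have "(\<lambda>n. \<nu> (snap t ` w n ` I)) \<longlonglongrightarrow> \<nu> (snap t ` v ` I)" by (simp add: LIM_zero_iff)
    then have "(\<lambda>n. \<nu> (snap t ` w n ` I) * of_bool (admissible t (v ` I))) \<longlonglongrightarrow> snapped t (v ` I)"
      unfolding snapped_def by (intro tendsto_intros)
    then show ?thesis
      by (rule Lim_transform_eventually) (use adm in eventually_elim, simp add: snapped_def)
  qed
qed

end

section \<open>Comparison with the Lasserre hierarchy\<close>

text \<open>The uniform distribution on (1, 2). Total mass 1 preserves values on the support, and
  the absence of atoms makes countable sets of thresholds negligible.\<close>

definition threshold_measure :: "real measure" where
  "threshold_measure = restrict_space lborel {1<..<2}"

lemma space_threshold_measure [simp]: "space threshold_measure = {1<..<2}"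
  by (simp add: threshold_measure_def space_restrict_space)

lemma emeasure_threshold_measure: "emeasure threshold_measure {1<..<2} = 1"
  by (simp add: threshold_measure_def emeasure_restrict_space)

lemma measure_threshold_measure [simp]: "measure threshold_measure {1<..<2} = 1"
  by (simp add: measure_def emeasure_threshold_measure)

interpretation threshold: finite_measure threshold_measure
  by standard (simp add: emeasure_threshold_measure)

lemma measurable_threshold: "f \<in> borel_measurable borel \<Longrightarrow> f \<in> borel_measurable threshold_measure"
  unfolding threshold_measure_def by (rule measurable_restrict_space1) simp

lemma AE_threshold_countable:
  assumes "countable C"
  shows "AE t in threshold_measure. t \<notin> C"
proof -
  have "C \<in> null_sets lborel" by (rule countable_imp_null_set_lborel[OF assms])
  then have "AE t in lborel. t \<notin> C" by (rule AE_not_in)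
  then show ?thesis
    unfolding threshold_measure_def by (subst AE_restrict_space_iff) auto
qed

context supported_Sub_function
begin

definition extension :: "'a set \<Rightarrow> real" where
  "extension S = (\<integral>t. snapped t S \<partial>threshold_measure)"

lemma integrable_snapped:
  assumes S: "S \<in> Sub (topspace V) K"
  shows "integrable threshold_measure (\<lambda>t. snapped t S)"
proof -
  obtain B where "\<forall>t. \<forall>S\<in>Sub (topspace V) K. \<bar>snapped t S\<bar> \<le> B" using snapped_bounded by blast
  then have "AE t in threshold_measure. norm (snapped t S) \<le> B" using S by simp
  moreover have "(\<lambda>t. snapped t S) \<in> borel_measurable threshold_measure"
    by (intro measurable_threshold measurable_snapped) (use S in \<open>auto simp: Sub_def\<close>)
  ultimately show ?thesis by (rule threshold.integrable_const_bound)
qed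

lemma extension_supp:
  assumes "S \<in> Sub supp K"
  shows "extension S = \<nu> S"
proof -
  have "extension S = (\<integral>t. \<nu> S \<partial>threshold_measure)"
    unfolding extension_def
    by (rule Bochner_Integration.integral_cong) (use snapped_supp[OF assms] in auto)
  then show ?thesis by simp
qed

lemma extension_zero:
  assumes "S \<in> Sub (topspace V) (K - 2)" "x \<in> S" "y \<in> S" "strength x y = 0"
  shows "extension S = 0"
proof -
  have "extension S = (\<integral>t. 0 \<partial>threshold_measure)"
    unfolding extension_def
    by (rule Bochner_Integration.integral_cong) (use snapped_zero[OF assms(1-3) _ _ assms(4)] in auto)
  then show ?thesis by simp
qed

text \<open>Dominated convergence: for each limit tuple \<open>v\<close>, the snapped values
  converge for all but countably many thresholds. The exceptional set depends on \<open>v\<close>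
  alone and serves every sequence converging to it.\<close>

lemma continuous_map_extension:
  assumes n: "n \<ge> 1" "n \<le> K - 2"
  shows "continuous_map (Sub_topology V n) euclideanreal extension"
proof (rule continuous_map_Sub_topologyI[OF n(1)])
  show "continuous_map (product_topology (\<lambda>_. V) {..<n}) euclideanreal (\<lambda>v. extension (tuple_set n v))"
  proof (rule continuous_map_d_sequentialI)
    let ?I = "{..<n}"
    fix v w assume v: "v \<in> PiE ?I (\<lambda>_. topspace V)" and w: "\<And>m. w m \<in> PiE ?I (\<lambda>_. topspace V)"
      and lim: "\<And>i. i \<in> ?I \<Longrightarrow> (\<lambda>m. d (v i) (w m i)) \<longlonglongrightarrow> 0"
    have v': "v \<in> ?I \<rightarrow> topspace V" and w': "\<And>m. w m \<in> ?I \<rightarrow> topspace V"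
      using v w by (auto simp: PiE_def)
    have Sub: "u ` ?I \<in> Sub (topspace V) K" if "u \<in> ?I \<rightarrow> topspace V" for u
      using that n card_image_le[of ?I u] by (auto simp: Sub_def)
    \<comment> \<open>The thresholds at which some comparison at \<open>v\<close> can become an
      equality. A quotient with denominator 0 has the default value 0, which lies outside (1,
      2).\<close>
    define C where "C = (\<Union>i\<in>?I. \<Union>m. {d (v i) (net m) / gap (v i)}) \<union>
      (\<Union>i\<in>?I. \<Union>j\<in>?I. {strength (v i) (v j) / max (gap (v i)) (gap (v j))})"
    have "countable C"
      unfolding C_def by (intro countable_Un countable_UN countableI_type countable_finite) auto
    then have AE: "AE t in threshold_measure. t \<notin> C" by (rule AE_threshold_countable)
    obtain B where B: "\<forall>t. \<forall>S\<in>Sub (topspace V) K. \<bar>snapped t S\<bar> \<le> B" using snapped_bounded by blast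
    have "(\<lambda>m. \<integral>t. snapped t (w m ` ?I) \<partial>threshold_measure) \<longlonglongrightarrow> (\<integral>t. snapped t (v ` ?I) \<partial>threshold_measure)"
    proof (rule integral_dominated_convergence[where w="\<lambda>_. B"])
      show "(\<lambda>t. snapped t (v ` ?I)) \<in> borel_measurable threshold_measure"
        "\<And>m. (\<lambda>t. snapped t (w m ` ?I)) \<in> borel_measurable threshold_measure"
        using integrable_snapped Sub v' w' by blast+
      show "AE t in threshold_measure. norm (snapped t (w m ` ?I)) \<le> B" for m
        using B Sub[OF w'] by simp
      show "AE t in threshold_measure. (\<lambda>m. snapped t (w m ` ?I)) \<longlonglongrightarrow> snapped t (v ` ?I)"
        using AE AE_space
      proof eventually_elim
        fix t assume t: "t \<notin> C" "t \<in> space threshold_measure"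
        show "(\<lambda>m. snapped t (w m ` ?I)) \<longlonglongrightarrow> snapped t (v ` ?I)"
        proof (rule snapped_limit[OF _ _ v' w' lim])
          fix i m assume i: "i \<in> ?I" "gap (v i) \<noteq> 0"
          have "d (v i) (net m) / gap (v i) \<in> C" using i(1) by (auto simp: C_def)
          then show "t * gap (v i) \<noteq> d (v i) (net m)"
            using t(1) i(2) by (metis nonzero_mult_div_cancel_right)
        next
          fix i j assume ij: "i \<in> ?I" "j \<in> ?I" "max (gap (v i)) (gap (v j)) \<noteq> 0"
          have "strength (v i) (v j) / max (gap (v i)) (gap (v j)) \<in> C" using ij(1,2) by (auto simp: C_def)
          then show "t * max (gap (v i)) (gap (v j)) \<noteq> strength (v i) (v j)"
            using t(1) ij(3) by (metis nonzero_mult_div_cancel_right)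
        qed (use t(2) n in auto)
      qed
    qed simp
    then show "(\<lambda>m. extension (tuple_set n (w m))) \<longlonglongrightarrow> extension (tuple_set n v)"
      by (simp add: extension_def tuple_set_def)
  qed simp
qed simp

definition compatible :: "real \<Rightarrow> 'a set \<Rightarrow> 'a set \<Rightarrow> bool" where
  "compatible t Q X \<longleftrightarrow> (\<forall>q\<in>Q. \<forall>x\<in>X.
    t * max (gap q) (gap x) \<le> strength q x \<and> t * max (gap x) (gap q) \<le> strength x q)"

text \<open>Points of the support have gap 0, so pairs within \<open>S \<union> T\<close> satisfy
  the condition automatically. No constraint couples \<open>S\<close> with \<open>T\<close>; what
  remains couples \<open>Q\<close> with each of them separately.\<close>

lemma admissible_union:
  assumes S: "S \<subseteq> supp" and T: "T \<subseteq> supp"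
  shows "admissible t (Q \<union> S \<union> T) \<longleftrightarrow> admissible t Q \<and> compatible t Q S \<and> compatible t Q T"
proof -
  have "t * max (gap x) (gap y) \<le> strength x y" if xy: "x \<in> supp" "y \<in> supp" for x y
    using gap_supp[OF xy(1)] gap_supp[OF xy(2)] strength_nonneg[OF K2 in_V[OF xy(1)] in_V[OF xy(2)]] by simp
  then show ?thesis
    unfolding admissible_def compatible_def using S T by blast
qed

text \<open>For fixed \<open>t\<close>, admissibility of \<open>Q \<union> S \<union> T\<close> factors over \<open>S\<close> and \<open>T\<close>, so positivity of the
  moment matrix survives the cut-off, and averaging over \<open>t\<close> preserves it.\<close>

lemma extension_psd:
  fixes c :: "'a set \<Rightarrow> real"
  assumes k: "k \<ge> 1" "2 * k \<le> K" and psd: "psd_kernel (Sub_measure \<omega> k) (\<lambda>S T. \<nu> (S \<union> T))"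
    and Q: "Q \<in> Sub (topspace V) (k - 1)" and A: "finite A" "A \<subseteq> Sub supp 1"
  shows "0 \<le> (\<Sum>S\<in>A. \<Sum>T\<in>A. c S * c T * extension (Q \<union> S \<union> T))"
proof -
  have AV: "S \<subseteq> supp" "S \<subseteq> topspace V" "finite S" "card S \<le> 1" if "S \<in> A" for S
    using that A(2) supp_subset by (auto simp: Sub_def)
  have QV: "finite Q" "Q \<subseteq> topspace V" "card Q \<le> k - 1" using Q by (auto simp: Sub_def)
  have sub: "Q \<union> S \<union> T \<in> Sub (topspace V) K" if "S \<in> A" "T \<in> A" for S T
  proof -
    have "card (Q \<union> S \<union> T) \<le> card Q + card S + card T"
      using card_Un_le[of "Q \<union> S" T] card_Un_le[of Q S] by linarith
    then show ?thesis using QV AV[OF that(1)] AV[OF that(2)] k by (auto simp: Sub_def)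
  qed
  have pos: "0 \<le> (\<Sum>S\<in>A. \<Sum>T\<in>A. c S * c T * snapped t (Q \<union> S \<union> T))" for t
  proof -
    define u :: "'a set \<Rightarrow> real" where "u X = of_bool (compatible t Q X)" for X
    \<comment> \<open>The snapped \<open>Q\<close> is absorbed into the index sets: with at most
      \<open>k - 1\<close> vertices from \<open>Q\<close> and one from \<open>S\<close> they fit
      into \<open>Sub supp k\<close>, where positivity of the kernel of \<nu> can be evaluated.
      Distinct \<open>S\<close> may yield the same set.\<close>
    define s where "s S = snap t ` Q \<union> snap t ` S" for S
    have s: "s S \<in> Sub supp k" if "S \<in> A" for S
    proof -
      have "card (s S) \<le> card Q + card S"
        unfolding s_def using card_Un_le[of "snap t ` Q" "snap t ` S"]
          card_image_le[OF QV(1), of "snap t"] card_image_le[OF AV(3)[OF that], of "snap t"] by linarith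
      then show ?thesis
        using QV AV[OF that] k snap_supp by (auto simp: Sub_def s_def)
    qed
    have "0 \<le> (\<Sum>S\<in>A. \<Sum>T\<in>A. (c S * u S) * (c T * u T) * \<nu> ({} \<union> s S \<union> s T))"
      by (rule pointwise_psd[OF k(1) _ _ _ _ A(1) s]) (use k psd in auto)
    then have "0 \<le> of_bool (admissible t Q) * (\<Sum>S\<in>A. \<Sum>T\<in>A. (c S * u S) * (c T * u T) * \<nu> (s S \<union> s T))"
      by simp
    also have "\<dots> = (\<Sum>S\<in>A. \<Sum>T\<in>A. c S * c T * snapped t (Q \<union> S \<union> T))"
      unfolding sum_distrib_left
    proof (intro sum.cong refl)
      fix S T assume ST: "S \<in> A" "T \<in> A"
      have "of_bool (admissible t (Q \<union> S \<union> T)) = of_bool (admissible t Q) * u S * u T"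
        unfolding admissible_union[OF AV(1)[OF ST(1)] AV(1)[OF ST(2)]] u_def by simp
      moreover have "snap t ` (Q \<union> S \<union> T) = s S \<union> s T" by (auto simp: s_def)
      ultimately show "of_bool (admissible t Q) * ((c S * u S) * (c T * u T) * \<nu> (s S \<union> s T))
          = c S * c T * snapped t (Q \<union> S \<union> T)"
        by (simp add: snapped_def ac_simps)
    qed
    finally show ?thesis .
  qed
  have "0 \<le> (\<integral>t. (\<Sum>S\<in>A. \<Sum>T\<in>A. c S * c T * snapped t (Q \<union> S \<union> T)) \<partial>threshold_measure)"
    by (rule integral_nonneg_AE) (simp add: pos)
  also have "\<dots> = (\<Sum>S\<in>A. \<integral>t. (\<Sum>T\<in>A. c S * c T * snapped t (Q \<union> S \<union> T)) \<partial>threshold_measure)"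
    by (intro Bochner_Integration.integral_sum Bochner_Integration.integrable_sum integrable_mult_right integrable_snapped sub)
  also have "\<dots> = (\<Sum>S\<in>A. \<Sum>T\<in>A. \<integral>t. c S * c T * snapped t (Q \<union> S \<union> T) \<partial>threshold_measure)"
    by (intro sum.cong refl Bochner_Integration.integral_sum integrable_mult_right integrable_snapped sub)
  also have "\<dots> = (\<Sum>S\<in>A. \<Sum>T\<in>A. c S * c T * extension (Q \<union> S \<union> T))"
    by (simp add: extension_def)
  finally show ?thesis .
qed

end

text \<open>The sizes match exactly in the positivity condition: \<open>Q\<close> has at most
  \<open>(r + 3) - 2 = (r + 2) - 1\<close> vertices, which is the bound of
  \<open>extension_psd\<close> for \<open>k = r + 2\<close>. Continuity and vanishing need
  \<open>r + 3 \<le> 2 * (r + 2) - 2\<close>, that is, \<open>r \<ge> 1\<close>. The objective is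
  unchanged since almost every vertex lies in the support.\<close>

lemma lass_feasible_imp_Delta_feasible:
  assumes "radon_space V \<omega>" "radon_space.supp V \<omega> \<noteq> {}" and r: "r \<ge> 1"
    and feas: "lass_feasible V E \<omega> (r + 2) \<nu>"
  shows "\<exists>\<nu>'. Delta_feasible V E \<omega> (r + 3) \<nu>' \<and> (\<integral>x. \<nu>' {x} \<partial>\<omega>) = (\<integral>x. \<nu> {x} \<partial>\<omega>)"
proof -
  interpret radon_space V \<omega> by fact
  interpret N: supported_Sub_function V \<omega> "2 * (r + 2)" \<nu>
    by unfold_locales (use assms(2) feas in \<open>auto simp: lass_feasible_def\<close>)
  have psd: "psd_kernel (Sub_measure \<omega> (r + 2)) (\<lambda>S T. \<nu> (S \<union> T))"
    and zero: "\<And>S. S \<in> Sub (topspace V) (2 * (r + 2)) \<Longrightarrow> \<not> independent_set E S \<Longrightarrow> \<nu> S = 0"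
    and one: "\<nu> {} = 1"
    using feas by (auto simp: lass_feasible_def)
  have cont: "continuous_map (Sub_topology V (r + 3)) euclideanreal N.extension"
    by (rule N.continuous_map_extension) (use r in auto)
  interpret X: Sub_function V \<omega> "r + 3" N.extension
    by unfold_locales (use cont in auto)
  have "N.extension S = 0" if S: "S \<in> Sub (topspace V) (r + 3)" "\<not> independent_set E S" for S
  proof -
    obtain x y where xy: "x \<in> S" "y \<in> S" "(x, y) \<in> E"
      using S(2) by (auto simp: independent_set_def)
    then have V: "x \<in> topspace V" "y \<in> topspace V" using S(1) by (auto simp: Sub_def)
    \<comment> \<open>Every set containing both ends of the edge is dependent, so the strength of
      the edge is 0 and \<open>extension_zero\<close> applies.\<close>
    have "\<nu> (insert x (insert y R)) = 0" if R: "R \<in> Sub (topspace V) (2 * (r + 2) - 2)" for R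
    proof (rule zero)
      show "insert x (insert y R) \<in> Sub (topspace V) (2 * (r + 2))"
        by (rule insert_in_Sub[OF insert_in_Sub[OF R, of y "2 * (r + 2) - 1"]]) (use V in auto)
      show "\<not> independent_set E (insert x (insert y R))"
        using xy(3) by (auto simp: independent_set_def)
    qed
    then have "N.strength x y \<le> 0" by (intro N.strength_least) simp
    then have "N.strength x y = 0" using N.strength_nonneg[OF N.K2 V] by simp
    moreover have "S \<in> Sub (topspace V) (2 * (r + 2) - 2)" using S(1) r by (auto simp: Sub_def)
    ultimately show ?thesis using N.extension_zero xy by blast
  qed
  moreover have "psd_kernel (Sub_measure \<omega> 1) (\<lambda>S T. N.extension (Q \<union> S \<union> T))"
    if Q: "Q \<in> Sub (topspace V) (r + 3 - 2)" for Q
  proof (rule X.psd_kernel_Sub1I)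
    fix A and c :: "'a set \<Rightarrow> real" assume A: "finite A" "A \<subseteq> Sub supp 1"
    show "0 \<le> (\<Sum>S\<in>A. \<Sum>T\<in>A. c S * c T * N.extension (Q \<union> S \<union> T))"
      by (rule N.extension_psd[OF _ _ psd _ A]) (use Q in auto)
  qed (use Q in \<open>auto simp: Sub_def\<close>)
  moreover have "N.extension {} = 1"
    using N.extension_supp[of "{}"] one by (simp add: Sub_def)
  ultimately have "Delta_feasible V E \<omega> (r + 3) N.extension"
    using cont by (simp add: Delta_feasible_def)
  moreover have "(\<integral>x. N.extension {x} \<partial>\<omega>) = (\<integral>x. \<nu> {x} \<partial>\<omega>)"
  proof (rule integral_cong_AE[OF X.measurable_singleton_value N.measurable_singleton_value])
    show "AE x in \<omega>. N.extension {x} = \<nu> {x}"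
      using AE_supp by eventually_elim (rule N.extension_supp, simp add: Sub_def)
  qed
  ultimately show ?thesis by blast
qed

text \<open>The witness is the indicator of \<open>{{}}\<close>. For \<open>Q = {}\<close> its
  moment matrix has rank one, with the empty set as the only nonzero index; for other
  \<open>Q\<close> it is zero.\<close>

lemma Delta_nonneg:
  assumes "radon_space V \<omega>"
  shows "0 \<le> Delta V E \<omega> (r + 3)"
proof -
  interpret radon_space V \<omega> by fact
  let ?\<nu> = "\<lambda>S. of_bool (S = {}) :: real"
  have ne: "tuple_set (r + 3) v \<noteq> {}" for v :: "nat \<Rightarrow> 'a"
    by (simp add: tuple_set_def lessThan_empty_iff)
  have cont: "continuous_map (Sub_topology V (r + 3)) euclideanreal ?\<nu>"
    by (rule continuous_map_Sub_topologyI) (simp_all add: ne)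
  interpret X: Sub_function V \<omega> "r + 3" ?\<nu>
    by unfold_locales (use cont in auto)
  have "psd_kernel (Sub_measure \<omega> 1) (\<lambda>S T. ?\<nu> (Q \<union> S \<union> T))"
    if Q: "Q \<in> Sub (topspace V) (r + 3 - 2)" for Q
  proof (rule X.psd_kernel_Sub1I)
    fix A and c :: "'a set \<Rightarrow> real"
    have "(\<Sum>S\<in>A. \<Sum>T\<in>A. c S * c T * ?\<nu> (Q \<union> S \<union> T)) = of_bool (Q = {}) * (\<Sum>S\<in>A. c S * ?\<nu> S)\<^sup>2"
      unfolding power2_eq_square sum_product
      unfolding sum_distrib_left by (intro sum.cong refl) auto
    also have "\<dots> \<ge> 0" by simp
    finally show "0 \<le> (\<Sum>S\<in>A. \<Sum>T\<in>A. c S * c T * ?\<nu> (Q \<union> S \<union> T))" .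
  qed (use Q in \<open>auto simp: Sub_def\<close>)
  then have "Delta_feasible V E \<omega> (r + 3) ?\<nu>"
    using cont by (auto simp: Delta_feasible_def independent_set_def)
  then have "ereal (\<integral>x. ?\<nu> {x} \<partial>\<omega>) \<le> Delta V E \<omega> (r + 3)"
    unfolding Delta_def by (intro Sup_upper CollectI exI[of _ ?\<nu>] conjI refl)
  then show ?thesis by (simp add: zero_ereal_def)
qed

lemma lass_le_Delta:
  assumes "radon_space V \<omega>" "r \<ge> 1"
  shows "lass V E \<omega> (r + 2) \<le> Delta V E \<omega> (r + 3)"
  unfolding lass_def
proof (rule Sup_least)
  interpret radon_space V \<omega> by fact
  fix z assume "z \<in> {ereal (\<integral>x. \<nu> {x} \<partial>\<omega>) |\<nu>. lass_feasible V E \<omega> (r + 2) \<nu>}"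
  then obtain \<nu> where z: "z = ereal (\<integral>x. \<nu> {x} \<partial>\<omega>)" and feas: "lass_feasible V E \<omega> (r + 2) \<nu>" by blast
  show "z \<le> Delta V E \<omega> (r + 3)"
  proof (cases "supp = {}")
    \<comment> \<open>Without support points there is nothing to snap to. Almost every vertex lies
      in the empty support, so all integrals over \<omega> vanish and nonnegativity of
      \<open>Delta\<close> is enough.\<close>
    case True
    then have "AE x in \<omega>. \<nu> {x} = 0" using AE_supp by (auto elim: eventually_mono)
    then have "(\<integral>x. \<nu> {x} \<partial>\<omega>) = 0" by (rule integral_eq_zero_AE)
    then show ?thesis using Delta_nonneg[OF assms(1)] z by (simp add: zero_ereal_def)
  next
    case False
    then obtain \<nu>' where "Delta_feasible V E \<omega> (r + 3) \<nu>'" "(\<integral>x. \<nu>' {x} \<partial>\<omega>) = (\<integral>x. \<nu> {x} \<partial>\<omega>)"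
      using lass_feasible_imp_Delta_feasible[OF assms(1) _ assms(2) feas] by blast
    then show ?thesis unfolding Delta_def z by (intro Sup_upper CollectI exI[of _ \<nu>']) simp
  qed
qed

theorem theorem4p3:
  fixes V :: "'a topology" and E :: "('a \<times> 'a) set" and \<omega> :: "'a measure" and r :: nat
  assumes "topological_graph V E"
    and "compact_space V" and "Hausdorff_space V"
    and "Radon_measure_on V \<omega>"
    and "r \<ge> 1"
  shows "lass V E \<omega> (r + 2) \<le> Delta V E \<omega> (r + 3) \<and> Delta V E \<omega> (r + 3) \<le> gamma V E \<omega> r"
proof -
  have "radon_space V \<omega>" using assms by (simp add: radon_space_def)
  then show ?thesis using lass_le_Delta Delta_le_gamma assms by blast
qed

end
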